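(* Let $F$ be a field of characteristic $\neq 2$, let $f=(x-\gamma)^2-\delta\in F[x]$ (with $\gamma,\delta\in F$) be such that every iterate $f^{(n)}$ is separable, let $\{c_n\}_{n\geq 0}$ be its adjusted post-critical orbit and $\rho_f$ its arboreal representation. Let $\underline{a}=(a_i)_{i\geq 0}\in\mathbb{F}_2^{(\mathbb{Z}_{\geq 0})}$ be non-zero. \begin{enumerate} \item If $\underline{a}\neq (1,0,0,\ldots)$, then $\mathrm{im}(\rho_f)=M_{\underline{a}}$ if and only if one of the following holds: \begin{enumerate} \item[(a)] $a_0=1$, $\prod_{i\geq 0}c_i^{a_i}\in (F^{\times})^2$, and for every non-zero $\underline{a}'=(a'_i)\in\mathbb{F}_2^{(\mathbb{Z}_{\geq 0})}$ with $\underline{a}'\neq\underline{a}$ we have $\prod_{i\geq 0}c_i^{a'_i}\notin (F^{\times})^2$; \item[(b)] $a_0=0$, $\prod_{i\geq 0}c_i^{a_i}\in (F^{\times})^2$, for every non-zero $\underline{a}'\neq\underline{a}$ we have $\prod_{i\geq 0}c_i^{a'_i}\notin (F^{\times})^2$, and the element $\widetilde{c}_{\underline{a}}\in F^{\times}$ (defined in the context) does not belong to the span of $\{c_n\}_{n\geq 0}$ in the $\mathbb{F}_2$-vector space $F^{\times}/(F^{\times})^2$. \end{enumerate} If (a) or (b) holds, then $f$ is stable. \item If $\underline{a}=(1,0,0,\ldots)$, then the following are equivalent: (i) $\mathrm{im}(\rho_f)=M_{\underline{a}}$; (ii) $\delta$ is a square in $F$ and, for $u\in F$ with $u^2=\delta$,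 the set $\{c_0+\gamma\pm u,\ c_1-\gamma\pm u,\ c_2-\gamma\pm u,\ldots,c_n-\gamma\pm u,\ldots\}$ is linearly independent in $F^{\times}/(F^{\times})^2$. If (i) or (ii) holds, then $f$ factors as a product of two linear factors $g_1,g_2$ each of which is $f$-stable. \end{enumerate}
   Context: Tree: let $T_\infty$ be the Cayley graph of the free monoid on $\{x,y\}$: vertices are finite words, each word $w$ is joined to $xw$ and $yw$; the root is the empty word, $L_n$ denotes the set of words of length $n$. $\Omega_\infty$ is the profinite group of graph automorphisms of $T_\infty$. For a word $w$, $\sigma_w\in\Omega_\infty$ is the involution fixing every word not ending in $w$ and sending $v'w\mapsto \overline{v'}w$, where $\overline{v'}$ is $v'$ with the letters $x,y$ interchanged. Every $\sigma\in\Omega_\infty$ has a unique "digital representation" $\sigma=\lim_N\sigma_N\sigma_{N-1}\cdots\sigma_0$ with $\sigma_i=\prod_{w\in L_i}\sigma_w^{\varepsilon_w(\sigma)}$, $\varepsilon_w(\sigma)\in\mathbb{F}_2$. Put $\phi_i(\sigma)=\sum_{w\in L_i}\varepsilon_w(\sigma)$; these are continuous homomorphisms $\Omega_\infty\to\mathbb{F}_2$. $\mathbb{F}_2^{(\mathbb{Z}_{\geq 0})}$ is the space of finitely supported sequences, and $M_{\underline{a}}=\ker(\sum_i a_i\phi_i)$ (a closed subgroup of index 2 for $\underline a\ne0$). Arboreal representation: fix a separable closure $F^{\mathrm{sep}}$, $G_F=\mathrm{Gal}(F^{\mathrm{sep}}/F)$. $T_\infty(f)$ is the tree whose level-$n$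 vertices are the roots of $f^{(n)}$ (with $f^{(0)}=x$), a root $\alpha$ at level $n$ being joined to $\beta$ at level $n-1$ iff $f(\alpha)=\beta$. $G_F$ acts on it, giving $\rho_f:G_F\to\mathrm{Aut}(T_\infty(f))$; composing with any graph isomorphism $\iota:T_\infty(f)\to T_\infty$ gives a homomorphism to $\Omega_\infty$ well defined up to conjugacy, and "$\mathrm{im}(\rho_f)=M_{\underline a}$" means the image of $\iota_*\circ\rho_f$ equals $M_{\underline a}$ (independent of $\iota$ since $M_{\underline a}$ is normal). Adjusted post-critical orbit: $c_0=-f(\gamma)=\delta$, $c_n=f^{(n+1)}(\gamma)$ for $n\ge1$. For polynomials $f,g$, $g$ is $f$-stable if $g\circ f^{(n)}$ is irreducible for all $n\ge1$; $f$ is stable if it is $f$-stable. Definition of $\widetilde c_{\underline a}$ (case $a_0=0$): fix a graph isomorphism $\iota$ and let $\alpha_x=\iota^{-1}(x)$, $\alpha_y=\iota^{-1}(y)$ be the two roots of $f$. For $s\in\{x,y\}$ set $P_s=\prod_{i\geq 1}(c_{i-1}-\alpha_s)^{a_i}$. Under the hypotheses of (b) there is $d\in F^\times$ with $d^2=P_xP_y$; set $\widetilde{c}_{\underline a}=2d+P_x+P_y\in F$. (The paper asserts that whether $\widetilde c_{\underline a}$ lies in the span of the $c_n$ does not depend on these choices.)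
   Formalization: In P_s the factor for i=1 is c_0+α_s instead of c_0−α_s (otherwise P_xP_y need not be a square and d may not exist); c̃_a is taken for a sign of d making it non-zero; in (2)(ii) independence is that of the family indexed by n and sign, so repeated elements count as dependent. *)

theory Defs
  imports
    "HOL-Algebra.Algebraic_Closure_Type"
    "HOL-Library.Poly_Mapping"
    "HOL-Library.Z2"
    "HOL-Library.Sublist"
    "HOL-Library.FuncSet"
begin

section \<open>The binary tree and its automorphism group\<close>

text \<open>
  A word is a list whose head is its leftmost letter; hence the word \<open>sw\<close> is \<open>s # w\<close> and
  ``ending in \<open>w\<close>'' is \<^const>\<open>suffix\<close>.
\<close>

datatype letter = Lx | Ly

type_synonym word = "letter list"

primrec flip :: "letter \<Rightarrow> letter" where
  "flip Lx = Ly"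
| "flip Ly = Lx"

definition word_adj :: "word \<Rightarrow> word \<Rightarrow> bool" where
  "word_adj v w \<longleftrightarrow> (\<exists>s. v = s # w \<or> w = s # v)"

definition Omega :: "(word \<Rightarrow> word) set" where
  "Omega = {\<sigma>. bij \<sigma> \<and> (\<forall>v w. word_adj (\<sigma> v) (\<sigma> w) \<longleftrightarrow> word_adj v w)}"

definition sigma :: "word \<Rightarrow> word \<Rightarrow> word" where
  "sigma w v =
     (if suffix w v then map flip (take (length v - length w) v) @ w else v)"

text \<open>
  The factors of \<open>level_factor \<epsilon> i\<close> commute (they have pairwise disjoint supports), so the
  order in which the words of length \<open>i\<close> are enumerated is irrelevant.
\<close>

definition level_factor :: "(word \<Rightarrow> bit) \<Rightarrow> nat \<Rightarrow> word \<Rightarrow> word" where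
  "level_factor \<epsilon> i =
     foldr (\<circ>) (map (\<lambda>w. if \<epsilon> w = 1 then sigma w else id) (List.n_lists i [Lx, Ly])) id"

primrec digital_product :: "(word \<Rightarrow> bit) \<Rightarrow> nat \<Rightarrow> word \<Rightarrow> word" where
  "digital_product \<epsilon> 0 = level_factor \<epsilon> 0"
| "digital_product \<epsilon> (Suc N) = level_factor \<epsilon> (Suc N) \<circ> digital_product \<epsilon> N"

text \<open>Convergence in the profinite topology is pointwise eventual equality.\<close>

definition digital_rep :: "(word \<Rightarrow> bit) \<Rightarrow> (word \<Rightarrow> word) \<Rightarrow> bool" where
  "digital_rep \<epsilon> \<sigma> \<longleftrightarrow>
     (\<forall>v. eventually (\<lambda>N. digital_product \<epsilon> N v = \<sigma> v) sequentially)"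

definition digit :: "(word \<Rightarrow> word) \<Rightarrow> word \<Rightarrow> bit" where
  "digit \<sigma> = (THE \<epsilon>. digital_rep \<epsilon> \<sigma>)"

definition phi :: "nat \<Rightarrow> (word \<Rightarrow> word) \<Rightarrow> bit" where
  "phi i \<sigma> = (\<Sum>w | length w = i. digit \<sigma> w)"

definition M_sub :: "(nat \<Rightarrow>\<^sub>0 bit) \<Rightarrow> (word \<Rightarrow> word) set" where
  "M_sub a = {\<sigma> \<in> Omega. (\<Sum>i\<in>Poly_Mapping.keys a. Poly_Mapping.lookup a i * phi i \<sigma>) = 0}"


section \<open>Iterates, stability and the adjusted post-critical orbit\<close>

definition poly_iter :: "'a::comm_ring_1 poly \<Rightarrow> nat \<Rightarrow> 'a poly" where
  "poly_iter f n = (pcompose f ^^ n) [:0, 1:]"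

definition stable_wrt :: "'a::field poly \<Rightarrow> 'a poly \<Rightarrow> bool" where
  "stable_wrt f g \<longleftrightarrow> (\<forall>n\<ge>1. irreducible (pcompose g (poly_iter f n)))"

definition stable_poly :: "'a::field poly \<Rightarrow> bool" where
  "stable_poly f \<longleftrightarrow> stable_wrt f f"

definition adj_orbit :: "'a::field poly \<Rightarrow> 'a \<Rightarrow> nat \<Rightarrow> 'a" where
  "adj_orbit f \<gamma> n = (if n = 0 then - poly f \<gamma> else poly (poly_iter f (n + 1)) \<gamma>)"


section \<open>The arboreal representation\<close>

definition separable_poly :: "'a::field poly \<Rightarrow> bool" where
  "separable_poly p \<longleftrightarrow> rsquarefree (map_poly to_ac p)"

definition sep_closure :: "'a::field alg_closure set" where
  "sep_closure =
     {z. \<exists>p :: 'a poly. irreducible p \<and> separable_poly p \<and> poly (map_poly to_ac p) z = 0}"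

definition abs_Galois :: "('a::field alg_closure \<Rightarrow> 'a alg_closure) set" where
  "abs_Galois = {g \<in> extensional sep_closure.
     bij_betw g sep_closure sep_closure \<and>
     (\<forall>y\<in>sep_closure. \<forall>z\<in>sep_closure. g (y + z) = g y + g z \<and> g (y * z) = g y * g z) \<and>
     (\<forall>c. g (to_ac c) = to_ac c)}"

text \<open>
  A vertex carries its level, since the same element can be a root of several iterates.
\<close>

definition tree_verts :: "'a::field poly \<Rightarrow> (nat \<times> 'a alg_closure) set" where
  "tree_verts f = {(n, z). z \<in> sep_closure \<and> poly (map_poly to_ac (poly_iter f n)) z = 0}"

definition tree_child :: "'a::field poly \<Rightarrow> nat \<times> 'a alg_closure \<Rightarrow> nat \<times> 'a alg_closure \<Rightarrow> bool"
  where "tree_child f v w \<longleftrightarrow>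
    fst v = Suc (fst w) \<and> poly (map_poly to_ac f) (snd v) = snd w"

definition tree_adj :: "'a::field poly \<Rightarrow> nat \<times> 'a alg_closure \<Rightarrow> nat \<times> 'a alg_closure \<Rightarrow> bool"
  where "tree_adj f v w \<longleftrightarrow> tree_child f v w \<or> tree_child f w v"

definition tree_iso :: "'a::field poly \<Rightarrow> (nat \<times> 'a alg_closure \<Rightarrow> word) \<Rightarrow> bool" where
  "tree_iso f \<iota> \<longleftrightarrow> bij_betw \<iota> (tree_verts f) UNIV \<and>
     (\<forall>v\<in>tree_verts f. \<forall>w\<in>tree_verts f. word_adj (\<iota> v) (\<iota> w) \<longleftrightarrow> tree_adj f v w)"

definition rho ::
  "('a::field alg_closure \<Rightarrow> 'a alg_closure) \<Rightarrow> nat \<times> 'a alg_closure \<Rightarrow> nat \<times> 'a alg_closure"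
  where "rho g v = (fst v, g (snd v))"

definition im_rho :: "'a::field poly \<Rightarrow> (nat \<times> 'a alg_closure \<Rightarrow> word) \<Rightarrow> (word \<Rightarrow> word) set" where
  "im_rho f \<iota> = (\<lambda>g. \<iota> \<circ> rho g \<circ> inv_into (tree_verts f) \<iota>) ` abs_Galois"


section \<open>The vector space of square classes\<close>

definition sq_equiv :: "'a::field \<Rightarrow> 'a \<Rightarrow> bool" where
  "sq_equiv x y \<longleftrightarrow> x \<noteq> 0 \<and> y \<noteq> 0 \<and> (\<exists>r. r \<noteq> 0 \<and> x = y * r\<^sup>2)"

lemma part_equivp_sq_equiv: "part_equivp sq_equiv"
proof (rule part_equivpI)
  show "\<exists>x :: 'a. sq_equiv x x"
    by (intro exI[of _ 1]) (auto simp: sq_equiv_def intro!: exI[of _ 1])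
  show "symp (sq_equiv :: 'a \<Rightarrow> _)"
  proof (rule sympI)
    fix x y :: 'a assume "sq_equiv x y"
    then obtain r where r: "x \<noteq> 0" "y \<noteq> 0" "r \<noteq> 0" "x = y * r\<^sup>2"
      by (auto simp: sq_equiv_def)
    then have "inverse r \<noteq> 0" "y = x * (inverse r)\<^sup>2"
      by (auto simp: field_simps)
    then show "sq_equiv y x"
      using r(1,2) unfolding sq_equiv_def by blast
  qed
  show "transp (sq_equiv :: 'a \<Rightarrow> _)"
  proof (rule transpI)
    fix x y z :: 'a assume "sq_equiv x y" "sq_equiv y z"
    then obtain r s where r: "x \<noteq> 0" "r \<noteq> 0" "x = y * r\<^sup>2" and s: "z \<noteq> 0" "s \<noteq> 0" "y = z * s\<^sup>2"
      by (auto simp: sq_equiv_def)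
    then have "s * r \<noteq> 0" "x = z * (s * r)\<^sup>2"
      by (auto simp: power_mult_distrib)
    then show "sq_equiv x z"
      using r(1) s(1) unfolding sq_equiv_def by blast
  qed
qed

text \<open>
  \<open>sq_class x\<close> is the class of \<open>x\<close> in \<open>F\<^sup>\<times>/(F\<^sup>\<times>)\<^sup>2\<close>, written additively; it is meaningful
  only for \<open>x \<noteq> 0\<close>.
\<close>

quotient_type (overloaded) 'a sqclass = "'a::field" / partial: sq_equiv
  morphisms rep_sqclass sq_class
  by (rule part_equivp_sq_equiv)

instantiation sqclass :: (field) ab_group_add
begin

lift_definition zero_sqclass :: "'a sqclass" is "1"
  by (auto simp: sq_equiv_def intro!: exI[of _ 1])

lift_definition plus_sqclass :: "'a sqclass \<Rightarrow> 'a sqclass \<Rightarrow> 'a sqclass" is "(*)"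
proof -
  fix x y u v :: 'a assume "sq_equiv x y" "sq_equiv u v"
  then obtain r s where "x \<noteq> 0" "y \<noteq> 0" "r \<noteq> 0" "x = y * r\<^sup>2" "u \<noteq> 0" "v \<noteq> 0" "s \<noteq> 0" "u = v * s\<^sup>2"
    by (auto simp: sq_equiv_def)
  then show "sq_equiv (x * u) (y * v)"
    unfolding sq_equiv_def by (auto simp: power_mult_distrib intro!: exI[of _ "r * s"])
qed

lift_definition uminus_sqclass :: "'a sqclass \<Rightarrow> 'a sqclass" is inverse
proof -
  fix x y :: 'a assume "sq_equiv x y"
  then obtain r where "x \<noteq> 0" "y \<noteq> 0" "r \<noteq> 0" "x = y * r\<^sup>2"
    by (auto simp: sq_equiv_def)
  then show "sq_equiv (inverse x) (inverse y)"
    unfolding sq_equiv_def by (auto simp: field_simps intro!: exI[of _ "inverse r"])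
qed

definition minus_sqclass :: "'a sqclass \<Rightarrow> 'a sqclass \<Rightarrow> 'a sqclass" where
  "minus_sqclass A B = A + (- B)"

instance
proof
  fix A B C :: "'a sqclass"
  show "A + B + C = A + (B + C)"
    by transfer (auto simp: sq_equiv_def mult_ac intro!: exI[of _ 1])
  show "A + B = B + A"
    by transfer (auto simp: sq_equiv_def mult_ac intro!: exI[of _ 1])
  show "0 + A = A"
    by transfer (auto simp: sq_equiv_def)
  show "- A + A = 0"
    by transfer (auto simp: sq_equiv_def intro!: exI[of _ 1])
  show "A - B = A + - B"
    by (rule minus_sqclass_def)
qed

end

lemma sqclass_double: "(A :: 'a::field sqclass) + A = 0"
  by transfer (auto simp: sq_equiv_def power2_eq_square)

definition sq_scale :: "bit \<Rightarrow> 'a::field sqclass \<Rightarrow> 'a sqclass" where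
  "sq_scale b A = (if b = 0 then 0 else A)"

global_interpretation sq: vector_space "sq_scale :: bit \<Rightarrow> 'a::field sqclass \<Rightarrow> 'a sqclass"
proof
  fix b c :: bit and A B :: "'a sqclass"
  show "sq_scale b (A + B) = sq_scale b A + sq_scale b B"
    by (simp add: sq_scale_def)
  show "sq_scale (b + c) A = sq_scale b A + sq_scale c A"
    by (cases b; cases c) (auto simp: sq_scale_def sqclass_double)
  show "sq_scale b (sq_scale c A) = sq_scale (b * c) A"
    by (auto simp: sq_scale_def)
  show "sq_scale 1 A = A"
    by (simp add: sq_scale_def)
qed

definition unit_square :: "'a::field \<Rightarrow> bool" where
  "unit_square x \<longleftrightarrow> (\<exists>r. r \<noteq> 0 \<and> x = r\<^sup>2)"

definition sq_independent_family :: "('i \<Rightarrow> 'a::field) \<Rightarrow> bool" where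
  "sq_independent_family v \<longleftrightarrow>
     (\<forall>i. v i \<noteq> 0) \<and> inj (\<lambda>i. sq_class (v i)) \<and> sq.independent (range (\<lambda>i. sq_class (v i)))"

text \<open>Over \<open>\<bbbF>\<^sub>2\<close> the support \<^const>\<open>Poly_Mapping.keys\<close> of \<open>a\<close> is the set of \<open>i\<close> with \<open>a\<^sub>i = 1\<close>.\<close>

definition orbit_prod :: "(nat \<Rightarrow> 'a::field) \<Rightarrow> (nat \<Rightarrow>\<^sub>0 bit) \<Rightarrow> 'a" where
  "orbit_prod c a = (\<Prod>i\<in>Poly_Mapping.keys a. c i)"

definition unique_square_relation :: "(nat \<Rightarrow> 'a::field) \<Rightarrow> (nat \<Rightarrow>\<^sub>0 bit) \<Rightarrow> bool" where
  "unique_square_relation c a \<longleftrightarrow> unit_square (orbit_prod c a) \<and>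
     (\<forall>a'. a' \<noteq> 0 \<and> a' \<noteq> a \<longrightarrow> \<not> unit_square (orbit_prod c a'))"


section \<open>The additional square class for \<open>a\<^sub>0 = 0\<close>\<close>

definition level_one_root :: "'a::field poly \<Rightarrow> (nat \<times> 'a alg_closure \<Rightarrow> word) \<Rightarrow> letter \<Rightarrow> 'a alg_closure"
  where "level_one_root f \<iota> s = snd (inv_into (tree_verts f) \<iota> [s])"

text \<open>
  The factor of \<open>P\<^sub>s\<close> at \<open>i = 1\<close> is \<open>c\<^sub>0 + \<alpha>\<^sub>s\<close>, not \<open>c\<^sub>0 - \<alpha>\<^sub>s\<close>: as \<open>c\<^sub>0 = - f(\<gamma>)\<close> carries the
  opposite sign, the adjusted post-critical orbit of \<open>f\<close> relative to \<open>x - \<alpha>\<^sub>s\<close> is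
  \<open>c\<^sub>0 + \<alpha>\<^sub>s, c\<^sub>1 - \<alpha>\<^sub>s, c\<^sub>2 - \<alpha>\<^sub>s, \<dots>\<close> (the sequence that also appears in the case
  \<open>a = (1, 0, 0, \<dots>)\<close>, where \<open>\<alpha>\<^sub>s = \<gamma> \<plusminus> u\<close>).  With this factor
  \<open>(c\<^sub>0 + \<alpha>\<^sub>x) (c\<^sub>0 + \<alpha>\<^sub>y) = f(- c\<^sub>0) = c\<^sub>1\<close>, so \<open>P\<^sub>x P\<^sub>y\<close> is the product of the \<open>c\<^sub>i\<close> with
  \<open>a\<^sub>i = 1\<close> and \<open>d\<close> exists; \<open>c\<^sub>0 - \<alpha>\<^sub>s\<close> would give \<open>f(c\<^sub>0)\<close>, which differs from \<open>c\<^sub>1\<close>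
  unless \<open>\<gamma> = 0\<close>.
\<close>

definition P_factor ::
  "'a::field poly \<Rightarrow> 'a \<Rightarrow> (nat \<times> 'a alg_closure \<Rightarrow> word) \<Rightarrow> (nat \<Rightarrow>\<^sub>0 bit) \<Rightarrow> letter \<Rightarrow> 'a alg_closure"
  where "P_factor f \<gamma> \<iota> a s =
    (\<Prod>i\<in>Poly_Mapping.keys a - {0}.
       if i = 1 then to_ac (adj_orbit f \<gamma> 0) + level_one_root f \<iota> s
       else to_ac (adj_orbit f \<gamma> (i - 1)) - level_one_root f \<iota> s)"

text \<open>
  \<open>is_ctilde f \<gamma> \<iota> a t\<close>: \<open>t \<in> F\<^sup>\<times>\<close> is the value of \<open>c~\<^sub>a\<close> for one of the choices of \<open>d\<close>.
\<close>

definition is_ctilde ::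
  "'a::field poly \<Rightarrow> 'a \<Rightarrow> (nat \<times> 'a alg_closure \<Rightarrow> word) \<Rightarrow> (nat \<Rightarrow>\<^sub>0 bit) \<Rightarrow> 'a \<Rightarrow> bool"
  where "is_ctilde f \<gamma> \<iota> a t \<longleftrightarrow> t \<noteq> 0 \<and>
    (\<exists>d. d \<noteq> 0 \<and> (to_ac d)\<^sup>2 = P_factor f \<gamma> \<iota> a Lx * P_factor f \<gamma> \<iota> a Ly \<and>
         to_ac t = 2 * to_ac d + P_factor f \<gamma> \<iota> a Lx + P_factor f \<gamma> \<iota> a Ly)"


section \<open>The two criteria\<close>

definition cond_a :: "'a::field poly \<Rightarrow> 'a \<Rightarrow> (nat \<Rightarrow>\<^sub>0 bit) \<Rightarrow> bool" where
  "cond_a f \<gamma> a \<longleftrightarrow>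
     Poly_Mapping.lookup a 0 = 1 \<and> unique_square_relation (adj_orbit f \<gamma>) a"

definition cond_b ::
  "'a::field poly \<Rightarrow> 'a \<Rightarrow> (nat \<times> 'a alg_closure \<Rightarrow> word) \<Rightarrow> (nat \<Rightarrow>\<^sub>0 bit) \<Rightarrow> bool" where
  "cond_b f \<gamma> \<iota> a \<longleftrightarrow>
     Poly_Mapping.lookup a 0 = 0 \<and> unique_square_relation (adj_orbit f \<gamma>) a \<and>
     (\<exists>t. is_ctilde f \<gamma> \<iota> a t \<and> sq_class t \<notin> sq.span (range (\<lambda>n. sq_class (adj_orbit f \<gamma> n))))"

definition split_family :: "'a::field poly \<Rightarrow> 'a \<Rightarrow> 'a \<Rightarrow> nat \<times> bool \<Rightarrow> 'a" where
  "split_family f \<gamma> u = (\<lambda>(n, b).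
     (if n = 0 then adj_orbit f \<gamma> 0 + \<gamma> else adj_orbit f \<gamma> n - \<gamma>) + (if b then u else - u))"

end

theory Submission
  imports Defs
begin

text \<open>
  An automorphism \<open>\<sigma>\<close> of the tree is determined by its portrait, the set of vertices \<open>w\<close> at which it
  interchanges the two children, and \<open>\<phi>\<^sub>i(\<sigma>)\<close> is the parity of the portrait on level \<open>i\<close>.  Writing the
  children of a root \<open>\<beta>\<close> as \<open>\<gamma> \<plusminus> r\<^sub>\<beta>\<close> with \<open>r\<^sub>\<beta>\<^sup>2 = \<delta> + \<beta>\<close>, the product of the \<open>r\<^sub>\<beta>\<close> over level \<open>i\<close> is a
  square root of \<open>c\<^sub>i\<close> on which Galois acts through \<open>\<phi>\<^sub>i\<close>; the products over the half of a level above
  \<open>\<alpha>\<^sub>x\<close> or \<open>\<alpha>\<^sub>y\<close> give square roots of \<open>P\<^sub>x\<close> and \<open>P\<^sub>y\<close>, and \<open>\<surd>P\<^sub>x \<plusminus> \<surd>P\<^sub>y\<close> is a square root of \<open>c~\<^sub>a\<close>.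
  All conditions on square classes thus say which characters of \<open>\<Omega>\<^sub>\<infinity>\<close> vanish on the Galois image \<open>G\<close>.

  That these conditions force \<open>G = M\<^sub>a\<close> is shown level by level.  If \<open>G\<close> and \<open>M\<^sub>a\<close> agree on level \<open>n\<close>,
  the portraits on level \<open>n\<close> of the elements of \<open>G\<close> trivial there form an invariant space of functions,
  which is as large as possible unless a parity character vanishes on it.  In that case this character
  of \<open>G\<close> factors through level \<open>n\<close> of \<open>M\<^sub>a\<close>, and the characters of \<open>M\<^sub>a\<close> of finite level are spanned by
  the \<open>\<phi>\<^sub>i\<close> and, if \<open>a\<^sub>0 = 0\<close>, the character \<open>psi\<close> of \<open>c~\<^sub>a\<close>.  At the top level \<open>N\<close> of the support of
  \<open>a\<close> and for \<open>a\<^sub>0 = 1\<close>, the square of an element acting below \<open>N\<close> as the flip at the root replaces \<open>psi\<close>.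
\<close>

text \<open>The role of \<open>a_0\<close> comes from the two halves into which the vertices of
  level one divide every later level. On level \<open>N\<close> the kernel of \<open>M_a\<close>
  consists of the functions of even total, whose invariant functionals are the multiples of the sum
  over one half. If \<open>a_0 = 0\<close>, exchanging the halves changes the sum of the half
  parities by the defining character, which is zero on \<open>M_a\<close>; hence one more character
  and one more condition. If \<open>a_0 = 1\<close>, a lift of the root flip must be odd on level
  \<open>N\<close> to compensate for the root, so its square is odd on each half, and no character
  can extend the half sum. For \<open>a = (1, 0, 0, ...)\<close> the halves are never exchanged and
  each half parity is a character: this is the origin of the family with both signs of
  \<open>u\<close>. An element fixed by all automorphisms of the algebraic closure need not lie in
  an imperfect \<open>F\<close>, so square roots must be known to be separable before invariance is
  used.\<close>

declare add_bit_eq_xor [simp del] mult_bit_eq_and [simp del]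

definition flipb :: "bit \<Rightarrow> letter \<Rightarrow> letter" where
  "flipb b s = (if b = 0 then s else flip s)"

lemma flip_flip [simp]: "flip (flip s) = s"
  by (cases s) auto

lemma flip_neq [simp]: "flip s \<noteq> s" "s \<noteq> flip s"
  by (cases s; simp)+

lemma flip_eq_iff [simp]: "flip s = flip t \<longleftrightarrow> s = t"
  by (cases s; cases t) auto

lemma letter_neq_iff: "s \<noteq> t \<longleftrightarrow> s = flip t"
  by (cases s; cases t) auto

lemma flipb_0 [simp]: "flipb 0 s = s" and flipb_1 [simp]: "flipb 1 s = flip s"
  by (auto simp: flipb_def)

lemma flipb_flipb [simp]: "flipb b (flipb c s) = flipb (b + c) s"
  by (cases b; cases c) auto

lemma flipb_eq_iff [simp]: "flipb b s = flipb c s \<longleftrightarrow> b = c" "flipb b s = flipb b t \<longleftrightarrow> s = t"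
  by (cases b; cases c; auto)+

lemma flipb_eq_self_iff [simp]: "flipb b s = s \<longleftrightarrow> b = 0"
  by (cases b) auto

lemma bit_add_self [simp]: "(b :: bit) + b = 0"
  by (cases b) auto

lemma bit_add_left_self [simp]: "(b :: bit) + (b + c) = c"
  by (cases b; cases c) auto

lemma bit_add_eq_0_iff: "(b :: bit) + c = 0 \<longleftrightarrow> b = c"
  by (cases b; cases c) auto

section \<open>Tree automorphisms and their portraits\<close>

abbreviation tree_inv :: "(word \<Rightarrow> word) \<Rightarrow> word \<Rightarrow> word" where
  "tree_inv \<sigma> \<equiv> inv_into UNIV \<sigma>"

text \<open>The bit is read at the source vertex \<open>w\<close>, not at its image; this convention
  fixes the shape of the cocycle rule \<open>act_comp\<close>.\<close>

primrec act :: "(word \<Rightarrow> bit) \<Rightarrow> word \<Rightarrow> word" where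
  "act p [] = []"
| "act p (s # w) = flipb (p w) s # act p w"

text \<open>Only the child \<open>Lx # w\<close> is inspected. For members of \<open>Omega\<close>
  the other child goes to the remaining place, by \<open>Omega_Cons\<close>.\<close>

definition portrait :: "(word \<Rightarrow> word) \<Rightarrow> word \<Rightarrow> bit" where
  "portrait \<sigma> w = (if hd (\<sigma> (Lx # w)) = Lx then 0 else 1)"

lemma portrait_act [simp]: "portrait (act p) = p"
proof
  fix w show "portrait (act p) w = p w"
    by (cases "p w") (auto simp: portrait_def)
qed

lemma length_act [simp]: "length (act p w) = length w"
  by (induction w) auto

lemma act_comp: "act p \<circ> act q = act (\<lambda>w. q w + p (act q w))"
proof
  fix w show "(act p \<circ> act q) w = act (\<lambda>w. q w + p (act q w)) w"
    by (induction w) (auto simp: add.commute)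
qed

lemma act_zero [simp]: "act (\<lambda>_. 0) = id"
proof
  fix w show "act (\<lambda>_. 0) w = id w" by (induction w) auto
qed

lemma act_inj: "act p v = act p w \<Longrightarrow> v = w"
proof (induction v arbitrary: w)
  case Nil then show ?case by (cases w) auto
next
  case (Cons s v) then show ?case by (cases w) auto
qed

lemma act_surj: "\<exists>v. act p v = w"
proof (induction w)
  case Nil then show ?case by (intro exI[of _ "[]"]) simp
next
  case (Cons s w)
  then obtain v where "act p v = w" by blast
  then show ?case by (intro exI[of _ "flipb (p v) s # v"]) simp
qed

lemma bij_act: "bij (act p)"
  unfolding bij_def inj_on_def surj_def using act_inj act_surj by metis

lemma act_in_Omega [simp]: "act p \<in> Omega"
proof -
  have *: "(\<exists>s. act p v = s # act p w) \<longleftrightarrow> (\<exists>s. v = s # w)" for v w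
    by (cases v) (auto dest: act_inj)
  show ?thesis
    unfolding Omega_def word_adj_def using bij_act * by (auto simp: ex_disj_distrib)
qed

lemma word_nbrs: "{v. word_adj w v} = {Lx # w, Ly # w} \<union> (if w = [] then {} else {tl w})"
  unfolding word_adj_def by (cases w) (auto, (metis letter.exhaust)+)

text \<open>The valency singles out the root, so that every automorphism must fix it although
  \<open>Omega\<close> is defined without reference to levels.\<close>

lemma card_word_nbrs: "card {v. word_adj w v} = (if w = [] then 2 else 3)"
proof -
  have "tl w \<noteq> s # w" for s by (metis Suc_n_not_le_n diff_le_self length_Cons length_tl)
  then have "tl w \<notin> {Lx # w, Ly # w}" by blast
  then show ?thesis unfolding word_nbrs by (auto simp: insert_commute card_insert_if)
qed

lemma Omega_root:
  assumes "\<sigma> \<in> Omega" shows "\<sigma> [] = []"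
proof -
  have b: "bij \<sigma>" and adj: "\<And>v w. word_adj (\<sigma> v) (\<sigma> w) \<longleftrightarrow> word_adj v w"
    using assms by (auto simp: Omega_def)
  have "{v. word_adj (\<sigma> []) v} = \<sigma> ` {v. word_adj [] v}"
    using adj b by (auto simp: image_iff) (metis bij_pointE)
  then have "card {v. word_adj (\<sigma> []) v} = 2"
    using card_image[OF inj_on_subset[OF bij_is_inj[OF b]], of "{v. word_adj [] v}"] card_word_nbrs[of "[]"]
    by simp
  then show ?thesis using card_word_nbrs[of "\<sigma> []"] by (auto split: if_splits)
qed

text \<open>A neighbour of \<open>\<sigma> w\<close> is its parent or one of its children. The
  parent is already the image of the parent of \<open>w\<close>, so by injectivity children go to
  children. The length is carried along to tell the two cases apart.\<close>

lemma Omega_Cons_ex: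
  assumes "\<sigma> \<in> Omega"
  shows "length (\<sigma> w) = length w \<and> (\<exists>t. \<sigma> (s # w) = t # \<sigma> w)"
proof (induction w arbitrary: s)
  case Nil
  have "word_adj (\<sigma> [s]) (\<sigma> [])"
    using assms by (auto simp: Omega_def word_adj_def)
  then show ?case using Omega_root[OF assms] by (auto simp: word_adj_def)
next
  case (Cons r w)
  have l: "length (\<sigma> (r # w)) = Suc (length w)" using Cons[of r] by auto
  have "word_adj (\<sigma> (s # r # w)) (\<sigma> (r # w))"
    using assms by (auto simp: Omega_def word_adj_def)
  moreover have "\<sigma> (s # r # w) \<noteq> \<sigma> w"
    using assms by (auto simp: Omega_def bij_def inj_eq)
  moreover obtain t where "\<sigma> (r # w) = t # \<sigma> w" using Cons by blast
  ultimately show ?case using l by (auto simp: word_adj_def)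
qed

lemma Omega_Cons:
  assumes "\<sigma> \<in> Omega"
  shows "\<sigma> (s # w) = flipb (portrait \<sigma> w) s # \<sigma> w"
proof -
  obtain t u where t: "\<sigma> (Lx # w) = t # \<sigma> w" and u: "\<sigma> (Ly # w) = u # \<sigma> w"
    using Omega_Cons_ex[OF assms] by meson
  have "\<sigma> (Lx # w) \<noteq> \<sigma> (Ly # w)"
    using assms by (auto simp: Omega_def bij_def inj_eq)
  then have "t \<noteq> u" using t u by auto
  then show ?thesis using t u by (cases s; cases t; cases u) (auto simp: portrait_def)
qed

lemma Omega_act:
  assumes "\<sigma> \<in> Omega" shows "\<sigma> = act (portrait \<sigma>)"
proof
  fix w show "\<sigma> w = act (portrait \<sigma>) w"
    by (induction w) (auto simp: Omega_root[OF assms] Omega_Cons[OF assms])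
qed

lemma Omega_length [simp]: "\<sigma> \<in> Omega \<Longrightarrow> length (\<sigma> w) = length w"
  by (metis Omega_act length_act)

lemma Omega_inj: "\<sigma> \<in> Omega \<Longrightarrow> \<sigma> v = \<sigma> w \<longleftrightarrow> v = w"
  by (metis Omega_act act_inj)

lemma Omega_id [simp]: "id \<in> Omega"
  using act_in_Omega[of "\<lambda>_. 0"] by simp

lemma Omega_comp: "\<sigma> \<in> Omega \<Longrightarrow> \<tau> \<in> Omega \<Longrightarrow> \<sigma> \<circ> \<tau> \<in> Omega"
  by (metis Omega_act act_comp act_in_Omega)

lemma Omega_bij: "\<sigma> \<in> Omega \<Longrightarrow> bij \<sigma>"
  by (simp add: Omega_def)

lemma Omega_inv: 
  assumes "\<sigma> \<in> Omega" shows "tree_inv \<sigma> \<in> Omega"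
proof -
  have "word_adj (tree_inv \<sigma> v) (tree_inv \<sigma> w) \<longleftrightarrow> word_adj (\<sigma> (tree_inv \<sigma> v)) (\<sigma> (tree_inv \<sigma> w))" for v w
    using assms by (auto simp: Omega_def)
  then show ?thesis
    using Omega_bij[OF assms] by (simp add: Omega_def bij_imp_bij_inv bij_is_surj surj_f_inv_f)
qed

lemma portrait_id [simp]: "portrait id w = 0"
  by (simp add: portrait_def)

lemma portrait_comp:
  assumes "\<sigma> \<in> Omega" "\<tau> \<in> Omega"
  shows "portrait (\<sigma> \<circ> \<tau>) w = portrait \<tau> w + portrait \<sigma> (\<tau> w)"
proof -
  have "portrait (act (portrait \<sigma>) \<circ> act (portrait \<tau>)) w = portrait \<tau> w + portrait \<sigma> (act (portrait \<tau>) w)"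
    by (simp add: act_comp)
  then show ?thesis using assms by (simp flip: Omega_act)
qed

lemma portrait_inv:
  assumes "\<sigma> \<in> Omega"
  shows "portrait (tree_inv \<sigma>) (\<sigma> w) = portrait \<sigma> w"
proof -
  have "portrait (tree_inv \<sigma> \<circ> \<sigma>) w = portrait \<sigma> w + portrait (tree_inv \<sigma>) (\<sigma> w)"
    using assms by (intro portrait_comp) (auto simp: Omega_inv)
  moreover have "tree_inv \<sigma> \<circ> \<sigma> = id"
    using Omega_bij[OF assms] by (simp add: bij_is_inj)
  ultimately show ?thesis by (simp add: bit_add_eq_0_iff)
qed

section \<open>Levels and parities of portraits\<close>

definition words :: "nat \<Rightarrow> word set" where "words n = {w. length w = n}"

lemma in_words_iff [simp]: "w \<in> words n \<longleftrightarrow> length w = n"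
  by (simp add: words_def)

lemma words_0: "words 0 = {[]}" by (auto simp: words_def)

lemma UNIV_letter: "(UNIV :: letter set) = {Lx, Ly}"
  using letter.exhaust by auto

lemma words_Suc: "words (Suc n) = (#) Lx ` words n \<union> (#) Ly ` words n"
proof (rule Set.set_eqI)
  fix w show "w \<in> words (Suc n) \<longleftrightarrow> w \<in> (#) Lx ` words n \<union> (#) Ly ` words n"
  proof (cases w)
    case (Cons s v) then show ?thesis by (cases s) auto
  qed auto
qed

lemma finite_words [simp]: "finite (words n)"
  by (induction n) (auto simp: words_0 words_Suc)

lemma sum_words_Suc:
  "(\<Sum>w\<in>words (Suc n). g w) = (\<Sum>w\<in>words n. g (Lx # w) + g (Ly # w))"
  unfolding words_Suc
  by (subst sum.union_disjoint) (auto simp: sum.reindex sum.distrib)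

lemma Omega_image_words: "\<sigma> \<in> Omega \<Longrightarrow> \<sigma> ` words n = words n"
proof -
  assume s: "\<sigma> \<in> Omega"
  have "w \<in> \<sigma> ` words n" if "length w = n" for w
  proof (rule image_eqI)
    show "w = \<sigma> (tree_inv \<sigma> w)" using Omega_bij[OF s] by (simp add: bij_is_surj surj_f_inv_f)
    show "tree_inv \<sigma> w \<in> words n" using that Omega_inv[OF s] by simp
  qed
  then show ?thesis using s by auto
qed

definition psum :: "word set \<Rightarrow> (word \<Rightarrow> word) \<Rightarrow> bit" where
  "psum S \<sigma> = (\<Sum>w\<in>S. portrait \<sigma> w)"

text \<open>Parity over \<open>S\<close> becomes additive only where \<open>\<tau>\<close> permutes
  \<open>S\<close>: always for a full level, and for half a level if the root is not
  flipped.\<close>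

lemma psum_comp:
  assumes "\<sigma> \<in> Omega" "\<tau> \<in> Omega"
  shows "psum S (\<sigma> \<circ> \<tau>) = psum S \<tau> + psum (\<tau> ` S) \<sigma>"
proof -
  have "inj_on \<tau> S" using assms(2) by (auto simp: inj_on_def Omega_inj)
  then show ?thesis by (simp add: psum_def portrait_comp assms sum.distrib sum.reindex)
qed

section \<open>Digits and portraits\<close>

text \<open>\<open>sigma w\<close> interchanges the letters in all positions to the left of
  \<open>w\<close>, so a digit acts on every later level. The bit visible at a vertex is therefore
  the sum of the digits along its chain of suffixes.\<close>

primrec digit_sum :: "(word \<Rightarrow> bit) \<Rightarrow> word \<Rightarrow> bit" where
  "digit_sum e [] = e []"
| "digit_sum e (s # u) = e (s # u) + digit_sum e u"

lemma set_n_lists_letters: "set (List.n_lists i [Lx, Ly]) = words i"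
  using set_n_lists[of i "[Lx, Ly]"] UNIV_letter by (auto simp: words_def)

lemma sigma_append:
  "length u = length w \<Longrightarrow> sigma w (v @ u) = (if u = w then map flip v @ u else v @ u)"
  by (auto simp: sigma_def suffix_def)

lemma sigma_short: "length v < length w \<Longrightarrow> sigma w v = v"
  by (auto simp: sigma_def dest: suffix_length_le)

lemma map_flipb [simp]: "map (flipb 0) v = v" "map (flipb 1) v = map flip v"
  by (simp_all add: map_idI)

lemma map_flipb_map_flipb: "map (flipb b) (map (flipb c) v) = map (flipb (b + c)) v"
  by simp

lemma foldr_comp_Cons: "foldr (\<circ>) (g # gs) id x = g (foldr (\<circ>) gs id x)"
  by simp

text \<open>On words ending in \<open>u\<close> every factor except \<open>sigma u\<close> is the
  identity and keeps the ending, so at most one factor acts.\<close>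

lemma foldr_sigma_append:
  fixes e :: "word \<Rightarrow> bit"
  assumes "distinct ws" "\<And>w. w \<in> set ws \<Longrightarrow> length w = length u"
  shows "foldr (\<circ>) (map (\<lambda>w. if e w = 1 then sigma w else id) ws) id (v @ u)
       = (if u \<in> set ws then map (flipb (e u)) v @ u else v @ u)"
  using assms
proof (induction ws)
  case Nil then show ?case by simp
next
  case (Cons w ws)
  have lw: "length u = length w" using Cons.prems by simp
  have IH: "foldr (\<circ>) (map (\<lambda>w. if e w = 1 then sigma w else id) ws) id (v @ u)
       = (if u \<in> set ws then map (flipb (e u)) v @ u else v @ u)"
    by (rule Cons.IH) (use Cons.prems in auto)
  show ?case
  proof (cases "u = w")
    case True
    then have "u \<notin> set ws" using Cons.prems by auto
    then show ?thesis using IH True sigma_append[OF lw, of v]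
      unfolding list.map foldr_comp_Cons by (cases "e w") simp_all
  next
    case False
    have "sigma w (v' @ u) = v' @ u" for v' using sigma_append[OF lw, of v'] False by simp
    then show ?thesis using IH False
      unfolding list.map foldr_comp_Cons by (cases "u \<in> set ws") simp_all
  qed
qed

lemma distinct_n_lists_letters: "distinct (List.n_lists i [Lx, Ly])"
  by (rule distinct_n_lists) simp

lemma level_factor_append:
  assumes "length u = i"
  shows "level_factor e i (v @ u) = map (flipb (e u)) v @ u"
proof -
  have "foldr (\<circ>) (map (\<lambda>w. if e w = (1::bit) then sigma w else id) (List.n_lists i [Lx, Ly])) id (v @ u)
       = (if u \<in> set (List.n_lists i [Lx, Ly]) then map (flipb (e u)) v @ u else v @ u)"
    by (rule foldr_sigma_append) (use distinct_n_lists_letters assms in \<open>auto simp: set_n_lists_letters\<close>)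
  then show ?thesis using assms unfolding level_factor_def by (simp add: set_n_lists_letters)
qed

lemma level_factor_short:
  assumes "length v < i" shows "level_factor e i v = v"
proof -
  have "foldr (\<circ>) (map (\<lambda>w. if e w = (1::bit) then sigma w else id) ws) id v = v"
    if "\<And>w. w \<in> set ws \<Longrightarrow> length v < length w" for ws
    using that
  proof (induction ws)
    case (Cons w ws)
    have IH: "foldr (\<circ>) (map (\<lambda>w. if e w = 1 then sigma w else id) ws) id v = v"
      by (rule Cons.IH) (use Cons.prems in auto)
    have "sigma w v = v" using Cons.prems by (simp add: sigma_short)
    then show ?case unfolding list.map foldr_comp_Cons IH by simp
  qed simp
  from this[of "List.n_lists i [Lx, Ly]"] show ?thesis
    using assms unfolding level_factor_def by (simp add: set_n_lists_letters)
qed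

text \<open>Factors of higher level are applied later, to a word that has already been moved; hence
  the digits are read at the image \<open>digit_act e w\<close>.\<close>

primrec digit_act :: "(word \<Rightarrow> bit) \<Rightarrow> word \<Rightarrow> word" where
  "digit_act e [] = []"
| "digit_act e (s # w) = flipb (digit_sum e (digit_act e w)) s # digit_act e w"

lemma length_digit_act [simp]: "length (digit_act e w) = length w"
  by (induction w) auto

text \<open>The part \<open>v\<close> beyond level \<open>N\<close> has to be carried along, because
  the first factors already twist all of it by the accumulated digit sum. The induction moves the
  last letter of \<open>v\<close> into \<open>w\<close>.\<close>

lemma digital_product_append:
  "length w = N \<Longrightarrow>
    digital_product e N (v @ w) = map (flipb (digit_sum e (digit_act e w))) v @ digit_act e w"
proof (induction N arbitrary: v w)
  case 0
  then show ?case using level_factor_append[of "[]" 0 e v] by simp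
next
  case (Suc N)
  then obtain s w' where w: "w = s # w'" "length w' = N" by (cases w) auto
  have "digital_product e N ((v @ [s]) @ w')
      = map (flipb (digit_sum e (digit_act e w'))) (v @ [s]) @ digit_act e w'"
    by (rule Suc.IH) (rule w)
  then have "digital_product e N (v @ w)
      = map (flipb (digit_sum e (digit_act e w'))) v @ digit_act e w"
    using w by simp
  then have "digital_product e (Suc N) (v @ w)
      = map (flipb (e (digit_act e w))) (map (flipb (digit_sum e (digit_act e w'))) v) @ digit_act e w"
    using level_factor_append[of "digit_act e w" "Suc N"] Suc.prems by simp
  then show ?case unfolding map_flipb_map_flipb using w by simp
qed

lemma digital_product_eq:
  "length w \<le> N \<Longrightarrow> digital_product e N w = digit_act e w"
proof (induction N)
  case 0 then show ?case using digital_product_append[of "[]" 0 e "[]"] by simp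
next
  case (Suc N)
  show ?case
  proof (cases "length w = Suc N")
    case True then show ?thesis using digital_product_append[of w "Suc N" e "[]"] by simp
  next
    case False
    then show ?thesis using Suc by (simp add: level_factor_short)
  qed
qed

lemma digital_rep_iff: "digital_rep e \<sigma> \<longleftrightarrow> \<sigma> = digit_act e"
proof -
  have ev: "eventually (\<lambda>N. digital_product e N v = digit_act e v) sequentially" for v
    using digital_product_eq unfolding eventually_sequentially by blast
  show ?thesis
  proof
    assume r: "digital_rep e \<sigma>"
    show "\<sigma> = digit_act e"
    proof
      fix v
      have "eventually (\<lambda>N. digital_product e N v = \<sigma> v) sequentially"
        using r by (simp add: digital_rep_def)
      with ev[of v] have "eventually (\<lambda>N. \<sigma> v = digit_act e v) sequentially"
        by eventually_elim simp
      then show "\<sigma> v = digit_act e v" by simp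
    qed
  next
    assume "\<sigma> = digit_act e" then show "digital_rep e \<sigma>" using ev by (simp add: digital_rep_def)
  qed
qed

lemma digit_sum_inj:
  assumes "digit_sum e = digit_sum e'" shows "e = e'"
proof
  fix w show "e w = e' w"
    using fun_cong[OF assms, of w] fun_cong[OF assms, of "tl w"] by (cases w) auto
qed

lemma digit_sum_surj: "\<exists>e. digit_sum e = h"
proof (intro exI ext)
  \<comment> \<open>Differences along the chain of suffixes invert the cumulative sum.\<close>
  fix w show "digit_sum (\<lambda>w. if w = [] then h [] else h w + h (tl w)) w = h w"
    by (induction w) (auto simp: add.assoc)
qed

lemma digit_act_digit_sum:
  assumes "\<sigma> \<in> Omega"
  shows "digit_act e = \<sigma> \<longleftrightarrow> (\<forall>w. digit_sum e (\<sigma> w) = portrait \<sigma> w)"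
proof
  assume "digit_act e = \<sigma>"
  then show "\<forall>w. digit_sum e (\<sigma> w) = portrait \<sigma> w"
    using digit_act.simps(2)[of e Lx] Omega_Cons[OF assms, of Lx] by simp
next
  assume *: "\<forall>w. digit_sum e (\<sigma> w) = portrait \<sigma> w"
  show "digit_act e = \<sigma>"
  proof
    fix w show "digit_act e w = \<sigma> w"
      by (induction w) (auto simp: Omega_root[OF assms] Omega_Cons[OF assms] *)
  qed
qed

lemma digit_sum_digit:
  assumes "\<sigma> \<in> Omega" shows "digit_sum (digit \<sigma>) (\<sigma> w) = portrait \<sigma> w"
proof -
  obtain e where e: "digit_sum e = (\<lambda>v. portrait \<sigma> (tree_inv \<sigma> v))" using digit_sum_surj by blast
  have inv: "tree_inv \<sigma> (\<sigma> w) = w" "\<sigma> (tree_inv \<sigma> w) = w" for w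
    using Omega_bij[OF assms] by (auto simp: bij_is_inj bij_is_surj surj_f_inv_f)
  have "digital_rep e \<sigma>"
    unfolding digital_rep_iff using digit_act_digit_sum[OF assms, of e] e inv by auto
  moreover have "e' = e" if "digital_rep e' \<sigma>" for e'
  proof (rule digit_sum_inj, rule ext)
    fix v
    show "digit_sum e' v = digit_sum e v"
      using that digit_act_digit_sum[OF assms, of e'] e inv unfolding digital_rep_iff by metis
  qed
  ultimately have "digit \<sigma> = e" unfolding digit_def by blast
  then show ?thesis using e inv by simp
qed

text \<open>Reindexing by \<open>\<sigma>\<close> moves the digit sums from images to all words of
  the level. Two siblings have the same digits at their common proper suffixes, so these cancel in
  pairs and one digit per word is left.\<close>

lemma phi_eq_psum:
  assumes "\<sigma> \<in> Omega" shows "phi i \<sigma> = psum (words i) \<sigma>"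
proof -
  have "psum (words i) \<sigma> = (\<Sum>w\<in>words i. digit_sum (digit \<sigma>) (\<sigma> w))"
    unfolding psum_def using digit_sum_digit[OF assms] by simp
  also have "\<dots> = (\<Sum>u\<in>\<sigma> ` words i. digit_sum (digit \<sigma>) u)"
    by (subst sum.reindex) (auto simp: inj_on_def Omega_inj[OF assms])
  also have "\<dots> = (\<Sum>u\<in>words i. digit_sum (digit \<sigma>) u)"
    by (simp add: Omega_image_words[OF assms])
  also have "\<dots> = (\<Sum>u\<in>words i. digit \<sigma> u)"
  proof (cases i)
    case (Suc j)
    have "(\<Sum>u\<in>words (Suc j). digit_sum (digit \<sigma>) u) + (\<Sum>u\<in>words (Suc j). digit \<sigma> u) = 0"
      unfolding sum_words_Suc sum.distrib[symmetric]
      by (intro sum.neutral ballI) (simp add: add.assoc add.left_commute)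
    then show ?thesis using Suc by (simp add: bit_add_eq_0_iff)
  qed (simp add: words_0)
  finally show ?thesis by (simp add: phi_def words_def)
qed

section \<open>Closed subgroups, level by level\<close>

definition tree_subgroup :: "(word \<Rightarrow> word) set \<Rightarrow> bool" where
  "tree_subgroup G \<longleftrightarrow> G \<subseteq> Omega \<and> id \<in> G \<and> (\<forall>\<sigma>\<in>G. \<forall>\<tau>\<in>G. \<sigma> \<circ> \<tau> \<in> G) \<and> (\<forall>\<sigma>\<in>G. tree_inv \<sigma> \<in> G)"

lemma tree_subgroupD:
  assumes "tree_subgroup G"
  shows "\<sigma> \<in> G \<Longrightarrow> \<sigma> \<in> Omega" "id \<in> G" "\<sigma> \<in> G \<Longrightarrow> \<tau> \<in> G \<Longrightarrow> \<sigma> \<circ> \<tau> \<in> G" "\<sigma> \<in> G \<Longrightarrow> tree_inv \<sigma> \<in> G"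
  using assms by (auto simp: tree_subgroup_def)

text \<open>One exact length suffices: for members of \<open>Omega\<close> the image of a word
  contains the images of its suffixes, so agreement passes to lower levels
  (\<open>agree_Suc_iff\<close>).\<close>

definition agree :: "nat \<Rightarrow> (word \<Rightarrow> word) \<Rightarrow> (word \<Rightarrow> word) \<Rightarrow> bool" where
  "agree n \<sigma> \<tau> \<longleftrightarrow> (\<forall>w. length w = n \<longrightarrow> \<sigma> w = \<tau> w)"

lemma agree_refl [simp]: "agree n \<sigma> \<sigma>"
  by (simp add: agree_def)

lemma agree_sym: "agree n \<sigma> \<tau> \<Longrightarrow> agree n \<tau> \<sigma>"
  by (simp add: agree_def)

lemma agree_trans: "agree n \<sigma> \<tau> \<Longrightarrow> agree n \<tau> \<rho> \<Longrightarrow> agree n \<sigma> \<rho>"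
  by (simp add: agree_def)

lemma agree_0 [simp]: "\<sigma> \<in> Omega \<Longrightarrow> \<tau> \<in> Omega \<Longrightarrow> agree 0 \<sigma> \<tau>"
  by (simp add: agree_def Omega_root)

lemma agree_Suc_iff:
  assumes "\<sigma> \<in> Omega" "\<tau> \<in> Omega"
  shows "agree (Suc n) \<sigma> \<tau> \<longleftrightarrow> agree n \<sigma> \<tau> \<and> (\<forall>w. length w = n \<longrightarrow> portrait \<sigma> w = portrait \<tau> w)"
    (is "?L \<longleftrightarrow> ?R")
proof
  assume L: ?L
  have "\<sigma> w = \<tau> w \<and> portrait \<sigma> w = portrait \<tau> w" if "length w = n" for w
  proof -
    have "\<sigma> (Lx # w) = \<tau> (Lx # w)" using L that by (simp add: agree_def)
    then show ?thesis using assms by (simp add: Omega_Cons)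
  qed
  then show ?R by (auto simp: agree_def)
next
  assume R: ?R
  show ?L unfolding agree_def
  proof (intro allI impI)
    fix w :: word assume "length w = Suc n"
    then obtain s v where "w = s # v" "length v = n" by (cases w) auto
    then show "\<sigma> w = \<tau> w" using R assms by (simp add: Omega_Cons agree_def)
  qed
qed

lemma agree_portrait_less:
  assumes "\<sigma> \<in> Omega" "\<tau> \<in> Omega" "agree n \<sigma> \<tau>" "length w < n"
  shows "portrait \<sigma> w = portrait \<tau> w"
  using assms by (induction n) (auto simp: agree_Suc_iff less_Suc_eq)

lemma agree_act_iff: "agree n (act p) (act q) \<longleftrightarrow> (\<forall>w. length w < n \<longrightarrow> p w = q w)"
proof (induction n)
  case (Suc n) then show ?case by (auto simp: agree_Suc_iff less_Suc_eq)
qed simp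

lemma agree_act_id_iff: "agree n (act p) id \<longleftrightarrow> (\<forall>w. length w < n \<longrightarrow> p w = 0)"
  using agree_act_iff[of n p "\<lambda>_. 0"] by simp

lemma agree_comp:
  assumes "agree n \<sigma> \<sigma>'" "agree n \<tau> \<tau>'" "\<tau> \<in> Omega"
  shows "agree n (\<sigma> \<circ> \<tau>) (\<sigma>' \<circ> \<tau>')"
  unfolding agree_def
proof (intro allI impI)
  fix w :: word assume w: "length w = n"
  then have "length (\<tau> w) = n" using assms(3) by simp
  then show "(\<sigma> \<circ> \<tau>) w = (\<sigma>' \<circ> \<tau>') w" using w assms(1,2) by (simp add: agree_def)
qed

lemma Omega_inv_cancel [simp]:
  assumes "\<sigma> \<in> Omega" shows "tree_inv \<sigma> (\<sigma> w) = w" "\<sigma> (tree_inv \<sigma> w) = w"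
  using Omega_bij[OF assms] by (auto simp: bij_is_inj bij_is_surj surj_f_inv_f)

lemma agree_inv_comp:
  assumes "agree n \<sigma> \<tau>" "\<sigma> \<in> Omega"
  shows "agree n (tree_inv \<sigma> \<circ> \<tau>) id"
  unfolding agree_def
proof (intro allI impI)
  fix w :: word assume "length w = n"
  then have "\<tau> w = \<sigma> w" using assms(1) by (simp add: agree_def)
  then show "(tree_inv \<sigma> \<circ> \<tau>) w = id w" using assms(2) by simp
qed

text \<open>Functions on level \<open>n\<close> are represented by functions on all words; the
  values off level \<open>n\<close> are arbitrary.\<close>

definition ker_portraits :: "(word \<Rightarrow> word) set \<Rightarrow> nat \<Rightarrow> (word \<Rightarrow> bit) set" where
  "ker_portraits G n = {v. \<exists>g\<in>G. agree n g id \<and> (\<forall>w. length w = n \<longrightarrow> portrait g w = v w)}"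

text \<open>Only one inclusion is recorded, since this is applied to \<open>G\<close> contained in
  \<open>M\<close>.\<close>

definition same_level :: "nat \<Rightarrow> (word \<Rightarrow> word) set \<Rightarrow> (word \<Rightarrow> word) set \<Rightarrow> bool" where
  "same_level n G M \<longleftrightarrow> (\<forall>\<sigma>\<in>M. \<exists>g\<in>G. agree n \<sigma> g)"

lemma portrait_conj:
  assumes "g \<in> Omega" "h \<in> Omega" "agree n g id" "length w = n"
  shows "portrait (tree_inv h \<circ> (g \<circ> h)) w = portrait g (h w)"
proof -
  have "length (h w) = n" using assms by simp
  then have "g (h w) = h w" using assms(3) by (simp add: agree_def)
  then show ?thesis
    using assms by (simp add: portrait_comp Omega_comp Omega_inv portrait_inv add.commute)
qed

lemma agree_conj:
  assumes "g \<in> Omega" "h \<in> Omega" "agree n g id"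
  shows "agree n (tree_inv h \<circ> (g \<circ> h)) id"
proof (rule agree_inv_comp)
  show "agree n h (g \<circ> h)"
    using agree_comp[OF agree_sym[OF assms(3)] agree_refl assms(2)] by simp
qed (rule assms)

lemma ker_portraits_add:
  assumes G: "tree_subgroup G" and u: "u \<in> ker_portraits G n" and v: "v \<in> ker_portraits G n"
  shows "(\<lambda>w. u w + v w) \<in> ker_portraits G n"
proof -
  obtain g h where g: "g \<in> G" "agree n g id" "\<And>w. length w = n \<Longrightarrow> portrait g w = u w"
    and h: "h \<in> G" "agree n h id" "\<And>w. length w = n \<Longrightarrow> portrait h w = v w"
    using u v by (auto simp: ker_portraits_def)
  note [simp] = tree_subgroupD(1)[OF G]
  have "agree n (g \<circ> h) id" using agree_comp[OF g(2) h(2)] h(1) by simp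
  moreover have "portrait (g \<circ> h) w = u w + v w" if "length w = n" for w
    using that g h by (simp add: portrait_comp agree_def add.commute)
  ultimately show ?thesis
    using tree_subgroupD(3)[OF G g(1) h(1)] by (auto simp: ker_portraits_def)
qed

text \<open>Conjugation by \<open>h\<close> translates the portrait on level \<open>n\<close> by
  \<open>h\<close>. Only the action of \<open>h\<close> on that level enters, so \<open>h\<close>
  may be taken from all of \<open>M\<close> and replaced by an approximant in
  \<open>G\<close>.\<close>

lemma ker_portraits_invariant:
  assumes G: "tree_subgroup G" and "same_level n G M" "M \<subseteq> Omega" "h \<in> M"
    and v: "v \<in> ker_portraits G n"
  shows "(\<lambda>w. v (h w)) \<in> ker_portraits G n"
proof -
  obtain g where g: "g \<in> G" "agree n g id" "\<And>w. length w = n \<Longrightarrow> portrait g w = v w"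
    using v by (auto simp: ker_portraits_def)
  obtain h' where h': "h' \<in> G" "agree n h h'" using assms by (auto simp: same_level_def)
  note [simp] = tree_subgroupD(1)[OF G]
  have "portrait (tree_inv h' \<circ> (g \<circ> h')) w = v (h w)" if "length w = n" for w
    using portrait_conj[of g h' n w] g h' that by (simp add: agree_def)
  moreover have "tree_inv h' \<circ> (g \<circ> h') \<in> G"
    using g h' G by (simp add: tree_subgroupD)
  moreover have "agree n (tree_inv h' \<circ> (g \<circ> h')) id" using agree_conj g h' by simp
  ultimately show ?thesis by (auto simp: ker_portraits_def)
qed

text \<open>Dividing \<open>\<sigma>\<close> by an approximant \<open>g\<close> leaves an element of
  \<open>M\<close> trivial on level \<open>n\<close>. If \<open>k\<close> in \<open>G\<close> has
  the same portrait there, \<open>g \<circ> k\<close> approximates \<open>\<sigma>\<close> one level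
  further.\<close>

lemma same_level_Suc:
  assumes G: "tree_subgroup G" and M: "tree_subgroup M" and "G \<subseteq> M" and sl: "same_level n G M"
    and ker: "\<And>\<kappa>. \<kappa> \<in> M \<Longrightarrow> agree n \<kappa> id \<Longrightarrow> portrait \<kappa> \<in> ker_portraits G n"
  shows "same_level (Suc n) G M"
  unfolding same_level_def
proof
  fix \<sigma> assume s: "\<sigma> \<in> M"
  obtain g where g: "g \<in> G" "agree n \<sigma> g" using sl s by (auto simp: same_level_def)
  have gM: "g \<in> M" using g assms by blast
  note [simp] = tree_subgroupD(1)[OF M]
  have "tree_inv g \<circ> \<sigma> \<in> M" using M s gM by (simp add: tree_subgroupD)
  moreover have "agree n (tree_inv g \<circ> \<sigma>) id"
    by (rule agree_inv_comp) (use g gM agree_sym in auto)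
  ultimately obtain k where k: "k \<in> G" "agree n k id"
    "\<And>w. length w = n \<Longrightarrow> portrait k w = portrait (tree_inv g \<circ> \<sigma>) w"
    using ker[of "tree_inv g \<circ> \<sigma>"] unfolding ker_portraits_def by auto
  have kM: "k \<in> M" using k assms by blast
  have sig: "portrait \<sigma> w = portrait (tree_inv g \<circ> \<sigma>) w + portrait g (tree_inv g (\<sigma> w))" for w
  proof -
    have "g \<circ> (tree_inv g \<circ> \<sigma>) = \<sigma>" using gM by (auto simp: fun_eq_iff)
    then show ?thesis
      using portrait_comp[of g "tree_inv g \<circ> \<sigma>" w] gM s by (simp add: Omega_comp Omega_inv)
  qed
  have "portrait \<sigma> w = portrait (g \<circ> k) w" if w: "length w = n" for w
  proof -
    have "tree_inv g (\<sigma> w) = w" using g(2) w gM by (simp add: agree_def)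
    moreover have "k w = w" using k(2) w by (simp add: agree_def)
    ultimately show ?thesis using sig[of w] k(3)[OF w] kM gM by (simp add: portrait_comp)
  qed
  moreover have "agree n \<sigma> (g \<circ> k)"
    using g(2) k(2) by (simp add: agree_def)
  ultimately have "agree (Suc n) \<sigma> (g \<circ> k)"
    using s gM kM by (simp add: agree_Suc_iff Omega_comp)
  then show "\<exists>g\<in>G. agree (Suc n) \<sigma> g" using tree_subgroupD(3)[OF G g(1) k(1)] by blast
qed

lemma same_level_closed:
  assumes "tree_subgroup M" "G \<subseteq> M" "\<And>n. same_level n G M"
    and closed: "\<And>\<sigma>. \<sigma> \<in> Omega \<Longrightarrow> (\<And>n. \<exists>g\<in>G. agree n \<sigma> g) \<Longrightarrow> \<sigma> \<in> G"
  shows "G = M"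
proof
  show "M \<subseteq> G"
  proof
    fix \<sigma> assume "\<sigma> \<in> M"
    then show "\<sigma> \<in> G"
      using assms(3) tree_subgroupD(1)[OF assms(1)] by (intro closed) (auto simp: same_level_def)
  qed
qed (rule assms)

section \<open>Invariant spaces of functions on a level\<close>

definition fsum :: "(word \<Rightarrow> bit) \<Rightarrow> word \<Rightarrow> bit" where
  "fsum u w = u (Lx # w) + u (Ly # w)"

definition delta :: "word \<Rightarrow> word \<Rightarrow> bit" where
  "delta u w = (if w = u then 1 else 0)"

lemma delta_self [simp]: "delta u u = 1" by (simp add: delta_def)

lemma delta_neq: "w \<noteq> u \<Longrightarrow> delta u w = 0" by (simp add: delta_def)

lemma sum_delta [simp]: "finite S \<Longrightarrow> (\<Sum>w\<in>S. delta u w) = (if u \<in> S then 1 else 0)"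
  unfolding delta_def by (simp add: sum.delta)

lemma fsum_add: "fsum (\<lambda>w. u w + v w) = (\<lambda>w. fsum u w + fsum v w)"
  by (auto simp: fsum_def fun_eq_iff add_ac)

lemma fsum_Omega: "g \<in> Omega \<Longrightarrow> fsum (\<lambda>w. u (g w)) = (\<lambda>w. fsum u (g w))"
proof
  fix w assume "g \<in> Omega"
  then show "fsum (\<lambda>w. u (g w)) w = fsum u (g w)"
    by (cases "portrait g w") (auto simp: fsum_def Omega_Cons add.commute)
qed

lemma sum_fsum: "(\<Sum>w\<in>words n. fsum u w) = (\<Sum>w\<in>words (Suc n). u w)"
  by (simp add: sum_words_Suc fsum_def)

text \<open>Once the indicators of the fibres of \<open>h\<close> are available, so are all
  functions constant on the fibres. As \<open>W\<close> is only closed under sums, zero is obtained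
  as \<open>u + u\<close>.\<close>

lemma combine_on_finite:
  fixes c :: "'b \<Rightarrow> bit"
  assumes fin: "finite A" and add: "\<And>u v. u \<in> W \<Longrightarrow> v \<in> W \<Longrightarrow> (\<lambda>w. u w + v w) \<in> W"
    and ne: "W \<noteq> {}"
    and single: "\<And>a. a \<in> A \<Longrightarrow> \<exists>e\<in>W. \<forall>w\<in>D. e w = (if h w = a then 1 else (0::bit))"
  shows "\<exists>e\<in>W. \<forall>w\<in>D. e w = (if h w \<in> A then c (h w) else 0)"
  using fin single
proof (induction A)
  case empty
  obtain u where "u \<in> W" using ne by blast
  then show ?case using add[of u u] by auto
next
  case (insert a A)
  obtain e where e: "e \<in> W" "\<And>w. w \<in> D \<Longrightarrow> e w = (if h w \<in> A then c (h w) else 0)"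
    using insert.IH insert.prems by blast
  obtain d where d: "d \<in> W" "\<And>w. w \<in> D \<Longrightarrow> d w = (if h w = a then 1 else 0)"
    using insert.prems by blast
  show ?case
  proof (cases "c a = 0")
    case True
    then have "\<forall>w\<in>D. e w = (if h w \<in> insert a A then c (h w) else 0)"
      using e(2) insert.hyps by auto
    then show ?thesis using e(1) by (rule bexI)
  next
    case False
    then have "\<forall>w\<in>D. e w + d w = (if h w \<in> insert a A then c (h w) else 0)"
      using e(2) d(2) insert.hyps by auto
    then show ?thesis using add[OF e(1) d(1)] by (rule bexI)
  qed
qed

text \<open>
  If \<open>u\<close> has fibre sum \<open>1\<close> at \<open>w\<^sub>0\<close> and \<open>g\<close> flips the fibre over \<open>w\<^sub>0\<close>, then \<open>u + u \<circ> g\<close> is the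
  indicator of that fibre; so surjectivity of the fibre sums lifts to surjectivity one level up.
\<close>

lemma fibre_step:
  fixes C :: "(word \<Rightarrow> bit) \<Rightarrow> bool"
  assumes add: "\<And>u v. u \<in> W \<Longrightarrow> v \<in> W \<Longrightarrow> (\<lambda>w. u w + v w) \<in> W"
    and inv: "\<And>g u. g \<in> M \<Longrightarrow> u \<in> W \<Longrightarrow> (\<lambda>w. u (g w)) \<in> W"
    and M: "M \<subseteq> Omega"
    and flips: "\<And>w0. length w0 = n \<Longrightarrow> \<exists>v g. C v \<and> v w0 = 1 \<and> g \<in> M \<and> agree n g id \<and>
        portrait g w0 = 1 \<and> (\<forall>w. length w = n \<longrightarrow> w \<noteq> w0 \<longrightarrow> portrait g w * v w = 0)"
    and cov: "\<And>v. C v \<Longrightarrow> \<exists>u\<in>W. \<forall>w. length w = n \<longrightarrow> fsum u w = v w"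
    and t: "C (fsum t)"
  shows "\<exists>u\<in>W. \<forall>w. length w = Suc n \<longrightarrow> u w = t w"
proof -
  have single: "\<exists>e\<in>W. \<forall>w\<in>words (Suc n). e w = (if tl w = w0 then 1 else 0)" if w0: "length w0 = n" for w0
  proof -
    obtain v g where vg: "C v" "v w0 = 1" "g \<in> M" "agree n g id" "portrait g w0 = 1"
      "\<And>w. length w = n \<Longrightarrow> w \<noteq> w0 \<Longrightarrow> portrait g w * v w = 0" using flips[OF w0] by blast
    obtain u where u: "u \<in> W" "\<And>w. length w = n \<Longrightarrow> fsum u w = v w" using cov[OF vg(1)] by blast
    have gO: "g \<in> Omega" using vg M by blast
    have "u x + u (g x) = (if tl x = w0 then 1 else 0)" if x: "x \<in> words (Suc n)" for x
    proof -
      obtain s w where x: "x = s # w" "length w = n" using x by (cases x) auto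
      have "g x = flipb (portrait g w) s # w"
        using x vg(4) by (simp add: Omega_Cons[OF gO] agree_def)
      then have "u x + u (g x) = portrait g w * fsum u w"
        using x by (cases "portrait g w"; cases s) (auto simp: fsum_def add.commute)
      then show ?thesis using x u(2) vg by (cases "w = w0") auto
    qed
    then show ?thesis by (intro bexI[OF _ add[OF u(1) inv[OF vg(3) u(1)]]] ballI)
  qed
  obtain u where u: "u \<in> W" "\<And>w. length w = n \<Longrightarrow> fsum u w = fsum t w" using cov[OF t] by blast
  \<comment> \<open>\<open>u\<close> and \<open>t\<close> have equal fibre sums, so
    \<open>t + u\<close> is constant on each fibre; \<open>c\<close> is this constant.\<close>
  define c where "c w = t (Lx # w) + u (Lx # w)" for w
  have "\<exists>e\<in>W. \<forall>w\<in>words (Suc n). e w = (if tl w \<in> words n then c (tl w) else 0)"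
    by (rule combine_on_finite[OF finite_words add]) (use u(1) single in \<open>auto simp only: in_words_iff\<close>)
  then obtain e where e: "e \<in> W"
    "\<And>w. w \<in> words (Suc n) \<Longrightarrow> e w = (if tl w \<in> words n then c (tl w) else 0)" by blast
  have "u x + e x = t x" if x: "length x = Suc n" for x
  proof -
    obtain s w where x: "x = s # w" "length w = n" using x by (cases x) auto
    have "e x = c w" using e(2) x by simp
    moreover have "u (Lx # w) + u (Ly # w) = t (Lx # w) + t (Ly # w)"
      using u(2)[of w] x by (simp add: fsum_def)
    ultimately show ?thesis using x
      by (cases s; cases "u (Lx # w)"; cases "u (Ly # w)"; cases "t (Lx # w)"; cases "t (Ly # w)")
         (auto simp: c_def)
  qed
  then show ?thesis by (intro bexI[OF _ add[OF u(1) e(1)]] allI impI)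
qed

definition invariant_space :: "(word \<Rightarrow> word) set \<Rightarrow> (word \<Rightarrow> bit) set \<Rightarrow> bool" where
  "invariant_space M W \<longleftrightarrow> (\<forall>u\<in>W. \<forall>v\<in>W. (\<lambda>w. u w + v w) \<in> W) \<and> (\<forall>g\<in>M. \<forall>u\<in>W. (\<lambda>w. u (g w)) \<in> W)"

lemma invariant_spaceD:
  assumes "invariant_space M W"
  shows "u \<in> W \<Longrightarrow> v \<in> W \<Longrightarrow> (\<lambda>w. u w + v w) \<in> W" "g \<in> M \<Longrightarrow> u \<in> W \<Longrightarrow> (\<lambda>w. u (g w)) \<in> W"
  using assms unfolding invariant_space_def by blast+

lemma invariant_space_fsum:
  assumes W: "invariant_space M W" and M: "M \<subseteq> Omega"
  shows "invariant_space M (fsum ` W)"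
  unfolding invariant_space_def
proof (intro conjI ballI)
  fix u v assume "u \<in> fsum ` W" "v \<in> fsum ` W"
  then obtain u' v' where "u' \<in> W" "v' \<in> W" "u = fsum u'" "v = fsum v'" by blast
  then show "(\<lambda>w. u w + v w) \<in> fsum ` W"
    using invariant_spaceD(1)[OF W] by (intro image_eqI[where x = "\<lambda>w. u' w + v' w"]) (auto simp: fsum_add)
next
  fix g u assume g: "g \<in> M" and "u \<in> fsum ` W"
  then obtain u' where u': "u' \<in> W" "u = fsum u'" by blast
  have "g \<in> Omega" using g M by blast
  then show "(\<lambda>w. u (g w)) \<in> fsum ` W"
    using invariant_spaceD(2)[OF W g u'(1)] u'(2)
    by (intro image_eqI[where x = "\<lambda>w. u' (g w)"]) (auto simp: fsum_Omega)
qed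

definition fixes_level :: "nat \<Rightarrow> (word \<Rightarrow> word) \<Rightarrow> bool" where
  "fixes_level n g \<longleftrightarrow> agree n g id"

text \<open>Fibre sums preserve the total, so an odd function pushes forward to an odd function on
  every lower level and finally to \<open>1\<close> at the root. \<open>fibre_step\<close> then
  climbs back up.\<close>

lemma full_cover:
  fixes W :: "(word \<Rightarrow> bit) set"
  assumes M: "M \<subseteq> Omega"
    and flips: "\<And>w. length w < n \<Longrightarrow> \<exists>g\<in>M. fixes_level (length w) g \<and> portrait g w = 1"
    and inv: "invariant_space M W"
    and u: "u \<in> W" "(\<Sum>w\<in>words n. u w) = 1"
  shows "\<exists>v\<in>W. \<forall>w. length w = n \<longrightarrow> v w = t w"
  using flips inv u
proof (induction n arbitrary: W u t)
  case 0
  show ?case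
  proof (cases "t [] = 1")
    case True then show ?thesis using 0 by (intro bexI[of _ u]) (auto simp: words_0)
  next
    case False then show ?thesis using invariant_spaceD(1)[OF 0(2) 0(3,3)] by (intro bexI[of _ "\<lambda>w. u w + u w"]) auto
  qed
next
  case (Suc n)
  have cov: "\<exists>v\<in>fsum ` W. \<forall>w. length w = n \<longrightarrow> v w = t w" for t
  proof (rule Suc.IH[of "fsum ` W" "fsum u"])
    show "\<exists>g\<in>M. fixes_level (length w) g \<and> portrait g w = 1" if "length w < n" for w
      using Suc.prems(1)[of w] that by simp
    show "invariant_space M (fsum ` W)" using invariant_space_fsum[OF Suc.prems(2) M] .
  qed (use Suc.prems in \<open>auto simp: sum_fsum\<close>)
  show ?case
  proof (rule fibre_step[where M = M and C = "\<lambda>_. True"])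
    fix w0 :: word assume w0: "length w0 = n"
    then obtain g where "g \<in> M" "agree n g id" "portrait g w0 = 1" using Suc.prems(1)[of w0] by (auto simp: fixes_level_def)
    then show "\<exists>v g. True \<and> v w0 = (1::bit) \<and> g \<in> M \<and> agree n g id \<and>
        portrait g w0 = 1 \<and> (\<forall>w. length w = n \<longrightarrow> w \<noteq> w0 \<longrightarrow> portrait g w * v w = 0)"
      by (intro exI[of _ "delta w0"] exI[of _ g]) (auto simp: delta_neq)
  next
    show "\<exists>u\<in>W. \<forall>w. length w = n \<longrightarrow> fsum u w = v w" for v using cov[of v] by blast
  qed (use Suc.prems M invariant_spaceD[OF Suc.prems(2)] in auto)
qed

text \<open>The last letter is the one next to the root. The condition \<open>w \<noteq> []\<close>
  keeps the unspecified \<open>last []\<close> out, so that \<open>branch 0 s\<close> is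
  empty.\<close>

definition branch :: "nat \<Rightarrow> letter \<Rightarrow> word set" where
  "branch n s = {w. length w = n \<and> w \<noteq> [] \<and> last w = s}"

lemma finite_branch [simp]: "finite (branch n s)"
  by (rule finite_subset[OF _ finite_words[of n]]) (auto simp: branch_def)

lemma branch_1: "branch (Suc 0) s = {[s]}"
  by (auto simp: branch_def length_Suc_conv)

lemma branch_Suc: "n \<ge> 1 \<Longrightarrow> branch (Suc n) s = (#) Lx ` branch n s \<union> (#) Ly ` branch n s"
proof (rule Set.set_eqI)
  fix w assume n: "n \<ge> 1"
  show "w \<in> branch (Suc n) s \<longleftrightarrow> w \<in> (#) Lx ` branch n s \<union> (#) Ly ` branch n s"
  proof (cases w)
    case (Cons r v) then show ?thesis using n by (cases r) (auto simp: branch_def)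
  qed (auto simp: branch_def)
qed

lemma sum_branch_fsum:
  "n \<ge> 1 \<Longrightarrow> (\<Sum>w\<in>branch n s. fsum u w) = (\<Sum>w\<in>branch (Suc n) s. u w)"
  by (subst branch_Suc, simp, subst sum.union_disjoint) (auto simp: sum.reindex sum.distrib fsum_def)

lemma words_eq_branches: "n \<ge> 1 \<Longrightarrow> words n = branch n s \<union> branch n (flip s)"
  by (auto simp: branch_def letter_neq_iff)

lemma sum_words_branches:
  "n \<ge> 1 \<Longrightarrow> (\<Sum>w\<in>words n. u w) = (\<Sum>w\<in>branch n s. u w) + (\<Sum>w\<in>branch n (flip s). u w)"
  by (subst words_eq_branches[of n s], simp, subst sum.union_disjoint) (auto simp: branch_def finite_branch[unfolded branch_def])

lemma psum_words_branches: "n \<ge> 1 \<Longrightarrow> psum (words n) \<sigma> = psum (branch n s) \<sigma> + psum (branch n (flip s)) \<sigma>"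
  unfolding psum_def by (rule sum_words_branches)

lemma Omega_last:
  assumes "\<sigma> \<in> Omega" "w \<noteq> []" shows "last (\<sigma> w) = flipb (portrait \<sigma> []) (last w)"
  using assms(2)
proof (induction w)
  case (Cons s w) then show ?case
    using Omega_Cons[OF assms(1), of s w] Omega_root[OF assms(1)]
      Omega_length[OF assms(1), of w] by (cases w) auto
qed simp

lemma Omega_image_branch:
  assumes "\<sigma> \<in> Omega" shows "\<sigma> ` branch n s = branch n (flipb (portrait \<sigma> []) s)"
proof -
  have sub: "\<sigma> ` branch n s \<subseteq> branch n (flipb (portrait \<sigma> []) s)" if "\<sigma> \<in> Omega" for \<sigma> s
    using that by (auto simp: branch_def Omega_last dest: arg_cong[where f = length])
  have "w \<in> \<sigma> ` branch n s" if "w \<in> branch n (flipb (portrait \<sigma> []) s)" for w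
  proof (rule image_eqI)
    show "w = \<sigma> (tree_inv \<sigma> w)" using assms by simp
    have "portrait (tree_inv \<sigma>) [] = portrait \<sigma> []"
      using portrait_inv[OF assms, of "[]"] Omega_root[OF assms] by simp
    then show "tree_inv \<sigma> w \<in> branch n s"
      using sub[OF Omega_inv[OF assms]] that by fastforce
  qed
  then show ?thesis using sub[OF assms] by blast
qed

text \<open>Version of \<open>full_cover\<close> for groups that may preserve the halves: the
  descent stops at level one, where the two values have to be attained separately.\<close>

lemma branch_cover:
  fixes W :: "(word \<Rightarrow> bit) set"
  assumes "n \<ge> 1" and M: "M \<subseteq> Omega"
    and flips: "\<And>w. 1 \<le> length w \<Longrightarrow> length w < n \<Longrightarrow> \<exists>g\<in>M. fixes_level (length w) g \<and> portrait g w = 1"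
    and inv: "invariant_space M W"
    and u: "\<And>s. \<exists>u\<in>W. (\<Sum>w\<in>branch n s. u w) = 1 \<and> (\<Sum>w\<in>branch n (flip s). u w) = 0"
  shows "\<exists>v\<in>W. \<forall>w. length w = n \<longrightarrow> v w = t w"
  using assms(1) flips inv u
proof (induction n arbitrary: W t rule: nat_induct_at_least)
  case base
  have single: "\<exists>e\<in>W. \<forall>w\<in>words (Suc 0). e w = (if w = a then 1 else 0)" if a: "a \<in> words (Suc 0)" for a
  proof -
    obtain s where s: "a = [s]" using a by (auto simp: length_Suc_conv)
    obtain u where u: "u \<in> W" "u [s] = 1" "u [flip s] = 0" using base(3)[of s] by (auto simp: branch_1)
    have "u w = (if w = a then 1 else 0)" if w: "w \<in> words (Suc 0)" for w
    proof -
      obtain r where r: "w = [r]" using w by (auto simp: length_Suc_conv)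
      show ?thesis using u s r letter_neq_iff[of r s] by (cases "r = s") auto
    qed
    then show ?thesis using u(1) by blast
  qed
  have "W \<noteq> {}" using base(3) by blast
  have "\<exists>e\<in>W. \<forall>w\<in>words (Suc 0). e w = (if w \<in> words (Suc 0) then t w else 0)"
    by (rule combine_on_finite[OF finite_words invariant_spaceD(1)[OF base(2)] \<open>W \<noteq> {}\<close> single])
  then show ?case by (simp add: words_def)
next
  case (Suc n)
  have cov: "\<exists>v\<in>fsum ` W. \<forall>w. length w = n \<longrightarrow> v w = t w" for t
  proof (rule Suc.IH[of "fsum ` W"])
    show "\<exists>g\<in>M. fixes_level (length w) g \<and> portrait g w = 1" if "1 \<le> length w" "length w < n" for w
      using Suc.prems(1)[of w] that by simp
    show "invariant_space M (fsum ` W)" using invariant_space_fsum[OF Suc.prems(2) M] .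
    show "\<exists>u\<in>fsum ` W. (\<Sum>w\<in>branch n s. u w) = 1 \<and> (\<Sum>w\<in>branch n (flip s). u w) = 0" for s
      using Suc.prems(3)[of s] by (auto simp: sum_branch_fsum[OF Suc.hyps])
  qed
  show ?case
  proof (rule fibre_step[where M = M and C = "\<lambda>_. True"])
    fix w0 :: word assume w0: "length w0 = n"
    then obtain g where "g \<in> M" "agree n g id" "portrait g w0 = 1"
      using Suc.prems(1)[of w0] Suc.hyps by (auto simp: fixes_level_def)
    then show "\<exists>v g. True \<and> v w0 = (1::bit) \<and> g \<in> M \<and> agree n g id \<and>
        portrait g w0 = 1 \<and> (\<forall>w. length w = n \<longrightarrow> w \<noteq> w0 \<longrightarrow> portrait g w * v w = 0)"
      by (intro exI[of _ "delta w0"] exI[of _ g]) (auto simp: delta_neq)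
  next
    show "\<exists>u\<in>W. \<forall>w. length w = n \<longrightarrow> fsum u w = v w" for v using cov[of v] by blast
  qed (use Suc.prems M invariant_spaceD[OF Suc.prems(2)] in auto)
qed

lemma ex_other_word:
  fixes w :: word
  assumes "length w = n" "n \<ge> 1" shows "\<exists>w'. length w' = n \<and> w' \<noteq> w \<and> last w' \<noteq> last w"
proof -
  have "w \<noteq> []" using assms by auto
  then show ?thesis using assms
    by (intro exI[of _ "butlast w @ [flip (last w)]"]) (auto dest: arg_cong[where f = last])
qed

text \<open>Again the descent stops at level one, where the even functions are generated by
  \<open>(1, 1)\<close>. An even function that is \<open>1\<close> at \<open>w0\<close> is also
  \<open>1\<close> somewhere else, and \<open>fibre_step\<close> must not see a flip there; hence
  the flips have to be isolated.\<close>

lemma even_cover: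
  fixes W :: "(word \<Rightarrow> bit) set"
  assumes "n \<ge> 1" and M: "M \<subseteq> Omega"
    and flips: "\<And>w. 1 \<le> length w \<Longrightarrow> length w < n \<Longrightarrow>
       \<exists>g\<in>M. fixes_level (length w) g \<and> (\<forall>v. length v = length w \<longrightarrow> portrait g v = delta w v)"
    and inv: "invariant_space M W"
    and u: "u \<in> W" "(\<Sum>w\<in>branch n Lx. u w) = 1" "(\<Sum>w\<in>branch n Ly. u w) = 1"
    and t: "(\<Sum>w\<in>words n. t w) = 0"
  shows "\<exists>v\<in>W. \<forall>w. length w = n \<longrightarrow> v w = t w"
  using assms(1) flips inv u t
proof (induction n arbitrary: W u t rule: nat_induct_at_least)
  case base
  have "t [Lx] = t [Ly]"
    using base(6) by (simp add: sum_words_branches[of _ _ Lx] branch_1 bit_add_eq_0_iff)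
  show ?case
  proof (cases "t [Lx] = 1")
    case True
    have "u w = t w" if "length w = 1" for w
    proof (cases w)
      case (Cons s v)
      then show ?thesis using that True base(4,5) \<open>t [Lx] = t [Ly]\<close> by (cases s) (auto simp: branch_1)
    qed (use that in auto)
    then show ?thesis using base(3) by blast
  next
    case False
    have "u w + u w = t w" if "length w = 1" for w
    proof (cases w)
      case (Cons s v)
      then show ?thesis using that False \<open>t [Lx] = t [Ly]\<close> by (cases s) auto
    qed (use that in auto)
    then show ?thesis by (intro bexI[OF _ invariant_spaceD(1)[OF base(2) base(3,3)]]) auto
  qed
next
  case (Suc n)
  have cov: "\<exists>v\<in>fsum ` W. \<forall>w. length w = n \<longrightarrow> v w = t w" if "(\<Sum>w\<in>words n. t w) = 0" for t
  proof (rule Suc.IH[of "fsum ` W" "fsum u"])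
    show "\<exists>g\<in>M. fixes_level (length w) g \<and> (\<forall>v. length v = length w \<longrightarrow> portrait g v = delta w v)"
      if "1 \<le> length w" "length w < n" for w
      using Suc.prems(1)[of w] that by simp
    show "invariant_space M (fsum ` W)" using invariant_space_fsum[OF Suc.prems(2) M] .
  qed (use Suc.prems that in \<open>auto simp: sum_branch_fsum[OF Suc.hyps]\<close>)
  show ?case
  proof (rule fibre_step[where M = M and C = "\<lambda>v. (\<Sum>w\<in>words n. v w) = 0"])
    fix w0 :: word assume w0: "length w0 = n"
    then obtain g where g: "g \<in> M" "agree n g id" "\<And>v. length v = n \<Longrightarrow> portrait g v = delta w0 v"
      using Suc.prems(1)[of w0] Suc.hyps by (auto simp: fixes_level_def)
    obtain w1 where w1: "length w1 = n" "w1 \<noteq> w0" using ex_other_word[OF w0 Suc.hyps] by blast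
    \<comment> \<open>The second word only makes the total even; \<open>g\<close> does not flip
      there.\<close>
    have "(\<Sum>w\<in>words n. delta w0 w + delta w1 w) = 0" using w0 w1 by (simp add: sum.distrib)
    then show "\<exists>v g. (\<Sum>w\<in>words n. v w) = 0 \<and> v w0 = (1::bit) \<and> g \<in> M \<and> agree n g id \<and>
        portrait g w0 = 1 \<and> (\<forall>w. length w = n \<longrightarrow> w \<noteq> w0 \<longrightarrow> portrait g w * v w = 0)"
      using g w0 w1
      by (intro exI[of _ "\<lambda>w. delta w0 w + delta w1 w"] exI[of _ g]) (auto simp: delta_neq)
  next
    show "\<exists>u\<in>W. \<forall>w. length w = n \<longrightarrow> fsum u w = v w" if "(\<Sum>w\<in>words n. v w) = 0" for v
      using cov[OF that] by blast
  qed (use Suc.prems M invariant_spaceD[OF Suc.prems(2)] in \<open>auto simp: sum_fsum\<close>)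
qed

section \<open>Characters of finite level\<close>

definition level_hom :: "(word \<Rightarrow> word) set \<Rightarrow> nat \<Rightarrow> ((word \<Rightarrow> word) \<Rightarrow> bit) \<Rightarrow> bool" where
  "level_hom M n \<chi> \<longleftrightarrow> (\<forall>\<sigma>\<in>M. \<forall>\<tau>\<in>M. \<chi> (\<sigma> \<circ> \<tau>) = \<chi> \<sigma> + \<chi> \<tau>) \<and>
     (\<forall>\<sigma>\<in>M. \<forall>\<tau>\<in>M. agree n \<sigma> \<tau> \<longrightarrow> \<chi> \<sigma> = \<chi> \<tau>)"

lemma level_homI:
  assumes M: "tree_subgroup M" and hom: "\<And>\<sigma> \<tau>. \<sigma> \<in> M \<Longrightarrow> \<tau> \<in> M \<Longrightarrow> \<chi> (\<sigma> \<circ> \<tau>) = \<chi> \<sigma> + \<chi> \<tau>"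
    and ker: "\<And>\<kappa>. \<kappa> \<in> M \<Longrightarrow> agree n \<kappa> id \<Longrightarrow> \<chi> \<kappa> = 0"
  shows "level_hom M n \<chi>"
proof -
  have "\<chi> \<sigma> = \<chi> \<tau>" if st: "\<sigma> \<in> M" "\<tau> \<in> M" "agree n \<sigma> \<tau>" for \<sigma> \<tau>
  proof -
    have s: "\<sigma> \<in> Omega" using tree_subgroupD(1)[OF M st(1)] .
    have k: "tree_inv \<sigma> \<circ> \<tau> \<in> M" using M st by (simp add: tree_subgroupD)
    have "\<sigma> \<circ> (tree_inv \<sigma> \<circ> \<tau>) = \<tau>" using s by (auto simp: fun_eq_iff)
    then have "\<chi> \<tau> = \<chi> \<sigma> + \<chi> (tree_inv \<sigma> \<circ> \<tau>)" using hom[OF st(1) k] by simp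
    then show ?thesis using ker[OF k agree_inv_comp[OF st(3) s]] by simp
  qed
  then show ?thesis using hom unfolding level_hom_def by blast
qed

lemma level_homD:
  assumes "level_hom M n \<chi>"
  shows "\<sigma> \<in> M \<Longrightarrow> \<tau> \<in> M \<Longrightarrow> \<chi> (\<sigma> \<circ> \<tau>) = \<chi> \<sigma> + \<chi> \<tau>"
    "\<sigma> \<in> M \<Longrightarrow> \<tau> \<in> M \<Longrightarrow> agree n \<sigma> \<tau> \<Longrightarrow> \<chi> \<sigma> = \<chi> \<tau>"
  using assms unfolding level_hom_def by blast+

lemma level_hom_id:
  assumes "level_hom M n \<chi>" "id \<in> M" shows "\<chi> id = 0"
  using level_homD(1)[OF assms(1,2,2)] by (cases "\<chi> id") auto

lemma level_hom_inv:
  assumes "level_hom M n \<chi>" "tree_subgroup M" "\<sigma> \<in> M" shows "\<chi> (tree_inv \<sigma>) = \<chi> \<sigma>"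
proof -
  have "tree_inv \<sigma> \<circ> \<sigma> = id" using tree_subgroupD(1)[OF assms(2,3)] by (auto simp: fun_eq_iff)
  then have "\<chi> (tree_inv \<sigma>) + \<chi> \<sigma> = 0"
    using level_homD(1)[OF assms(1) tree_subgroupD(4)[OF assms(2,3)] assms(3)]
      level_hom_id[OF assms(1) tree_subgroupD(2)[OF assms(2)]] by simp
  then show ?thesis by (simp add: bit_add_eq_0_iff)
qed

text \<open>On level \<open>n\<close> the groups \<open>G\<close> and \<open>M\<close> have the same
  image, and the character factors through it. Its value at \<open>\<sigma>\<close> is that of any
  approximant of \<open>\<sigma>\<close> in \<open>G\<close>.\<close>

lemma level_hom_extend:
  assumes G: "tree_subgroup G" and M: "tree_subgroup M" and "G \<subseteq> M" and sl: "same_level n G M"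
    and hom: "level_hom G n \<chi>"
  shows "\<exists>\<chi>'. level_hom M n \<chi>' \<and> (\<forall>g\<in>G. \<chi>' g = \<chi> g)"
proof -
  define r where "r \<sigma> = (SOME g. g \<in> G \<and> agree n \<sigma> g)" for \<sigma>
  have r: "r \<sigma> \<in> G" "agree n \<sigma> (r \<sigma>)" if "\<sigma> \<in> M" for \<sigma>
    using that sl someI_ex[of "\<lambda>g. g \<in> G \<and> agree n \<sigma> g"] by (auto simp: same_level_def r_def)
  have eq: "\<chi> (r \<sigma>) = \<chi> g" if "\<sigma> \<in> M" "g \<in> G" "agree n \<sigma> g" for \<sigma> g
    using level_homD(2)[OF hom r(1)[OF that(1)] that(2)] agree_trans[OF agree_sym[OF r(2)[OF that(1)]] that(3)] .
  have "level_hom M n (\<lambda>\<sigma>. \<chi> (r \<sigma>))"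
    unfolding level_hom_def
  proof (intro conjI ballI impI)
    fix \<sigma> \<tau> assume st: "\<sigma> \<in> M" "\<tau> \<in> M"
    have "agree n (\<sigma> \<circ> \<tau>) (r \<sigma> \<circ> r \<tau>)"
      using agree_comp[OF r(2)[OF st(1)] r(2)[OF st(2)]] tree_subgroupD(1)[OF M st(2)] by simp
    then show "\<chi> (r (\<sigma> \<circ> \<tau>)) = \<chi> (r \<sigma>) + \<chi> (r \<tau>)"
      using eq[OF tree_subgroupD(3)[OF M st] tree_subgroupD(3)[OF G r(1)[OF st(1)] r(1)[OF st(2)]]]
        level_homD(1)[OF hom r(1)[OF st(1)] r(1)[OF st(2)]] by simp
  next
    fix \<sigma> \<tau> assume st: "\<sigma> \<in> M" "\<tau> \<in> M" "agree n \<sigma> \<tau>"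
    then show "\<chi> (r \<sigma>) = \<chi> (r \<tau>)"
      using eq[OF st(1) r(1)[OF st(2)] agree_trans[OF st(3) r(2)[OF st(2)]]] by simp
  qed
  moreover have "\<chi> (r g) = \<chi> g" if "g \<in> G" for g using eq[of g g] that assms(3) by auto
  ultimately show ?thesis by (intro exI[of _ "\<lambda>\<sigma>. \<chi> (r \<sigma>)"]) auto
qed

text \<open>On elements trivial up to level \<open>n\<close> a character of level
  \<open>n + 1\<close> depends only on the portrait on level \<open>n\<close>, additively. Values in
  a commutative group make it invariant under conjugation, that is, under translation by
  \<open>M\<close>.\<close>

lemma kernel_functional:
  assumes M: "tree_subgroup M" and hom: "level_hom M (Suc n) \<chi>"
  obtains K where
    "\<And>g. g \<in> M \<Longrightarrow> agree n g id \<Longrightarrow> \<chi> g = K (portrait g)"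
    "\<And>u v. u \<in> ker_portraits M n \<Longrightarrow> v \<in> ker_portraits M n \<Longrightarrow> K (\<lambda>w. u w + v w) = K u + K v"
    "\<And>h v. h \<in> M \<Longrightarrow> v \<in> ker_portraits M n \<Longrightarrow> K (\<lambda>w. v (h w)) = K v"
    "\<And>u v. u \<in> ker_portraits M n \<Longrightarrow> (\<And>w. length w = n \<Longrightarrow> u w = v w) \<Longrightarrow> K u = K v"
proof -
  define rel where "rel v g \<longleftrightarrow> g \<in> M \<and> agree n g id \<and> (\<forall>w. length w = n \<longrightarrow> portrait g w = v w)" for v g
  define K where "K v = \<chi> (SOME g. rel v g)" for v
  note O = tree_subgroupD(1)[OF M]
  have K: "K v = \<chi> g" if "rel v g" for v g
  proof -
    have r: "rel v (SOME g. rel v g)" using someI[of "rel v", OF that] .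
    define h where "h = (SOME g. rel v g)"
    have h: "h \<in> M" "agree n h id" "\<And>w. length w = n \<Longrightarrow> portrait h w = v w"
      using r by (auto simp: rel_def h_def)
    have g: "g \<in> M" "agree n g id" "\<And>w. length w = n \<Longrightarrow> portrait g w = v w"
      using that by (auto simp: rel_def)
    have "agree (Suc n) h g"
      using h g O agree_trans[OF h(2) agree_sym[OF g(2)]] by (simp add: agree_Suc_iff)
    then show ?thesis using level_homD(2)[OF hom h(1) g(1)] by (simp add: K_def h_def)
  qed
  have ex: "\<exists>g. rel v g" if "v \<in> ker_portraits M n" for v
    using that by (auto simp: rel_def ker_portraits_def)
  show thesis
  proof
    show "\<chi> g = K (portrait g)" if "g \<in> M" "agree n g id" for g
      using K[of "portrait g" g] that by (simp add: rel_def)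
    show "K (\<lambda>w. u w + v w) = K u + K v" if uv: "u \<in> ker_portraits M n" "v \<in> ker_portraits M n" for u v
    proof -
      obtain g h where g: "rel u g" and h: "rel v h" using ex[OF uv(1)] ex[OF uv(2)] by blast
      have gM: "g \<in> M" "h \<in> M" using g h by (auto simp: rel_def)
      have "rel (\<lambda>w. u w + v w) (g \<circ> h)"
        using g h gM O[of g] O[of h] tree_subgroupD(3)[OF M gM]
        by (auto simp: rel_def portrait_comp agree_def add.commute)
      then have "K (\<lambda>w. u w + v w) = \<chi> (g \<circ> h)" by (rule K)
      then show ?thesis using K[OF g] K[OF h] level_homD(1)[OF hom gM] by simp
    qed
    show "K (\<lambda>w. v (h w)) = K v" if hv: "h \<in> M" "v \<in> ker_portraits M n" for h v
    proof -
      obtain g where g: "rel v g" using ex[OF hv(2)] by blast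
      have gM: "g \<in> M" using g by (simp add: rel_def)
      have "rel (\<lambda>w. v (h w)) (tree_inv h \<circ> (g \<circ> h))"
        using g that O[of g] O[of h] portrait_conj[of g h n] agree_conj[of g h n]
          tree_subgroupD(3)[OF M tree_subgroupD(4)[OF M that(1)] tree_subgroupD(3)[OF M gM that(1)]]
        by (auto simp: rel_def)
      then have "K (\<lambda>w. v (h w)) = \<chi> (tree_inv h \<circ> (g \<circ> h))" by (rule K)
      also have "\<dots> = \<chi> g"
        using level_homD(1)[OF hom tree_subgroupD(4)[OF M that(1)] tree_subgroupD(3)[OF M gM that(1)]]
          level_homD(1)[OF hom gM that(1)] level_hom_inv[OF hom M that(1)]
        by (simp add: add.commute)
      finally show ?thesis using K[OF g] by simp
    qed
    show "K u = K v" if uv: "u \<in> ker_portraits M n" "\<And>w. length w = n \<Longrightarrow> u w = v w" for u v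
    proof -
      obtain g where g: "rel u g" using ex[OF uv(1)] by blast
      then have "rel v g" using that(2) by (simp add: rel_def)
      then show ?thesis using K[OF g] K[of v g] by simp
    qed
  qed
qed

lemma additive_functional:
  fixes K :: "(word \<Rightarrow> bit) \<Rightarrow> bit"
  assumes add: "\<And>u v. K (\<lambda>w. u w + v w) = K u + K v"
    and loc: "\<And>u v. (\<And>w. length w = n \<Longrightarrow> u w = v w) \<Longrightarrow> K u = K v"
  shows "K u = (\<Sum>w\<in>words n. u w * K (delta w))"
proof -
  have "K (\<lambda>w. if w \<in> A then u w else 0) = (\<Sum>w\<in>A. u w * K (delta w))" if "finite A" for A
    using that
  proof (induction A)
    case empty
    have "K (\<lambda>_. 0) = K (\<lambda>_. 0) + K (\<lambda>_. 0)" using add[of "\<lambda>_. 0" "\<lambda>_. 0"] by simp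
    then show ?case by (cases "K (\<lambda>_. 0)") auto
  next
    case (insert a A)
    have zero: "K (\<lambda>_. 0) = 0" using add[of "\<lambda>_. 0" "\<lambda>_. 0"] by (cases "K (\<lambda>_. 0)") auto
    have "(\<lambda>w. if w \<in> insert a A then u w else 0)
        = (\<lambda>w. (if u a = 0 then 0 else delta a w) + (if w \<in> A then u w else 0))"
      using insert.hyps by (auto simp: fun_eq_iff delta_def)
    then have "K (\<lambda>w. if w \<in> insert a A then u w else 0)
        = K (\<lambda>w. if u a = 0 then 0 else delta a w) + K (\<lambda>w. if w \<in> A then u w else 0)"
      using add by presburger
    also have "K (\<lambda>w. if u a = 0 then 0 else delta a w) = u a * K (delta a)"
      using zero by (cases "u a") auto
    finally show ?case using insert by simp
  qed
  from this[OF finite_words[of n]] show ?thesis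
    using loc[of u "\<lambda>w. if w \<in> words n then u w else 0"] by simp
qed

section \<open>Automorphisms prescribed along a path\<close>

lemma strict_suffix_Cons: "strict_suffix v (s # w) \<longleftrightarrow> v = w \<or> strict_suffix v w"
  unfolding strict_suffix_def suffix_Cons by (auto dest: suffix_length_le)

lemma act_cong: "(\<And>v. strict_suffix v w \<Longrightarrow> p v = q v) \<Longrightarrow> act p w = act q w"
proof (induction w)
  case (Cons s w)
  have "act p w = act q w"
    using Cons.prems by (intro Cons.IH) (auto simp: strict_suffix_Cons)
  moreover have "p w = q w" using Cons.prems[of w] by (simp add: strict_suffix_Cons)
  ultimately show ?case by simp
qed simp

text \<open>Correcting one letter at a time needs flips only on the path from the root to
  \<open>w\<close>. The support condition leaves the remaining vertices free for later
  corrections.\<close>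

lemma ex_act_eq:
  "length w = length w' \<Longrightarrow> \<exists>p. act p w = w' \<and> (\<forall>v. \<not> strict_suffix v w \<longrightarrow> p v = 0)"
proof (induction w arbitrary: w')
  case Nil then show ?case by (intro exI[of _ "\<lambda>_. 0"]) auto
next
  case (Cons s w)
  then obtain t v where w': "w' = t # v" "length w = length v" by (cases w') auto
  obtain p where p: "act p w = v" "\<And>v. \<not> strict_suffix v w \<Longrightarrow> p v = 0" using Cons.IH w' by blast
  define q where "q = p(w := if s = t then 0 else 1)"
  have "act q w = v" using act_cong[of w q p] p(1) by (auto simp: q_def strict_suffix_def)
  moreover have "flipb (q w) s = t" using letter_neq_iff[of t s] by (auto simp: q_def)
  moreover have "q u = 0" if "\<not> strict_suffix u (s # w)" for u
  proof -
    have "u \<noteq> w" "\<not> strict_suffix u w"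
      using that by (auto simp: strict_suffix_Cons)
    then show ?thesis using p(2) by (simp add: q_def)
  qed
  ultimately show ?case using w' by (intro exI[of _ q]) auto
qed

section \<open>The group cut out by one relation between level parities\<close>

lemma bit_add_eq_iff: "(a :: bit) + b = c \<longleftrightarrow> a = c + b"
  by (cases a; cases b; cases c) auto

definition chi :: "nat set \<Rightarrow> (word \<Rightarrow> word) \<Rightarrow> bit" where
  "chi A \<sigma> = (\<Sum>i\<in>A. psum (words i) \<sigma>)"

text \<open>The choice of \<open>Lx\<close> is immaterial on \<open>rel_group A\<close> if
  \<open>0 \<notin> A\<close>: both halves of each level add up to the whole level.\<close>

definition psi :: "nat set \<Rightarrow> (word \<Rightarrow> word) \<Rightarrow> bit" where
  "psi A \<sigma> = (\<Sum>i\<in>A. psum (branch i Lx) \<sigma>)"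

definition rel_group :: "nat set \<Rightarrow> (word \<Rightarrow> word) set" where
  "rel_group A = {\<sigma> \<in> Omega. chi A \<sigma> = 0}"

lemma psum_words_comp:
  assumes "\<sigma> \<in> Omega" "\<tau> \<in> Omega"
  shows "psum (words n) (\<sigma> \<circ> \<tau>) = psum (words n) \<sigma> + psum (words n) \<tau>"
  using assms by (simp add: psum_comp Omega_image_words add.commute)

lemma chi_comp: "\<sigma> \<in> Omega \<Longrightarrow> \<tau> \<in> Omega \<Longrightarrow> chi A (\<sigma> \<circ> \<tau>) = chi A \<sigma> + chi A \<tau>"
  by (simp add: chi_def psum_words_comp sum.distrib)

lemma psum_id [simp]: "psum S id = 0"
  by (simp add: psum_def)

lemma psum_act: "psum S (act p) = (\<Sum>w\<in>S. p w)"
  by (simp add: psum_def)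

lemma chi_inv:
  assumes "\<sigma> \<in> Omega" shows "chi A (tree_inv \<sigma>) = chi A \<sigma>"
proof -
  have "tree_inv \<sigma> \<circ> \<sigma> = id" using assms by (auto simp: fun_eq_iff)
  then have "chi A (tree_inv \<sigma>) + chi A \<sigma> = chi A id"
    using chi_comp[OF Omega_inv[OF assms] assms, of A] by simp
  also have "\<dots> = 0" by (simp add: chi_def)
  finally show ?thesis by (simp add: bit_add_eq_0_iff)
qed

lemma tree_subgroup_rel_group: "tree_subgroup (rel_group A)"
  unfolding tree_subgroup_def rel_group_def
  by (auto simp: chi_comp Omega_comp Omega_inv chi_inv) (simp add: chi_def)

lemma sum_bit_sym_diff:
  fixes h :: "'b \<Rightarrow> bit"
  assumes "finite A" "finite B"
  shows "(\<Sum>i\<in>sym_diff A B. h i) = (\<Sum>i\<in>A. h i) + (\<Sum>i\<in>B. h i)"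
proof -
  have "(\<Sum>i\<in>A. h i) = (\<Sum>i\<in>A - B. h i) + (\<Sum>i\<in>A \<inter> B. h i)"
    using assms by (subst sum.union_disjoint[symmetric]) (auto intro: sum.cong simp: Un_Diff_Int)
  moreover have "(\<Sum>i\<in>B. h i) = (\<Sum>i\<in>B - A. h i) + (\<Sum>i\<in>A \<inter> B. h i)"
    using assms by (subst sum.union_disjoint[symmetric]) (auto intro!: sum.cong)
  moreover have "(\<Sum>i\<in>sym_diff A B. h i) = (\<Sum>i\<in>A - B. h i) + (\<Sum>i\<in>B - A. h i)"
    using assms by (intro sum.union_disjoint) auto
  ultimately show ?thesis by (simp add: add_ac)
qed

lemma chi_sym_diff: "finite A \<Longrightarrow> finite B \<Longrightarrow> chi (sym_diff A B) \<sigma> = chi A \<sigma> + chi B \<sigma>"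
  unfolding chi_def by (rule sum_bit_sym_diff)

lemma psum_eq_0_of_agree:
  assumes "\<sigma> \<in> Omega" "agree n \<sigma> id" "\<And>w. w \<in> S \<Longrightarrow> length w < n"
  shows "psum S \<sigma> = 0"
  unfolding psum_def using agree_portrait_less[OF assms(1) Omega_id assms(2)] assms(3)
  by (intro sum.neutral) auto

lemma level_hom_kernel:
  assumes "level_hom M n \<chi>" "id \<in> M" "\<kappa> \<in> M" "agree n \<kappa> id" shows "\<chi> \<kappa> = 0"
  using level_homD(2)[OF assms(1,3,2,4)] level_hom_id[OF assms(1,2)] by simp

lemma psum_words_delta: "psum (words i) (act (delta u)) = (if length u = i then 1 else 0)"
  by (simp add: psum_act)

text \<open>Flips along the path to \<open>w\<close> suffice, and the root is not among them because
  \<open>w\<close> and \<open>w'\<close> lie in the same half. The path to \<open>u\<close> meets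
  that path only in the root, so \<open>u\<close> stays in place.\<close>

lemma ex_Omega_move_fix:
  assumes "length w = length w'" "w \<noteq> []" "last w = last w'" "last u \<noteq> last w"
  shows "\<exists>h\<in>Omega. h w = w' \<and> h u = u"
proof -
  obtain p where p: "act p w = w'" "\<And>v. \<not> strict_suffix v w \<Longrightarrow> p v = 0" using ex_act_eq[OF assms(1)] by blast
  have "last w' = flipb (p []) (last w)" using Omega_last[OF act_in_Omega[of p] assms(2)] p(1) by simp
  then have "p [] = 0" using assms flipb_eq_self_iff[of "p []" "last w"] by simp
  moreover have "p v = 0" if "strict_suffix v u" "v \<noteq> []" for v
  proof (rule p(2))
    have "last v = last u" using that by (auto simp: strict_suffix_def suffix_def)
    then show "\<not> strict_suffix v w" using that assms(4) by (auto simp: strict_suffix_def suffix_def)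
  qed
  ultimately have "act p u = act (\<lambda>_. 0) u" by (intro act_cong) metis
  then show ?thesis using p(1) by (intro bexI[of _ "act p"]) auto
qed

text \<open>For \<open>A = {0}\<close> the group fixes both vertices of level one and has many more
  characters; it is treated separately. Excluding it gives \<open>N \<ge> 1\<close>, so that level
  \<open>N\<close> has two halves.\<close>

locale relation_set =
  fixes A :: "nat set"
  assumes fin: "finite A" and ne: "A \<noteq> {}" and not0: "A \<noteq> {0}"
begin

definition N :: nat where "N = Max A"

abbreviation M :: "(word \<Rightarrow> word) set" where "M \<equiv> rel_group A"

lemma N_in: "N \<in> A" unfolding N_def using fin ne by simp

lemma le_N: "i \<in> A \<Longrightarrow> i \<le> N" unfolding N_def using fin by simp

lemma N_pos: "N \<ge> 1"
proof (rule ccontr)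
  assume "\<not> N \<ge> 1"
  then have "A \<subseteq> {0}" using le_N by fastforce
  then show False using ne not0 by blast
qed

lemma M_sub_Omega: "M \<subseteq> Omega" and M_Omega: "\<sigma> \<in> M \<Longrightarrow> \<sigma> \<in> Omega"
  by (auto simp: rel_group_def)

lemmas M_group = tree_subgroup_rel_group[of A]
lemmas M_D = tree_subgroupD[OF M_group]

text \<open>Level \<open>N\<close> enters the relation once, so changing one bit there corrects
  \<open>chi A\<close>. The word \<open>u\<close> is left free so that the correction can be put out
  of the way.\<close>

lemma M_adjust:
  assumes "length u = N"
  shows "act (\<lambda>w. p w + chi A (act p) * delta u w) \<in> M"
proof -
  have "psum (words i) (act (\<lambda>w. p w + c * delta u w)) = psum (words i) (act p) + (if i = N then c else 0)" for i c
    using assms by (simp add: psum_act sum.distrib flip: sum_distrib_left)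
  then have "chi A (act (\<lambda>w. p w + c * delta u w)) = chi A (act p) + c" for c
    using fin N_in by (simp add: chi_def sum.distrib)
  then show ?thesis by (simp add: rel_group_def)
qed

lemma agree_chi_N:
  assumes "\<kappa> \<in> Omega" "agree N \<kappa> id"
  shows "chi A \<kappa> = psum (words N) \<kappa>" "psi A \<kappa> = psum (branch N Lx) \<kappa>"
proof -
  have z: "psum (words i) \<kappa> = 0" "psum (branch i Lx) \<kappa> = 0" if "i \<in> A - {N}" for i
    using that le_N[of i] assms by (auto intro!: psum_eq_0_of_agree[of _ N] simp: branch_def)
  show "chi A \<kappa> = psum (words N) \<kappa>"
    unfolding chi_def using z fin N_in by (subst sum.remove[of _ N]) auto
  show "psi A \<kappa> = psum (branch N Lx) \<kappa>"
    unfolding psi_def using z fin N_in by (subst sum.remove[of _ N]) auto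
qed

lemma chi_act_above:
  assumes "\<And>w. length w \<le> N \<Longrightarrow> p w = 0" shows "chi A (act p) = 0"
  unfolding chi_def psum_act using assms le_N by (intro sum.neutral ballI) auto

text \<open>For \<open>n < N\<close> the correction takes place on a later level and is invisible;
  for \<open>n > N\<close> no level of the relation is touched and no correction occurs.\<close>

lemma ker_portraits_full:
  assumes "n \<noteq> N" shows "v \<in> ker_portraits M n"
proof -
  define p where "p w = (if length w = n then v w else 0)" for w
  define u where "u = replicate N Lx"
  define q where "q = (\<lambda>w. p w + chi A (act p) * delta u w)"
  have "act q \<in> M" using M_adjust[of u p] by (simp add: q_def u_def)
  moreover have "agree n (act q) id"
    unfolding agree_act_id_iff
  proof (intro allI impI)
    fix w :: word assume w: "length w < n"
    show "q w = 0"
    proof (cases "n < N")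
      case True then show ?thesis using w by (auto simp: q_def p_def u_def delta_def)
    next
      case False
      then have "chi A (act p) = 0" using assms by (intro chi_act_above) (auto simp: p_def)
      then show ?thesis using w by (simp add: q_def p_def)
    qed
  qed
  moreover have "portrait (act q) w = v w" if "length w = n" for w
    using that assms by (auto simp: q_def p_def u_def delta_def)
  ultimately show ?thesis unfolding ker_portraits_def by blast
qed

lemma ker_portraits_N: "v \<in> ker_portraits M N \<longleftrightarrow> (\<Sum>w\<in>words N. v w) = 0"
proof
  assume "v \<in> ker_portraits M N"
  then obtain g where g: "g \<in> M" "agree N g id" "\<And>w. length w = N \<Longrightarrow> portrait g w = v w"
    unfolding ker_portraits_def by blast
  have "(\<Sum>w\<in>words N. v w) = psum (words N) g" using g(3) by (simp add: psum_def)
  also have "\<dots> = 0" using agree_chi_N(1)[OF M_Omega[OF g(1)] g(2)] g(1) by (simp add: rel_group_def)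
  finally show "(\<Sum>w\<in>words N. v w) = 0" .
next
  assume v: "(\<Sum>w\<in>words N. v w) = 0"
  define p where "p w = (if length w = N then v w else 0)" for w
  have a: "agree N (act p) id" by (simp add: agree_act_id_iff p_def)
  have "psum (words N) (act p) = 0" using v by (simp add: psum_act p_def)
  then have "act p \<in> M" using agree_chi_N(1)[OF _ a] by (simp add: rel_group_def)
  then show "v \<in> ker_portraits M N" unfolding ker_portraits_def using a by (auto simp: p_def)
qed

lemma M_approx: assumes "\<sigma> \<in> Omega" shows "\<exists>\<tau>\<in>M. agree N \<sigma> \<tau>"
proof -
  define u where "u = replicate N Lx"
  have "act (\<lambda>w. portrait \<sigma> w + chi A (act (portrait \<sigma>)) * delta u w) \<in> M"
    by (rule M_adjust) (simp add: u_def)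
  moreover have "agree N (act (portrait \<sigma>)) (act (\<lambda>w. portrait \<sigma> w + chi A (act (portrait \<sigma>)) * delta u w))"
    unfolding agree_act_iff by (auto simp: u_def delta_def)
  ultimately show ?thesis using Omega_act[OF assms] by metis
qed

lemma M_flips: "\<exists>g\<in>M. agree (length w) g id \<and> portrait g w = 1"
proof (cases "length w = N")
  case False
  then have "delta w \<in> ker_portraits M (length w)" by (rule ker_portraits_full)
  then show ?thesis unfolding ker_portraits_def by auto
next
  case True
  obtain w' where w': "length w' = N" "w' \<noteq> w" using ex_other_word[OF True N_pos] by blast
  have "(\<lambda>v. delta w v + delta w' v) \<in> ker_portraits M N"
    unfolding ker_portraits_N using True w' by (simp add: sum.distrib)
  then show ?thesis unfolding ker_portraits_def using True w' by (auto simp: delta_neq)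
qed

lemma M_transitive:
  assumes "length w = length w'" shows "\<exists>h\<in>M. h w = w'"
proof (cases "w = []")
  case True then show ?thesis using assms M_D(2) by (intro bexI[of _ id]) auto
next
  case False
  obtain p where p: "act p w = w'" "\<And>v. \<not> strict_suffix v w \<Longrightarrow> p v = 0" using ex_act_eq[OF assms] by blast
  \<comment> \<open>The correction is placed in the half of level \<open>N\<close> that does not
    contain the path to \<open>w\<close>.\<close>
  define u where "u = replicate N (flip (last w))"
  define q where "q = (\<lambda>v. p v + chi A (act p) * delta u v)"
  have "u \<noteq> []" "last u = flip (last w)" using N_pos by (auto simp: u_def)
  then have "\<not> strict_suffix u w" by (auto simp: strict_suffix_def suffix_def)
  then have "act q w = act p w" by (intro act_cong) (auto simp: q_def delta_def)
  moreover have "act q \<in> M" using M_adjust[of u p] by (simp add: q_def u_def)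
  ultimately show ?thesis using p(1) by blast
qed

text \<open>Levels strictly between the root and \<open>N\<close> contribute nothing to
  \<open>chi A g\<close>, and the root contributes \<open>1\<close>; hence \<open>g\<close> is odd
  on level \<open>N\<close>. As \<open>g\<close> exchanges the halves, the parity of
  \<open>g \<circ> g\<close> on one half is the parity of \<open>g\<close> on the whole
  level.\<close>

lemma root_flip_square:
  assumes "0 \<in> A" "g \<in> M" "agree N g (act (delta []))"
  shows "agree N (g \<circ> g) id" "psum (branch N Lx) (g \<circ> g) = 1"
proof -
  have gO: "g \<in> Omega" using assms M_Omega by blast
  have "act (delta []) \<circ> act (delta []) = id"
  proof -
    have "act (delta []) w = [] \<longleftrightarrow> w = []" for w by (cases w) auto
    then have "(\<lambda>w. delta [] w + delta [] (act (delta []) w)) = (\<lambda>_. 0)"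
      by (auto simp: delta_def fun_eq_iff)
    then show ?thesis unfolding act_comp by simp
  qed
  then show "agree N (g \<circ> g) id" using agree_comp[OF assms(3,3) gO] by simp
  have p: "portrait g w = delta [] w" if "length w < N" for w
    using agree_portrait_less[OF gO act_in_Omega assms(3) that] by simp
  have "psum (words i) g = 0" if "i \<in> A - {N} - {0}" for i
    unfolding psum_def using that le_N[of i] p by (intro sum.neutral) (auto simp: delta_neq)
  moreover have "psum (words 0) g = 1" using p[of "[]"] N_pos by (simp add: psum_def words_0)
  ultimately have "chi A g = psum (words N) g + 1"
    unfolding chi_def using fin N_in assms(1) N_pos
    by (subst sum.remove[of _ N]; simp; subst sum.remove[of _ 0]) auto
  then have N1: "psum (words N) g = 1" using assms(2) by (auto simp: rel_group_def bit_add_eq_0_iff)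
  have "g ` branch N Lx = branch N Ly"
    using Omega_image_branch[OF gO, of N Lx] p[of "[]"] N_pos by simp
  then have "psum (branch N Lx) (g \<circ> g) = psum (words N) g"
    using psum_words_branches[OF N_pos, of g Lx] by (simp add: psum_comp gO)
  then show "psum (branch N Lx) (g \<circ> g) = 1" using N1 by simp
qed

lemma ex_root_flip: "\<exists>g\<in>M. agree N g (act (delta []))"
  using M_approx[OF act_in_Omega[of "delta []"]] agree_sym by blast

section \<open>All characters of finite level of the relation group\<close>

lemma psi_comp:
  assumes "0 \<notin> A" "\<sigma> \<in> M" "\<tau> \<in> M"
  shows "psi A (\<sigma> \<circ> \<tau>) = psi A \<sigma> + psi A \<tau>"
proof -
  have O: "\<sigma> \<in> Omega" "\<tau> \<in> Omega" using assms M_Omega by auto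
  have "psi A (\<sigma> \<circ> \<tau>) = psi A \<tau> + (\<Sum>i\<in>A. psum (branch i (flipb (portrait \<tau> []) Lx)) \<sigma>)"
    by (simp add: psi_def psum_comp O Omega_image_branch sum.distrib)
  also have "(\<Sum>i\<in>A. psum (branch i (flipb (portrait \<tau> []) Lx)) \<sigma>) = psi A \<sigma>"
  proof (cases "portrait \<tau> [] = 0")
    case False
    have "(\<Sum>i\<in>A. psum (branch i Ly) \<sigma>) + psi A \<sigma> = chi A \<sigma>"
      unfolding psi_def chi_def sum.distrib[symmetric]
    proof (rule sum.cong)
      fix i assume "i \<in> A"
      then have "i \<ge> 1" using assms(1) by (cases i) auto
      then show "psum (branch i Ly) \<sigma> + psum (branch i Lx) \<sigma> = psum (words i) \<sigma>"
        using psum_words_branches[of i \<sigma> Ly] by simp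
    qed simp
    also have "\<dots> = 0" using assms(2) by (simp add: rel_group_def)
    finally show ?thesis using False by (simp add: bit_add_eq_0_iff)
  qed (simp add: psi_def)
  finally show ?thesis unfolding add.commute[of "psi A \<tau>"] .
qed

text \<open>The kernel contains all functions on the level, and \<open>M\<close> is transitive
  there, so an invariant functional takes the same value at every indicator.\<close>

lemma kernel_character_full:
  assumes hom: "level_hom M (Suc n) \<chi>" and n: "n \<noteq> N"
  shows "\<exists>c. \<forall>\<kappa>\<in>M. agree n \<kappa> id \<longrightarrow> \<chi> \<kappa> = c * psum (words n) \<kappa>"
proof -
  obtain K where K: "\<And>g. g \<in> M \<Longrightarrow> agree n g id \<Longrightarrow> \<chi> g = K (portrait g)"
    "\<And>u v. u \<in> ker_portraits M n \<Longrightarrow> v \<in> ker_portraits M n \<Longrightarrow> K (\<lambda>w. u w + v w) = K u + K v"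
    "\<And>h v. h \<in> M \<Longrightarrow> v \<in> ker_portraits M n \<Longrightarrow> K (\<lambda>w. v (h w)) = K v"
    "\<And>u v. u \<in> ker_portraits M n \<Longrightarrow> (\<And>w. length w = n \<Longrightarrow> u w = v w) \<Longrightarrow> K u = K v"
    using kernel_functional[OF M_group hom] by blast
  note full = ker_portraits_full[OF n]
  have lin: "K u = (\<Sum>w\<in>words n. u w * K (delta w))" for u
    by (rule additive_functional[where K = K, OF K(2)[OF full full] K(4)[OF full]])
  define c where "c = K (delta (replicate n Lx))"
  have c: "K (delta w) = c" if w: "length w = n" for w
  proof -
    obtain h where h: "h \<in> M" "h w = replicate n Lx" using M_transitive[of w "replicate n Lx"] w by auto
    have "delta (replicate n Lx) (h v) = delta w v" for v
      using Omega_inj[OF M_Omega[OF h(1)], of v w] h(2) by (simp add: delta_def)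
    then show ?thesis using K(3)[OF h(1) full, of "delta (replicate n Lx)"] by (simp add: c_def)
  qed
  have "\<chi> \<kappa> = c * psum (words n) \<kappa>" if "\<kappa> \<in> M" "agree n \<kappa> id" for \<kappa>
    using K(1)[OF that] lin[of "portrait \<kappa>"] c by (simp add: psum_def sum_distrib_left mult.commute)
  then show ?thesis by blast
qed

text \<open>The kernel consists of even functions, spanned by pairs of points. Moving one end inside
  its half shows that all pairs with ends in opposite halves have one value \<open>c\<close>; a pair
  inside one half is a sum of two such pairs and has value \<open>0\<close>. So the functional is
  \<open>c\<close> times the sum over one half.\<close>

lemma kernel_character_N:
  assumes hom: "level_hom M (Suc N) \<chi>"
  shows "\<exists>c. \<forall>\<kappa>\<in>M. agree N \<kappa> id \<longrightarrow> \<chi> \<kappa> = c * psum (branch N Lx) \<kappa>"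
proof -
  obtain K where K: "\<And>g. g \<in> M \<Longrightarrow> agree N g id \<Longrightarrow> \<chi> g = K (portrait g)"
    "\<And>u v. u \<in> ker_portraits M N \<Longrightarrow> v \<in> ker_portraits M N \<Longrightarrow> K (\<lambda>w. u w + v w) = K u + K v"
    "\<And>h v. h \<in> M \<Longrightarrow> v \<in> ker_portraits M N \<Longrightarrow> K (\<lambda>w. v (h w)) = K v"
    "\<And>u v. u \<in> ker_portraits M N \<Longrightarrow> (\<And>w. length w = N \<Longrightarrow> u w = v w) \<Longrightarrow> K u = K v"
    using kernel_functional[OF M_group hom] by blast
  define pair where "pair w w' = (\<lambda>v. delta w v + delta w' v)" for w w'
  have pair: "pair w w' \<in> ker_portraits M N" if "length w = N" "length w' = N" for w w'
    unfolding ker_portraits_N pair_def using that by (simp add: sum.distrib)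
  have pair_comm: "pair w w' = pair w' w" for w w' by (simp add: pair_def add.commute)
  have move: "K (pair w u) = K (pair w' u)"
    if l: "length w = N" "length w' = N" "length u = N" "last w = last w'" "last u \<noteq> last w" for w w' u
  proof -
    have "w \<noteq> []" using l N_pos by auto
    then obtain h0 where h0: "h0 \<in> Omega" "h0 w = w'" "h0 u = u"
      using ex_Omega_move_fix[of w w' u] l by auto
    obtain h where h: "h \<in> M" "agree N h0 h" using M_approx[OF h0(1)] by blast
    have hw: "h w = w'" "h u = u" using h0 h(2) l by (auto simp: agree_def)
    have "pair w' u (h v) = pair w u v" for v
      using Omega_inj[OF M_Omega[OF h(1)], of v w] Omega_inj[OF M_Omega[OF h(1)], of v u] hw
      by (simp add: pair_def delta_def)
    then show ?thesis using K(3)[OF h(1) pair[OF l(2,3)]] by simp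
  qed
  define ux uy where "ux = replicate N Lx" and "uy = replicate N Ly"
  have lu: "length ux = N" "length uy = N" "last ux = Lx" "last uy = Ly" using N_pos by (auto simp: ux_def uy_def)
  define c where "c = K (pair ux uy)"
  have cx: "K (pair w uy) = c" if "w \<in> branch N Lx" for w
    using that lu move[of w ux uy] by (auto simp: c_def branch_def)
  have cy: "K (pair w uy) = 0" if "w \<in> branch N Ly" for w
  proof -
    have w: "length w = N" "last w = Ly" using that by (auto simp: branch_def)
    have "pair w uy = (\<lambda>v. pair w ux v + pair ux uy v)" by (auto simp: pair_def fun_eq_iff add_ac)
    then have "K (pair w uy) = K (pair w ux) + K (pair ux uy)"
      using K(2)[OF pair[OF w(1) lu(1)] pair[OF lu(1,2)]] by simp
    also have "K (pair w ux) = K (pair ux uy)" using move[of w uy ux] w lu pair_comm[of ux uy] by simp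
    finally show ?thesis by simp
  qed
  \<comment> \<open>A projection onto the even functions, correcting at \<open>uy\<close>; it lets
    the functional be expanded in coordinates of the whole level.\<close>
  define E where "E v = (\<lambda>w. v w + (\<Sum>w\<in>words N. v w) * delta uy w)" for v :: "word \<Rightarrow> bit"
  have E: "E v \<in> ker_portraits M N" for v
    unfolding ker_portraits_N E_def using lu by (simp add: sum.distrib flip: sum_distrib_left)
  have lin: "K (E u) = (\<Sum>w\<in>words N. u w * K (E (delta w)))" for u
  proof (rule additive_functional[where K = "\<lambda>v. K (E v)"])
    fix u v :: "word \<Rightarrow> bit"
    have "E (\<lambda>w. u w + v w) = (\<lambda>w. E u w + E v w)"
      by (auto simp: E_def fun_eq_iff sum.distrib algebra_simps)
    then show "K (E (\<lambda>w. u w + v w)) = K (E u) + K (E v)" using K(2)[OF E E] by simp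
  next
    fix u v :: "word \<Rightarrow> bit" assume uv: "\<And>w. length w = N \<Longrightarrow> u w = v w"
    then have "(\<Sum>w\<in>words N. u w) = (\<Sum>w\<in>words N. v w)" by (intro sum.cong) auto
    then show "K (E u) = K (E v)" using uv by (intro K(4) E) (simp add: E_def)
  qed
  have Ed: "E (delta w) = pair w uy" if "length w = N" for w
    using that by (auto simp: E_def pair_def)
  have "\<chi> \<kappa> = c * psum (branch N Lx) \<kappa>" if k: "\<kappa> \<in> M" "agree N \<kappa> id" for \<kappa>
  proof -
    have "portrait \<kappa> \<in> ker_portraits M N" using k unfolding ker_portraits_def by blast
    then have "(\<Sum>w\<in>words N. portrait \<kappa> w) = 0" by (simp add: ker_portraits_N)
    then have "E (portrait \<kappa>) = portrait \<kappa>" by (auto simp: E_def)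
    then have "\<chi> \<kappa> = (\<Sum>w\<in>words N. portrait \<kappa> w * K (E (delta w)))"
      using K(1)[OF k] lin[of "portrait \<kappa>"] by simp
    also have "\<dots> = (\<Sum>w\<in>branch N Lx. portrait \<kappa> w * K (E (delta w))) + (\<Sum>w\<in>branch N Ly. portrait \<kappa> w * K (E (delta w)))"
      using sum_words_branches[OF N_pos, of _ Lx] by simp
    also have "(\<Sum>w\<in>branch N Lx. portrait \<kappa> w * K (E (delta w))) = c * psum (branch N Lx) \<kappa>"
      unfolding psum_def sum_distrib_left using cx Ed by (intro sum.cong) (auto simp: branch_def mult.commute)
    also have "(\<Sum>w\<in>branch N Ly. portrait \<kappa> w * K (E (delta w))) = 0"
      using cy Ed by (intro sum.neutral) (auto simp: branch_def)
    finally show ?thesis by simp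
  qed
  then show ?thesis by blast
qed

text \<open>The kernel on the top level determines a multiple of \<open>psum (words n)\<close>, or
  of \<open>psi A\<close> if \<open>n = N\<close>. Subtracting it leaves a character of level
  \<open>n\<close>. Since \<open>psi A\<close> reads bits on level \<open>N\<close>, it can occur
  only for \<open>N < n\<close>.\<close>

lemma characters:
  assumes "level_hom M n \<chi>"
  shows "\<exists>B b. finite B \<and> B \<subseteq> {..<n} \<and> (b = 1 \<longrightarrow> 0 \<notin> A \<and> N < n) \<and> (\<forall>\<sigma>\<in>M. \<chi> \<sigma> = chi B \<sigma> + b * psi A \<sigma>)"
  using assms
proof (induction n arbitrary: \<chi>)
  case 0
  have "\<chi> \<sigma> = 0" if "\<sigma> \<in> M" for \<sigma>
    by (rule level_hom_kernel[OF 0 M_D(2) that]) (simp add: M_Omega[OF that])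
  then show ?case by (intro exI[of _ "{}"] exI[of _ 0]) (simp add: chi_def)
next
  case (Suc n)
  note hom = level_homD(1)[OF Suc.prems]
  show ?case
  proof (cases "n = N")
    case False
    obtain c where c: "\<And>\<kappa>. \<kappa> \<in> M \<Longrightarrow> agree n \<kappa> id \<Longrightarrow> \<chi> \<kappa> = c * psum (words n) \<kappa>"
      using kernel_character_full[OF Suc.prems False] by blast
    have "level_hom M n (\<lambda>\<sigma>. \<chi> \<sigma> + c * psum (words n) \<sigma>)"
    proof (rule level_homI[OF M_group])
      fix \<sigma> \<tau> assume st: "\<sigma> \<in> M" "\<tau> \<in> M"
      show "\<chi> (\<sigma> \<circ> \<tau>) + c * psum (words n) (\<sigma> \<circ> \<tau>) = \<chi> \<sigma> + c * psum (words n) \<sigma> + (\<chi> \<tau> + c * psum (words n) \<tau>)"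
        unfolding hom[OF st] psum_words_comp[OF M_Omega[OF st(1)] M_Omega[OF st(2)]] by (simp add: algebra_simps)
    next
      fix \<kappa> assume "\<kappa> \<in> M" "agree n \<kappa> id"
      then show "\<chi> \<kappa> + c * psum (words n) \<kappa> = 0" using c[of \<kappa>] by simp
    qed
    from Suc.IH[OF this] obtain B b where B: "finite B" "B \<subseteq> {..<n}" "b = 1 \<longrightarrow> 0 \<notin> A \<and> N < n"
      "\<And>\<sigma>. \<sigma> \<in> M \<Longrightarrow> \<chi> \<sigma> + c * psum (words n) \<sigma> = chi B \<sigma> + b * psi A \<sigma>" by blast
    define B' where "B' = (if c = 1 then insert n B else B)"
    have "n \<notin> B" using B(2) by auto
    then have "chi B' \<sigma> = chi B \<sigma> + c * psum (words n) \<sigma>" for \<sigma>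
      using B(1) by (auto simp: B'_def chi_def add.commute)
    then have "\<chi> \<sigma> = chi B' \<sigma> + b * psi A \<sigma>" if "\<sigma> \<in> M" for \<sigma>
      using B(4)[OF that] unfolding bit_add_eq_iff by (simp add: add_ac)
    moreover have "finite B'" "B' \<subseteq> {..<Suc n}" using B by (auto simp: B'_def)
    moreover have "b = 1 \<longrightarrow> 0 \<notin> A \<and> N < Suc n" using B(3) by auto
    ultimately show ?thesis by blast
  next
    case True
    obtain c where c: "\<And>\<kappa>. \<kappa> \<in> M \<Longrightarrow> agree N \<kappa> id \<Longrightarrow> \<chi> \<kappa> = c * psum (branch N Lx) \<kappa>"
      using kernel_character_N[of \<chi>] Suc.prems True by blast
    \<comment> \<open>A character vanishes on squares, but the square of a lift of the root flip has
      odd half sum.\<close>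
    have c0: "c = 0" if "0 \<in> A"
    proof -
      obtain g where g: "g \<in> M" "agree N g (act (delta []))" using ex_root_flip by blast
      have "\<chi> (g \<circ> g) = 0" unfolding hom[OF g(1,1)] by simp
      then show ?thesis using c[OF M_D(3)[OF g(1,1)]] root_flip_square[OF that g] by simp
    qed
    have "level_hom M n (\<lambda>\<sigma>. \<chi> \<sigma> + c * psi A \<sigma>)"
    proof (rule level_homI[OF M_group])
      fix \<sigma> \<tau> assume st: "\<sigma> \<in> M" "\<tau> \<in> M"
      have "c * psi A (\<sigma> \<circ> \<tau>) = c * (psi A \<sigma> + psi A \<tau>)"
        using c0 psi_comp[OF _ st] by (cases "0 \<in> A") auto
      then show "\<chi> (\<sigma> \<circ> \<tau>) + c * psi A (\<sigma> \<circ> \<tau>) = \<chi> \<sigma> + c * psi A \<sigma> + (\<chi> \<tau> + c * psi A \<tau>)"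
        unfolding hom[OF st] by (simp add: algebra_simps)
    next
      fix \<kappa> assume k: "\<kappa> \<in> M" "agree n \<kappa> id"
      then show "\<chi> \<kappa> + c * psi A \<kappa> = 0"
        using c[OF k(1)] agree_chi_N(2)[OF M_Omega[OF k(1)]] True by simp
    qed
    from Suc.IH[OF this] obtain B b where B: "finite B" "B \<subseteq> {..<n}" "b = 1 \<longrightarrow> 0 \<notin> A \<and> N < n"
      "\<And>\<sigma>. \<sigma> \<in> M \<Longrightarrow> \<chi> \<sigma> + c * psi A \<sigma> = chi B \<sigma> + b * psi A \<sigma>" by blast
    \<comment> \<open>Here \<open>n = N\<close>, so the induction hypothesis cannot involve
      \<open>psi A\<close>.\<close>
    have "b = 0" using B(3) True by (cases "b = 1") auto
    then have "\<chi> \<sigma> = chi B \<sigma> + c * psi A \<sigma>" if "\<sigma> \<in> M" for \<sigma>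
      using B(4)[OF that] unfolding bit_add_eq_iff by simp
    moreover have "c = 1 \<longrightarrow> 0 \<notin> A \<and> N < Suc n" using c0 True by auto
    moreover have "B \<subseteq> {..<Suc n}" using B(2) by auto
    ultimately show ?thesis using B(1) by blast
  qed
qed

text \<open>If the kernel of \<open>G\<close> on level \<open>n\<close> were too small, the parity
  of that level (for \<open>n = N\<close>, that of one half) would be a character of
  \<open>G\<close> of level \<open>n\<close>. Extending it to \<open>M\<close> and expanding it by
  \<open>characters\<close> yields a relation on \<open>G\<close> which \<open>indep\<close> or
  \<open>psi_indep\<close> forbids.\<close>

theorem rel_group_approx:
  assumes G: "tree_subgroup G" and GM: "G \<subseteq> M"
    and indep: "\<And>B. finite B \<Longrightarrow> B \<noteq> {} \<Longrightarrow> B \<noteq> A \<Longrightarrow> \<exists>g\<in>G. chi B g = 1"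
    and psi_indep: "\<And>B. 0 \<notin> A \<Longrightarrow> finite B \<Longrightarrow> \<exists>g\<in>G. psi A g \<noteq> chi B g"
  shows "same_level n G M"
proof (induction n)
  case 0
  show ?case unfolding same_level_def
    using tree_subgroupD(2)[OF G] M_Omega by (intro ballI bexI[of _ id]) auto
next
  case (Suc n)
  note GO = tree_subgroupD(1)[OF G]
  have W: "invariant_space M (ker_portraits G n)"
    unfolding invariant_space_def
    using ker_portraits_add[OF G] ker_portraits_invariant[OF G Suc M_sub_Omega] by blast
  show ?case
  proof (cases "n = N")
    case False
    have "\<exists>g\<in>G. agree n g id \<and> psum (words n) g = 1"
    proof (rule ccontr)
      assume "\<not> (\<exists>g\<in>G. agree n g id \<and> psum (words n) g = 1)"
      then have "level_hom G n (psum (words n))"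
        by (intro level_homI[OF G]) (auto simp: psum_words_comp GO)
      then obtain \<chi> where \<chi>: "level_hom M n \<chi>" "\<And>g. g \<in> G \<Longrightarrow> \<chi> g = psum (words n) g"
        using level_hom_extend[OF G M_group GM Suc] by blast
      obtain B b where B: "finite B" "B \<subseteq> {..<n}" "b = 1 \<longrightarrow> 0 \<notin> A \<and> N < n"
        "\<And>\<sigma>. \<sigma> \<in> M \<Longrightarrow> \<chi> \<sigma> = chi B \<sigma> + b * psi A \<sigma>" using characters[OF \<chi>(1)] by blast
      have eq: "chi (insert n B) g = b * psi A g" if "g \<in> G" for g
      proof -
        have "g \<in> M" using that GM by blast
        then have "psum (words n) g = chi B g + b * psi A g" using B(4) \<chi>(2)[OF that] by simp
        moreover have "chi (insert n B) g = psum (words n) g + chi B g"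
          unfolding chi_def using B(1,2) by (subst sum.insert) auto
        ultimately show ?thesis by (simp add: add_ac)
      qed
      show False
      proof (cases "b = 1")
        case True
        then show False using psi_indep[of "insert n B"] B(1,3) eq by auto
      next
        case b: False
        \<comment> \<open>Equality would put \<open>n\<close> into \<open>A\<close> below its
          maximum \<open>N\<close>, yet \<open>N\<close> would have to lie in \<open>B\<close>,
          whose elements are less than \<open>n\<close>.\<close>
        have "insert n B \<noteq> A"
        proof
          assume *: "insert n B = A"
          then have "n \<in> A" by blast
          then have "n < N" using le_N[of n] False by simp
          then show False using N_in * B(2) by auto
        qed
        then obtain g where "g \<in> G" "chi (insert n B) g = 1" using indep[of "insert n B"] B(1) by auto
        then show False using eq b by auto
      qed
    qed
    then obtain g where g: "g \<in> G" "agree n g id" "psum (words n) g = 1" by blast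
    have "portrait g \<in> ker_portraits G n" using g unfolding ker_portraits_def by blast
    then have cov: "\<exists>v\<in>ker_portraits G n. \<forall>w. length w = n \<longrightarrow> v w = t w" for t
      using g(3) M_flips by (intro full_cover[OF M_sub_Omega _ W]) (auto simp: psum_def fixes_level_def)
    show ?thesis
    proof (rule same_level_Suc[OF G M_group GM Suc])
      fix \<kappa> assume "\<kappa> \<in> M" "agree n \<kappa> id"
      obtain v where "v \<in> ker_portraits G n" "\<And>w. length w = n \<Longrightarrow> v w = portrait \<kappa> w" using cov by blast
      then show "portrait \<kappa> \<in> ker_portraits G n" unfolding ker_portraits_def by simp
    qed
  next
    case n: True
    have "\<exists>g\<in>G. agree N g id \<and> psum (branch N Lx) g = 1"
    proof (rule ccontr)
      assume "\<not> (\<exists>g\<in>G. agree N g id \<and> psum (branch N Lx) g = 1)"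
      then have no: "\<And>g. g \<in> G \<Longrightarrow> agree N g id \<Longrightarrow> psum (branch N Lx) g = 0" by auto
      show False
      proof (cases "0 \<in> A")
        case True
        \<comment> \<open>Here \<open>psi A\<close> is no character; instead the square of an
          element of \<open>G\<close> lifting the root flip is odd on one half.\<close>
        obtain h where h: "h \<in> M" "agree N h (act (delta []))" using ex_root_flip by blast
        obtain g where g: "g \<in> G" "agree N h g" using Suc h(1) n unfolding same_level_def by blast
        have "agree N g (act (delta []))" using agree_trans[OF agree_sym[OF g(2)] h(2)] .
        then show False
          using root_flip_square[OF True, of g] g(1) GM no[OF tree_subgroupD(3)[OF G g(1,1)]] by auto
      next
        case False
        have "level_hom G n (psi A)"
        proof (rule level_homI[OF G])
          show "psi A (\<sigma> \<circ> \<tau>) = psi A \<sigma> + psi A \<tau>" if "\<sigma> \<in> G" "\<tau> \<in> G" for \<sigma> \<tau>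
            using psi_comp[OF False] that GM by blast
          show "psi A \<kappa> = 0" if "\<kappa> \<in> G" "agree n \<kappa> id" for \<kappa>
            using no[of \<kappa>] agree_chi_N(2)[of \<kappa>] that n GO by simp
        qed
        then obtain \<chi> where \<chi>: "level_hom M n \<chi>" "\<And>g. g \<in> G \<Longrightarrow> \<chi> g = psi A g"
          using level_hom_extend[OF G M_group GM Suc] by blast
        obtain B b where B: "finite B" "B \<subseteq> {..<n}" "b = 1 \<longrightarrow> 0 \<notin> A \<and> N < n"
          "\<And>\<sigma>. \<sigma> \<in> M \<Longrightarrow> \<chi> \<sigma> = chi B \<sigma> + b * psi A \<sigma>" using characters[OF \<chi>(1)] by blast
        have "b = 0" using B(3) n by (cases "b = 1") auto
        moreover obtain g where "g \<in> G" "psi A g \<noteq> chi B g" using psi_indep[OF False B(1)] by blast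
        ultimately show False using B(4)[of g] \<chi>(2)[of g] GM by auto
      qed
    qed
    then obtain g where g: "g \<in> G" "agree N g id" "psum (branch N Lx) g = 1" by blast
    \<comment> \<open>Being even on the level and odd on one half, \<open>g\<close> is odd on both
      halves, as \<open>even_cover\<close> requires.\<close>
    have "psum (words N) g = 0" using agree_chi_N(1)[of g] g GM GO by (auto simp: rel_group_def)
    then have g': "psum (branch N Ly) g = 1"
      using g(3) psum_words_branches[OF N_pos, of g Lx] by (auto simp: bit_add_eq_0_iff)
    have flips: "\<exists>h\<in>M. fixes_level (length w) h \<and> (\<forall>v. length v = length w \<longrightarrow> portrait h v = delta w v)"
      if "length w < N" for w
    proof -
      have "delta w \<in> ker_portraits M (length w)" using that by (intro ker_portraits_full) auto
      then show ?thesis unfolding ker_portraits_def fixes_level_def by blast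
    qed
    have gk: "portrait g \<in> ker_portraits G n" using g n unfolding ker_portraits_def by blast
    have cov: "\<exists>v\<in>ker_portraits G n. \<forall>w. length w = n \<longrightarrow> v w = t w" if "(\<Sum>w\<in>words n. t w) = 0" for t
      using g(3) g' flips that N_pos n
      by (intro even_cover[OF _ M_sub_Omega _ W gk]) (auto simp: psum_def)
    show ?thesis
    proof (rule same_level_Suc[OF G M_group GM Suc])
      fix \<kappa> assume k: "\<kappa> \<in> M" "agree n \<kappa> id"
      then have "portrait \<kappa> \<in> ker_portraits M N" using n unfolding ker_portraits_def by blast
      then have "(\<Sum>w\<in>words n. portrait \<kappa> w) = 0" using n by (simp add: ker_portraits_N)
      then obtain v where "v \<in> ker_portraits G n" "\<And>w. length w = n \<Longrightarrow> v w = portrait \<kappa> w" using cov by blast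
      then show "portrait \<kappa> \<in> ker_portraits G n" unfolding ker_portraits_def by simp
    qed
  qed
qed

text \<open>A level of \<open>B\<close> outside \<open>A\<close> is detected by a single flip, which
  satisfies the relation. If \<open>B\<close> is a proper subset of \<open>A\<close>, the flip is
  balanced by another one on a level of \<open>A\<close> outside \<open>B\<close>.\<close>

lemma rel_group_independent:
  assumes "finite B" "B \<noteq> {}" "B \<noteq> A" shows "\<exists>\<sigma>\<in>M. chi B \<sigma> = 1"
proof -
  have single: "chi C (act (delta (replicate i Lx))) = (if i \<in> C then 1 else 0)" if "finite C" for C i
    unfolding chi_def using that by (simp add: psum_words_delta)
  show ?thesis
  proof (cases "B \<subseteq> A")
    case False
    then obtain i where "i \<in> B" "i \<notin> A" by blast
    then show ?thesis using single[OF assms(1), of i] single[OF fin, of i]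
      by (intro bexI[of _ "act (delta (replicate i Lx))"]) (auto simp: rel_group_def)
  next
    case True
    then obtain i j where ij: "i \<in> B" "j \<in> A" "j \<notin> B" using assms by blast
    define \<sigma> where "\<sigma> = act (delta (replicate i Lx)) \<circ> act (delta (replicate j Lx))"
    have "\<sigma> \<in> Omega" by (simp add: \<sigma>_def Omega_comp)
    moreover have "chi C \<sigma> = (if i \<in> C then 1 else 0) + (if j \<in> C then 1 else 0)" if "finite C" for C
      by (simp add: \<sigma>_def chi_comp single[OF that])
    ultimately show ?thesis using ij True fin assms(1) by (intro bexI[of _ \<sigma>]) (auto simp: rel_group_def)
  qed
qed

text \<open>Two flips on level \<open>N\<close>, one in each half: all full parities vanish, while
  \<open>psi\<close> sees one of them.\<close>

lemma rel_group_psi_independent: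
  assumes "0 \<notin> A" "finite B" shows "\<exists>\<sigma>\<in>M. psi A \<sigma> \<noteq> chi B \<sigma>"
proof -
  define ux uy where "ux = replicate N Lx" and "uy = replicate N Ly"
  have u: "length ux = N" "length uy = N" "ux \<noteq> uy" "ux \<in> branch N Lx" "uy \<notin> branch N Lx"
    using N_pos by (auto simp: ux_def uy_def branch_def)
  define \<sigma> where "\<sigma> = act (\<lambda>w. delta ux w + delta uy w)"
  have z: "chi C \<sigma> = 0" if "finite C" for C
    unfolding chi_def \<sigma>_def psum_act using u by (intro sum.neutral) (auto simp: sum.distrib)
  have "agree N \<sigma> id" unfolding \<sigma>_def agree_act_id_iff using u by (auto simp: delta_def)
  then have "psi A \<sigma> = psum (branch N Lx) \<sigma>" by (intro agree_chi_N) (auto simp: \<sigma>_def)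
  also have "\<dots> = 1" unfolding \<sigma>_def psum_act using u by (simp add: sum.distrib)
  finally show ?thesis using z[OF fin] z[OF assms(2)] by (intro bexI[of _ \<sigma>]) (auto simp: rel_group_def \<sigma>_def)
qed

end

section \<open>The stabiliser of the two vertices of level one\<close>

abbreviation split_group :: "(word \<Rightarrow> word) set" where "split_group \<equiv> rel_group {0}"

lemma split_group_iff: "\<sigma> \<in> split_group \<longleftrightarrow> \<sigma> \<in> Omega \<and> portrait \<sigma> [] = 0"
  by (simp add: rel_group_def chi_def psum_def words_0)

lemmas split_group_group = tree_subgroup_rel_group[of "{0}"]
lemmas split_group_D = tree_subgroupD[OF split_group_group]

text \<open>On \<open>split_group\<close> both halves of each level are stable, so each of these
  parities is a character.\<close>

definition branch_chi :: "(nat \<times> letter) set \<Rightarrow> (word \<Rightarrow> word) \<Rightarrow> bit" where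
  "branch_chi B \<sigma> = (\<Sum>(i, s)\<in>B. psum (branch i s) \<sigma>)"

lemma psum_branch_comp:
  assumes "\<sigma> \<in> split_group" "\<tau> \<in> split_group"
  shows "psum (branch n s) (\<sigma> \<circ> \<tau>) = psum (branch n s) \<sigma> + psum (branch n s) \<tau>"
  using assms by (simp add: split_group_iff psum_comp Omega_image_branch add.commute)

lemma split_ker_portraits_full:
  assumes "n \<ge> 1" shows "v \<in> ker_portraits split_group n"
proof -
  define p where "p = (\<lambda>w :: word. if length w = n then v w else 0)"
  have "act p \<in> split_group" using assms by (simp add: split_group_iff p_def)
  moreover have "agree n (act p) id" by (simp add: agree_act_id_iff p_def)
  ultimately show ?thesis unfolding ker_portraits_def by (auto simp: p_def)
qed

lemma split_transitive:
  assumes "length w = length w'" "w \<noteq> []" "last w = last w'"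
  shows "\<exists>h\<in>split_group. h w = w'"
proof -
  obtain h where h: "h \<in> Omega" "h w = w'"
    using ex_Omega_move_fix[OF assms, of "[flip (last w)]"] by auto
  have "flipb (portrait h []) (last w) = last w" using Omega_last[OF h(1) assms(2)] h(2) assms(3) by simp
  then show ?thesis using h by (auto simp: split_group_iff)
qed

lemma finite_letters [simp]: "finite (C :: letter set)"
  by (rule finite_subset[OF subset_UNIV]) (simp add: UNIV_letter)

text \<open>The orbits on level \<open>n\<close> are the two halves, so an invariant functional has
  one value on each; \<open>C\<close> collects the halves where it is \<open>1\<close>.\<close>

lemma split_kernel_character:
  assumes hom: "level_hom split_group (Suc n) \<chi>" and n: "n \<ge> 1"
  shows "\<exists>C. \<forall>\<kappa>\<in>split_group. agree n \<kappa> id \<longrightarrow> \<chi> \<kappa> = (\<Sum>s\<in>C. psum (branch n s) \<kappa>)"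
proof -
  obtain K where K: "\<And>g. g \<in> split_group \<Longrightarrow> agree n g id \<Longrightarrow> \<chi> g = K (portrait g)"
    "\<And>u v. u \<in> ker_portraits split_group n \<Longrightarrow> v \<in> ker_portraits split_group n \<Longrightarrow> K (\<lambda>w. u w + v w) = K u + K v"
    "\<And>h v. h \<in> split_group \<Longrightarrow> v \<in> ker_portraits split_group n \<Longrightarrow> K (\<lambda>w. v (h w)) = K v"
    "\<And>u v. u \<in> ker_portraits split_group n \<Longrightarrow> (\<And>w. length w = n \<Longrightarrow> u w = v w) \<Longrightarrow> K u = K v"
    using kernel_functional[OF split_group_group hom] by blast
  note full = split_ker_portraits_full[OF n]
  have lin: "K u = (\<Sum>w\<in>words n. u w * K (delta w))" for u
    by (rule additive_functional[where K = K, OF K(2)[OF full full] K(4)[OF full]])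
  define c where "c s = K (delta (replicate n s))" for s
  have c: "K (delta w) = c s" if w: "w \<in> branch n s" for w s
  proof -
    obtain h where h: "h \<in> split_group" "h w = replicate n s"
      using split_transitive[of w "replicate n s"] w n by (auto simp: branch_def)
    have "delta (replicate n s) (h v) = delta w v" for v
      using Omega_inj[OF split_group_D(1)[OF h(1)], of v w] h(2) by (simp add: delta_def)
    then show ?thesis using K(3)[OF h(1) full, of "delta (replicate n s)"] by (simp add: c_def)
  qed
  have "\<chi> \<kappa> = (\<Sum>s\<in>{s. c s = 1}. psum (branch n s) \<kappa>)" if k: "\<kappa> \<in> split_group" "agree n \<kappa> id" for \<kappa>
  proof -
    have br: "(\<Sum>w\<in>branch n s. portrait \<kappa> w * K (delta w)) = (if c s = 1 then psum (branch n s) \<kappa> else 0)" for s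
      unfolding psum_def using c by (cases "c s = 1") (auto intro!: sum.cong sum.neutral)
    have "\<chi> \<kappa> = (\<Sum>w\<in>words n. portrait \<kappa> w * K (delta w))"
      using K(1)[OF k] lin[of "portrait \<kappa>"] by simp
    also have "\<dots> = (\<Sum>w\<in>branch n Lx. portrait \<kappa> w * K (delta w)) + (\<Sum>w\<in>branch n Ly. portrait \<kappa> w * K (delta w))"
      using sum_words_branches[OF n, of _ Lx] by simp
    also have "\<dots> = (\<Sum>s\<in>UNIV. if c s = 1 then psum (branch n s) \<kappa> else 0)"
      unfolding br by (simp add: UNIV_letter)
    also have "\<dots> = (\<Sum>s\<in>{s. c s = 1}. psum (branch n s) \<kappa>)"
      by (intro sum.mono_neutral_cong_right) auto
    finally show ?thesis .
  qed
  then show ?thesis by (intro exI[of _ "{s. c s = 1}"]) blast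
qed


lemma branch_chi_Un:
  assumes "finite B" "\<And>s. (n, s) \<notin> B"
  shows "branch_chi (B \<union> {n} \<times> C) \<sigma> = branch_chi B \<sigma> + (\<Sum>s\<in>C. psum (branch n s) \<sigma>)"
proof -
  have "branch_chi (B \<union> {n} \<times> C) \<sigma> = branch_chi B \<sigma> + (\<Sum>(i, s)\<in>{n} \<times> C. psum (branch i s) \<sigma>)"
    unfolding branch_chi_def using assms by (intro sum.union_disjoint) auto
  also have "(\<Sum>(i, s)\<in>{n} \<times> C. psum (branch i s) \<sigma>) = (\<Sum>s\<in>C. psum (branch n s) \<sigma>)"
    unfolding sum.cartesian_product[symmetric] by simp
  finally show ?thesis .
qed

lemma split_agree_1: "\<sigma> \<in> split_group \<Longrightarrow> agree (Suc 0) \<sigma> id"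
  by (simp add: split_group_iff agree_Suc_iff)

text \<open>Same descent as in \<open>characters\<close>. The indices start at \<open>1\<close>
  because the whole group acts trivially on level one.\<close>

lemma split_characters:
  assumes "level_hom split_group n \<chi>"
  shows "\<exists>B. finite B \<and> B \<subseteq> {1..<n} \<times> UNIV \<and> (\<forall>\<sigma>\<in>split_group. \<chi> \<sigma> = branch_chi B \<sigma>)"
  using assms
proof (induction n arbitrary: \<chi>)
  case 0
  have "\<chi> \<sigma> = 0" if "\<sigma> \<in> split_group" for \<sigma>
    by (rule level_hom_kernel[OF 0 split_group_D(2) that]) (simp add: split_group_D(1)[OF that])
  then show ?case by (intro exI[of _ "{}"]) (simp add: branch_chi_def)
next
  case (Suc n)
  note hom = level_homD(1)[OF Suc.prems]
  show ?case
  proof (cases "n = 0")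
    case True
    have "\<chi> \<sigma> = 0" if "\<sigma> \<in> split_group" for \<sigma>
      using level_hom_kernel[OF Suc.prems split_group_D(2) that] split_agree_1[OF that] True by simp
    then show ?thesis by (intro exI[of _ "{}"]) (simp add: branch_chi_def)
  next
    case False
    then have n: "n \<ge> 1" by simp
    obtain C where C: "\<And>\<kappa>. \<kappa> \<in> split_group \<Longrightarrow> agree n \<kappa> id \<Longrightarrow> \<chi> \<kappa> = (\<Sum>s\<in>C. psum (branch n s) \<kappa>)"
      using split_kernel_character[OF Suc.prems n] by blast
    have "level_hom split_group n (\<lambda>\<sigma>. \<chi> \<sigma> + (\<Sum>s\<in>C. psum (branch n s) \<sigma>))"
    proof (rule level_homI[OF split_group_group])
      fix \<sigma> \<tau> assume st: "\<sigma> \<in> split_group" "\<tau> \<in> split_group"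
      show "\<chi> (\<sigma> \<circ> \<tau>) + (\<Sum>s\<in>C. psum (branch n s) (\<sigma> \<circ> \<tau>))
        = \<chi> \<sigma> + (\<Sum>s\<in>C. psum (branch n s) \<sigma>) + (\<chi> \<tau> + (\<Sum>s\<in>C. psum (branch n s) \<tau>))"
        unfolding hom[OF st] psum_branch_comp[OF st] sum.distrib by (simp add: add_ac)
    next
      fix \<kappa> assume "\<kappa> \<in> split_group" "agree n \<kappa> id"
      then show "\<chi> \<kappa> + (\<Sum>s\<in>C. psum (branch n s) \<kappa>) = 0" using C[of \<kappa>] by simp
    qed
    from Suc.IH[OF this] obtain B where B: "finite B" "B \<subseteq> {1..<n} \<times> UNIV"
      "\<And>\<sigma>. \<sigma> \<in> split_group \<Longrightarrow> \<chi> \<sigma> + (\<Sum>s\<in>C. psum (branch n s) \<sigma>) = branch_chi B \<sigma>" by blast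
    have "(n, s) \<notin> B" for s using B(2) by auto
    then have "\<chi> \<sigma> = branch_chi (B \<union> {n} \<times> C) \<sigma>" if "\<sigma> \<in> split_group" for \<sigma>
      using B(3)[OF that] branch_chi_Un[OF B(1)] unfolding bit_add_eq_iff by simp
    moreover have "finite (B \<union> {n} \<times> C)" "B \<union> {n} \<times> C \<subseteq> {1..<Suc n} \<times> UNIV" using B(1,2) n by auto
    ultimately show ?thesis by blast
  qed
qed

text \<open>Here the obstruction to a full kernel is a combination of the two half sums. If one
  vanished on the kernel of \<open>G\<close>, it would be a character of lower level, giving a
  relation excluded by \<open>indep\<close>.\<close>

theorem split_group_approx:
  assumes G: "tree_subgroup G" and GM: "G \<subseteq> split_group"
    and indep: "\<And>B. finite B \<Longrightarrow> B \<noteq> {} \<Longrightarrow> B \<subseteq> {1..} \<times> UNIV \<Longrightarrow> \<exists>g\<in>G. branch_chi B g = 1"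
  shows "same_level n G split_group"
proof (induction n)
  case 0
  show ?case unfolding same_level_def
    using tree_subgroupD(2)[OF G] split_group_D(1) by (intro ballI bexI[of _ id]) auto
next
  case (Suc n)
  have sub: "split_group \<subseteq> Omega" using split_group_D(1) by blast
  show ?case
  proof (cases "n = 0")
    case True
    show ?thesis unfolding same_level_def True
      using tree_subgroupD(2)[OF G] split_agree_1 by (intro ballI bexI[of _ id]) auto
  next
    case False
    then have n: "n \<ge> 1" by simp
    have W: "invariant_space split_group (ker_portraits G n)"
      unfolding invariant_space_def
      using ker_portraits_add[OF G] ker_portraits_invariant[OF G Suc sub] by blast
    have ex: "\<exists>u\<in>ker_portraits G n. (\<Sum>s\<in>C. \<Sum>w\<in>branch n s. u w) = 1" if C: "C \<noteq> {}" for C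
    proof (rule ccontr)
      assume no: "\<not> (\<exists>u\<in>ker_portraits G n. (\<Sum>s\<in>C. \<Sum>w\<in>branch n s. u w) = 1)"
      have "level_hom G n (\<lambda>g. \<Sum>s\<in>C. psum (branch n s) g)"
      proof (rule level_homI[OF G])
        fix \<sigma> \<tau> assume "\<sigma> \<in> G" "\<tau> \<in> G"
        then have "\<sigma> \<in> split_group" "\<tau> \<in> split_group" using GM by auto
        note st = psum_branch_comp[OF this]
        show "(\<Sum>s\<in>C. psum (branch n s) (\<sigma> \<circ> \<tau>)) = (\<Sum>s\<in>C. psum (branch n s) \<sigma>) + (\<Sum>s\<in>C. psum (branch n s) \<tau>)"
          unfolding st sum.distrib ..
      next
        fix \<kappa> assume "\<kappa> \<in> G" "agree n \<kappa> id"
        then have "portrait \<kappa> \<in> ker_portraits G n" unfolding ker_portraits_def by blast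
        then show "(\<Sum>s\<in>C. psum (branch n s) \<kappa>) = 0" using no by (auto simp: psum_def)
      qed
      from level_hom_extend[OF G split_group_group GM Suc this]
      obtain \<chi> where \<chi>: "level_hom split_group n \<chi>" "\<And>g. g \<in> G \<Longrightarrow> \<chi> g = (\<Sum>s\<in>C. psum (branch n s) g)" by blast
      from split_characters[OF \<chi>(1)] obtain B where B: "finite B" "B \<subseteq> {1..<n} \<times> UNIV"
        "\<And>\<sigma>. \<sigma> \<in> split_group \<Longrightarrow> \<chi> \<sigma> = branch_chi B \<sigma>" by blast
      have nB: "(n, s) \<notin> B" for s using B(2) by auto
      have "B \<union> {n} \<times> C \<subseteq> {1..} \<times> UNIV" using B(2) n by auto
      then obtain g where g: "g \<in> G" "branch_chi (B \<union> {n} \<times> C) g = 1"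
        using indep[of "B \<union> {n} \<times> C"] B(1) C by auto
      have "branch_chi B g = (\<Sum>s\<in>C. psum (branch n s) g)" using B(3)[of g] \<chi>(2)[OF g(1)] g(1) GM by auto
      then show False using g(2) branch_chi_Un[OF B(1) nB, of C g] by simp
    qed
    \<comment> \<open>The half sums map the kernel to the plane over the field of two elements, and
      no nonzero functional vanishes on the image, which is therefore everything; the cases exhibit
      \<open>(1, 0)\<close>.\<close>
    have pm: "\<exists>u\<in>ker_portraits G n. (\<Sum>w\<in>branch n s. u w) = 1 \<and> (\<Sum>w\<in>branch n (flip s). u w) = 0" for s
    proof -
      obtain u where u: "u \<in> ker_portraits G n" "(\<Sum>w\<in>branch n s. u w) = 1" using ex[of "{s}"] by auto
      obtain v where v: "v \<in> ker_portraits G n" "(\<Sum>w\<in>branch n s. v w) + (\<Sum>w\<in>branch n (flip s). v w) = 1"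
        using ex[of "{s, flip s}"] by auto
      let ?f = "\<lambda>u. \<Sum>w\<in>branch n s. u w :: bit" and ?h = "\<lambda>u. \<Sum>w\<in>branch n (flip s). u w :: bit"
      have uv: "(\<lambda>w. u w + v w) \<in> ker_portraits G n"
        by (rule invariant_spaceD(1)[OF W u(1) v(1)])
      consider "?h u = 0" | "?h u = 1" "?f v = 1" "?h v = 0" | "?h u = 1" "?f v = 0" "?h v = 1"
        using v(2) by (cases "?h u"; cases "?f v"; cases "?h v") auto
      then show ?thesis
      proof cases
        case 1 then show ?thesis using u by blast
      next
        case 2 then show ?thesis using v by blast
      next
        case 3 then show ?thesis using u by (intro bexI[OF _ uv]) (auto simp: sum.distrib)
      qed
    qed
    have flips: "\<exists>g\<in>split_group. fixes_level (length w) g \<and> portrait g w = 1" if "1 \<le> length w" for w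
      using split_ker_portraits_full[OF that, of "delta w"] unfolding ker_portraits_def fixes_level_def by auto
    have cov: "\<exists>v\<in>ker_portraits G n. \<forall>w. length w = n \<longrightarrow> v w = t w" for t
      by (rule branch_cover[OF n sub flips W pm])
    show ?thesis
    proof (rule same_level_Suc[OF G split_group_group GM Suc])
      fix \<kappa> assume "\<kappa> \<in> split_group" "agree n \<kappa> id"
      obtain v where "v \<in> ker_portraits G n" "\<And>w. length w = n \<Longrightarrow> v w = portrait \<kappa> w" using cov by blast
      then show "portrait \<kappa> \<in> ker_portraits G n" unfolding ker_portraits_def by simp
    qed
  qed
qed

lemma split_group_independent:
  assumes "finite B" "B \<noteq> {}" "B \<subseteq> {1..} \<times> UNIV"
  shows "\<exists>\<sigma>\<in>split_group. branch_chi B \<sigma> = 1"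
proof -
  obtain i s where mem: "(i, s) \<in> B" using assms by auto
  then have i: "i \<ge> 1" using assms by auto
  define \<sigma> where "\<sigma> = act (delta (replicate i s))"
  have "\<sigma> \<in> split_group" using i by (auto simp: split_group_iff \<sigma>_def delta_def)
  moreover have "replicate i s \<in> branch j t \<longleftrightarrow> (j, t) = (i, s)" for j t
    using i by (auto simp: branch_def)
  then have "branch_chi B \<sigma> = (\<Sum>p\<in>B. if p = (i, s) then 1 else 0)"
    unfolding branch_chi_def by (intro sum.cong) (auto simp: \<sigma>_def psum_act split: if_splits)
  then have "branch_chi B \<sigma> = 1" using assms(1) mem by simp
  ultimately show ?thesis by blast
qed

section \<open>Automorphisms of the algebraic closure\<close>

abbreviation emb :: "'a::field poly \<Rightarrow> 'a alg_closure poly" where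
  "emb \<equiv> map_poly to_ac"

lemma coeff_emb [simp]: "coeff (emb p) n = to_ac (coeff p n)"
  by (simp add: coeff_map_poly)

lemma emb_pCons [simp]: "emb (pCons c p) = pCons (to_ac c) (emb p)"
  by (simp add: map_poly_pCons)

lemma emb_add: "emb (p + q) = emb p + emb q"
  by (rule poly_eqI) simp

lemma emb_diff: "emb (p - q) = emb p - emb q"
  by (rule poly_eqI) simp

lemma emb_minus: "emb (- p) = - emb p"
  by (rule poly_eqI) simp

lemma emb_mult: "emb (p * q) = emb p * emb q"
  by (rule poly_eqI) (simp add: coeff_mult to_ac_sum)

lemma emb_eq_0_iff [simp]: "emb p = 0 \<longleftrightarrow> p = 0"
  by (simp add: poly_eq_iff)

lemma degree_emb [simp]: "degree (emb p) = degree p"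
  by (rule degree_map_poly) simp

lemma emb_smult: "emb (smult c p) = smult (to_ac c) (emb p)"
  by (rule poly_eqI) simp

text \<open>A partial homomorphism over \<open>F\<close>, kept as a relation so that unions and
  extensions are inclusions. The last clause encodes single-valuedness, because differences remain
  in the graph; inverses come from algebraicity (\<open>field_graph_inverse\<close>).\<close>

definition field_graph :: "('a::field alg_closure \<times> 'a alg_closure) set \<Rightarrow> bool" where
  "field_graph T \<longleftrightarrow> (\<forall>c. (to_ac c, to_ac c) \<in> T) \<and>
     (\<forall>a b c d. (a, b) \<in> T \<longrightarrow> (c, d) \<in> T \<longrightarrow> (a + c, b + d) \<in> T \<and> (a * c, b * d) \<in> T) \<and>
     (\<forall>b. (0, b) \<in> T \<longrightarrow> b = 0)"

lemma field_graphD: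
  assumes "field_graph T"
  shows "(to_ac c, to_ac c) \<in> T" "(a, b) \<in> T \<Longrightarrow> (x, y) \<in> T \<Longrightarrow> (a + x, b + y) \<in> T"
    "(a, b) \<in> T \<Longrightarrow> (x, y) \<in> T \<Longrightarrow> (a * x, b * y) \<in> T" "(0, b) \<in> T \<Longrightarrow> b = 0"
  using assms unfolding field_graph_def by blast+

lemma field_graph_0_1:
  assumes "field_graph T" shows "(0, 0) \<in> T" "(1, 1) \<in> T" "(-1, -1) \<in> T"
  using field_graphD(1)[OF assms, of 0] field_graphD(1)[OF assms, of 1] field_graphD(1)[OF assms, of "-1"]
  by auto

lemma field_graph_diff:
  assumes "field_graph T" "(a, b) \<in> T" "(x, y) \<in> T" shows "(a - x, b - y) \<in> T"
  using field_graphD(2)[OF assms(1,2) field_graphD(3)[OF assms(1) field_graph_0_1(3)[OF assms(1)] assms(3)]]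
  by simp

lemma field_graph_unique:
  assumes "field_graph T" "(a, b) \<in> T" "(a, c) \<in> T" shows "b = c"
  using field_graphD(4)[OF assms(1), of "b - c"] field_graph_diff[OF assms] by simp

lemma field_graph_sum:
  assumes "field_graph T" "\<And>i. i \<in> I \<Longrightarrow> (u i, v i) \<in> T"
  shows "((\<Sum>i\<in>I. u i), (\<Sum>i\<in>I. v i)) \<in> T"
  using assms(2) by (induction I rule: infinite_finite_induct)
    (auto intro: field_graphD(2)[OF assms(1)] field_graph_0_1[OF assms(1)])

lemma field_graph_poly:
  assumes "field_graph T" "(a, b) \<in> T"
  shows "(poly (emb q) a, poly (emb q) b) \<in> T"
  by (induction q) (auto intro!: field_graphD(1-3)[OF assms(1)] field_graph_0_1[OF assms(1)] assms(2))

text \<open>A polynomial of least degree vanishing at \<open>a \<noteq> 0\<close> has nonzero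
  constant term, and solving for this term gives the inverse. Thus subrings over \<open>F\<close>
  are fields and graphs need no division.\<close>

lemma inverse_as_poly:
  fixes a :: "'a::field alg_closure"
  assumes "a \<noteq> 0" shows "\<exists>q. a * poly (emb q) a = 1"
proof -
  obtain p0 :: "'a poly" where p0: "p0 \<noteq> 0 \<and> poly (emb p0) a = 0" using alg_closure_algebraic by metis
  obtain p where p: "p \<noteq> 0" "poly (emb p) a = 0"
    and min: "\<And>q. q \<noteq> 0 \<Longrightarrow> poly (emb q) a = 0 \<Longrightarrow> degree p \<le> degree q"
    using ex_has_least_nat[of "\<lambda>p. p \<noteq> 0 \<and> poly (emb p) a = 0" p0 degree] p0 by blast
  obtain c r where pr: "p = pCons c r" by (cases p) auto
  have "c \<noteq> 0"
  proof
    assume c: "c = 0"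
    then have "r \<noteq> 0" "poly (emb r) a = 0" using p assms by (auto simp: pr)
    then show False using min[of r] by (simp add: pr)
  qed
  moreover have "to_ac c + a * poly (emb r) a = 0" using p(2) by (simp add: pr)
  then have "a * poly (emb r) a = - to_ac c" by (simp add: eq_neg_iff_add_eq_0 add.commute)
  ultimately have "a * poly (emb (smult (- inverse c) r)) a = 1"
    by (simp add: emb_smult emb_minus mult.left_commute[of a])
  then show ?thesis by blast
qed

lemma field_graph_inverse:
  assumes T: "field_graph T" and ab: "(a, b) \<in> T" and "a \<noteq> 0"
  shows "b \<noteq> 0" "(inverse a, inverse b) \<in> T"
proof -
  obtain q where q: "a * poly (emb q) a = 1" using inverse_as_poly[OF assms(3)] by blast
  note pq = field_graph_poly[OF T ab, of q]
  have "(1, b * poly (emb q) b) \<in> T" using field_graphD(3)[OF T ab pq] q by simp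
  then have b: "b * poly (emb q) b = 1" using field_graph_unique[OF T _ field_graph_0_1(2)[OF T]] by blast
  then show "b \<noteq> 0" by auto
  show "(inverse a, inverse b) \<in> T" using pq inverse_unique[OF q] inverse_unique[OF b] by simp
qed

definition poly_graph :: "('b::comm_ring_1 \<times> 'b) set \<Rightarrow> 'b poly \<Rightarrow> 'b poly \<Rightarrow> bool" where
  "poly_graph T q r \<longleftrightarrow> (\<forall>i. (coeff q i, coeff r i) \<in> T)"

lemma poly_graph_add: "field_graph T \<Longrightarrow> poly_graph T q r \<Longrightarrow> poly_graph T q' r' \<Longrightarrow> poly_graph T (q + q') (r + r')"
  unfolding poly_graph_def by (auto intro: field_graphD(2))

lemma poly_graph_diff: "field_graph T \<Longrightarrow> poly_graph T q r \<Longrightarrow> poly_graph T q' r' \<Longrightarrow> poly_graph T (q - q') (r - r')"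
  unfolding poly_graph_def by (auto intro: field_graph_diff)

lemma poly_graph_mult: "field_graph T \<Longrightarrow> poly_graph T q r \<Longrightarrow> poly_graph T q' r' \<Longrightarrow> poly_graph T (q * q') (r * r')"
  unfolding poly_graph_def coeff_mult by (auto intro!: field_graph_sum field_graphD(3))

lemma poly_graph_pCons:
  "poly_graph T q r \<Longrightarrow> (a, b) \<in> T \<Longrightarrow> poly_graph T (pCons a q) (pCons b r)"
  unfolding poly_graph_def by (auto simp: coeff_pCons split: nat.split)

lemma poly_graph_0: "field_graph T \<Longrightarrow> poly_graph T 0 0"
  unfolding poly_graph_def by (simp add: field_graph_0_1)

lemma poly_graph_monom: "field_graph T \<Longrightarrow> (a, b) \<in> T \<Longrightarrow> poly_graph T (monom a n) (monom b n)"
  unfolding poly_graph_def by (auto simp: field_graph_0_1)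

lemma poly_graph_emb: "field_graph T \<Longrightarrow> poly_graph T (emb p) (emb p)"
  unfolding poly_graph_def by (auto intro: field_graphD(1))

text \<open>One step of long division, performed simultaneously on a polynomial and its image.
  Iterating it replaces division with remainder over the domain of \<open>T\<close>, which is not a
  type.\<close>

lemma poly_graph_reduce:
  assumes T: "field_graph T" and m: "poly_graph T m m'" "m \<noteq> 0"
    and q: "poly_graph T q q'" and deg: "degree m \<le> degree q"
  obtains k k' where "poly_graph T k k'" "poly_graph T (q - k * m) (q' - k' * m')"
    "coeff (q - k * m) (degree q) = 0" "degree (q - k * m) \<le> degree q"
proof -
  have lm: "(lead_coeff m, coeff m' (degree m)) \<in> T" "lead_coeff m \<noteq> 0"
    using m by (auto simp: poly_graph_def)
  define c c' where "c = lead_coeff q * inverse (lead_coeff m)"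
    and "c' = coeff q' (degree q) * inverse (coeff m' (degree m))"
  have c: "(c, c') \<in> T" unfolding c_def c'_def
    using field_graphD(3)[OF T _ field_graph_inverse(2)[OF T lm]] q by (auto simp: poly_graph_def)
  define n where "n = degree q - degree m"
  have k: "poly_graph T (monom c n) (monom c' n)" using poly_graph_monom[OF T c] .
  have "coeff (monom c n * m) (degree q) = c * lead_coeff m"
    using deg by (simp add: coeff_monom_mult n_def)
  then have "coeff (q - monom c n * m) (degree q) = 0" using lm(2) by (simp add: c_def)
  moreover have "degree (monom c n * m) \<le> degree q"
    using degree_mult_le[of "monom c n" m] degree_monom_le[of c n] deg by (simp add: n_def)
  then have "degree (q - monom c n * m) \<le> degree q" by (intro degree_diff_le) auto
  moreover have "poly_graph T (q - monom c n * m) (q' - monom c' n * m')"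
    by (intro poly_graph_diff[OF T q] poly_graph_mult[OF T k m(1)])
  ultimately show thesis using k that by blast
qed

lemma degree_less_of_coeff_0:
  assumes "degree r \<le> n" "coeff r n = 0" shows "r = 0 \<or> degree r < n"
  using assms by (metis le_neq_implies_less leading_coeff_0_iff)

text \<open>\<open>m\<close> plays the minimal polynomial of \<open>z\<close> over the domain of
  \<open>T\<close>, up to a scalar, and \<open>m'\<close> is its image.\<close>

definition graph_minimal :: "('b::comm_ring_1 \<times> 'b) set \<Rightarrow> 'b \<Rightarrow> 'b poly \<Rightarrow> 'b poly \<Rightarrow> bool" where
  "graph_minimal T z m m' \<longleftrightarrow> poly_graph T m m' \<and> m \<noteq> 0 \<and> poly m z = 0 \<and>
     (\<forall>q q'. poly_graph T q q' \<longrightarrow> q \<noteq> 0 \<longrightarrow> poly q z = 0 \<longrightarrow> degree m \<le> degree q)"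

lemma graph_minimal_ex:
  fixes z :: "'a::field alg_closure"
  assumes T: "field_graph T" shows "\<exists>m m'. graph_minimal T z m m'"
proof -
  obtain p :: "'a poly" where p: "p \<noteq> 0" "poly (emb p) z = 0" using alg_closure_algebraic by metis
  define Q where "Q = (\<lambda>(q, q'). poly_graph T q q' \<and> q \<noteq> 0 \<and> poly q z = 0)"
  have "Q (emb p, emb p)" using p poly_graph_emb[OF T] by (simp add: Q_def)
  then obtain x where "Q x" "\<And>y. Q y \<Longrightarrow> degree (fst x) \<le> degree (fst y)"
    using ex_has_least_nat[of Q "(emb p, emb p)" "\<lambda>x. degree (fst x)"] by blast
  then have "graph_minimal T z (fst x) (snd x)"
    unfolding graph_minimal_def Q_def by (auto simp: case_prod_beta)
  then show ?thesis by blast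
qed

lemma graph_minimal_divides:
  assumes T: "field_graph T" and m: "graph_minimal T z m m'"
    and q: "poly_graph T q q'" "poly q z = 0"
  shows "m dvd q \<and> m' dvd q'"
  using q
\<comment> \<open>The measure separates the zero polynomial from nonzero constants, which also have
  degree \<open>0\<close>.\<close>
proof (induction "if q = 0 then 0 else Suc (degree q)" arbitrary: q q' rule: less_induct)
  case less
  show ?case
  proof (cases "q = 0")
    case True
    have "q' = 0"
      using less.prems(1) field_graphD(4)[OF T] True by (auto simp: poly_graph_def poly_eq_iff)
    then show ?thesis using True by simp
  next
    case False
    then have "degree m \<le> degree q" using m less.prems by (auto simp: graph_minimal_def)
    moreover have "poly_graph T m m'" "m \<noteq> 0" "poly m z = 0" using m by (auto simp: graph_minimal_def)
    ultimately obtain k k' where k: "poly_graph T (q - k * m) (q' - k' * m')"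
      "coeff (q - k * m) (degree q) = 0" "degree (q - k * m) \<le> degree q"
      using poly_graph_reduce[OF T _ _ less.prems(1)] by metis
    have "m dvd q - k * m \<and> m' dvd q' - k' * m'"
    proof (rule less.hyps)
      show "(if q - k * m = 0 then 0 else Suc (degree (q - k * m))) < (if q = 0 then 0 else Suc (degree q))"
        using degree_less_of_coeff_0[OF k(3,2)] False by auto
      show "poly (q - k * m) z = 0" using less.prems(2) \<open>poly m z = 0\<close> by simp
    qed (rule k)
    then show ?thesis by (metis diff_add_cancel dvd_add dvd_triv_right)
  qed
qed

text \<open>The new map sends \<open>q(z)\<close> to \<open>q'(z')\<close>. It is well defined
  because any \<open>q\<close> vanishing at \<open>z\<close> is a multiple of \<open>m\<close>,
  whose image kills \<open>z'\<close>.\<close>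

lemma field_graph_adjoin:
  assumes T: "field_graph T" and m: "graph_minimal T z m m'" and z': "poly m' z' = 0"
  shows "\<exists>T'. field_graph T' \<and> T \<subseteq> T' \<and> (z, z') \<in> T'"
proof -
  define T' where "T' = {(poly q z, poly q' z') |q q'. poly_graph T q q'}"
  have "field_graph T'"
    unfolding field_graph_def
  proof (intro conjI allI impI)
    fix c show "(to_ac c, to_ac c) \<in> T'"
      using poly_graph_emb[OF T, of "[:c:]"] unfolding T'_def by force
  next
    fix a b c d assume "(a, b) \<in> T'" "(c, d) \<in> T'"
    then obtain q q' r r' where *: "poly_graph T q q'" "a = poly q z" "b = poly q' z'"
      "poly_graph T r r'" "c = poly r z" "d = poly r' z'" unfolding T'_def by blast
    have "(poly (q + r) z, poly (q' + r') z') \<in> T'" "(poly (q * r) z, poly (q' * r') z') \<in> T'"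
      unfolding T'_def using poly_graph_add[OF T *(1,4)] poly_graph_mult[OF T *(1,4)] by blast+
    then show "(a + c, b + d) \<in> T'" "(a * c, b * d) \<in> T'" using * by simp_all
  next
    fix b assume "(0, b) \<in> T'"
    then obtain q q' where *: "poly_graph T q q'" "poly q z = 0" "b = poly q' z'" unfolding T'_def by force
    then have "m' dvd q'" using graph_minimal_divides[OF T m] by blast
    then show "b = 0" using z' *(3) by (auto elim!: dvdE)
  qed
  moreover have "(a, b) \<in> T'" if "(a, b) \<in> T" for a b
    using poly_graph_pCons[OF poly_graph_0[OF T] that] unfolding T'_def by force
  moreover have "(z, z') \<in> T'"
    using poly_graph_emb[OF T, of "[:0, 1:]"] unfolding T'_def by force
  ultimately show ?thesis by auto
qed

lemma graph_minimal_root: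
  assumes T: "field_graph T" and m: "graph_minimal T z m m'"
  shows "\<exists>z'. poly m' z' = 0"
proof (rule alg_closed_imp_poly_has_root)
  have mm: "poly_graph T m m'" "m \<noteq> 0" "poly m z = 0" using m by (auto simp: graph_minimal_def)
  have "degree m > 0"
  proof (rule ccontr)
    assume "\<not> degree m > 0"
    then obtain c where "m = [:c:]" by (auto elim: degree_eq_zeroE)
    then show False using mm by simp
  qed
  moreover have "coeff m' (degree m) \<noteq> 0"
    using field_graph_inverse(1)[OF T, of "lead_coeff m"] mm by (auto simp: poly_graph_def)
  \<comment> \<open>The leading coefficient of \<open>m\<close> has a nonzero image, so
    \<open>m'\<close> is not constant and has a root.\<close>
  then have "degree m \<le> degree m'" by (rule le_degree)
  ultimately show "degree m' > 0" by simp
qed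

text \<open>Automorphisms of the whole algebraic closure over \<open>F\<close>. They compose and
  invert as total functions, unlike the extensional maps in \<open>abs_Galois\<close>.\<close>

definition ac_auts :: "('a::field alg_closure \<Rightarrow> 'a alg_closure) set" where
  "ac_auts = {\<tau>. bij \<tau> \<and> (\<forall>x y. \<tau> (x + y) = \<tau> x + \<tau> y \<and> \<tau> (x * y) = \<tau> x * \<tau> y) \<and> (\<forall>c. \<tau> (to_ac c) = to_ac c)}"

lemma ac_autsD:
  assumes "\<tau> \<in> ac_auts"
  shows "bij \<tau>" "\<tau> (x + y) = \<tau> x + \<tau> y" "\<tau> (x * y) = \<tau> x * \<tau> y" "\<tau> (to_ac c) = to_ac c"
  using assms by (auto simp: ac_auts_def)

lemma ac_auts_simps:
  assumes "\<tau> \<in> ac_auts"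
  shows "\<tau> 0 = 0" "\<tau> 1 = 1" "\<tau> (- x) = - \<tau> x" "\<tau> (x - y) = \<tau> x - \<tau> y" "\<tau> x = \<tau> y \<longleftrightarrow> x = y"
    "\<tau> (x ^ n) = \<tau> x ^ n" "\<tau> (sum u I) = (\<Sum>i\<in>I. \<tau> (u i))" "\<tau> (prod u I) = (\<Prod>i\<in>I. \<tau> (u i))"
proof -
  note D = ac_autsD[OF assms]
  show 0: "\<tau> 0 = 0" using D(4)[of 0] by simp
  show 1: "\<tau> 1 = 1" using D(4)[of 1] by simp
  show m: "\<tau> (- x) = - \<tau> x" for x using D(2)[of x "- x"] 0 by (simp add: eq_neg_iff_add_eq_0 add.commute)
  show "\<tau> (x - y) = \<tau> x - \<tau> y" using D(2)[of x "- y"] m by simp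
  show "\<tau> x = \<tau> y \<longleftrightarrow> x = y" using D(1) by (simp add: bij_def inj_eq)
  show "\<tau> (x ^ n) = \<tau> x ^ n" by (induction n) (simp_all add: 1 D(3))
  show "\<tau> (sum u I) = (\<Sum>i\<in>I. \<tau> (u i))" by (induction I rule: infinite_finite_induct) (simp_all add: 0 D(2))
  show "\<tau> (prod u I) = (\<Prod>i\<in>I. \<tau> (u i))" by (induction I rule: infinite_finite_induct) (simp_all add: 1 D(3))
qed

lemma ac_auts_poly:
  assumes "\<tau> \<in> ac_auts" shows "\<tau> (poly p x) = poly (map_poly \<tau> p) (\<tau> x)"
  by (induction p) (auto simp: map_poly_pCons ac_auts_simps[OF assms] ac_autsD[OF assms])

lemma map_poly_ac_auts_emb: "\<tau> \<in> ac_auts \<Longrightarrow> map_poly \<tau> (emb p) = emb p"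
  by (rule poly_eqI) (simp add: coeff_map_poly ac_auts_simps ac_autsD)

lemma ac_auts_poly_emb: "\<tau> \<in> ac_auts \<Longrightarrow> \<tau> (poly (emb p) x) = poly (emb p) (\<tau> x)"
  by (simp add: ac_auts_poly map_poly_ac_auts_emb)

lemma ac_auts_comp: "\<sigma> \<in> ac_auts \<Longrightarrow> \<tau> \<in> ac_auts \<Longrightarrow> \<sigma> \<circ> \<tau> \<in> ac_auts"
  by (auto simp: ac_auts_def intro: bij_comp)

lemma ac_auts_id: "id \<in> ac_auts"
  by (auto simp: ac_auts_def)

lemma ac_auts_inv:
  assumes "\<tau> \<in> ac_auts" shows "inv_into UNIV \<tau> \<in> ac_auts"
proof -
  note D = ac_autsD[OF assms]
  have c: "\<tau> (inv_into UNIV \<tau> x) = x" for x using D(1) by (simp add: bij_is_surj surj_f_inv_f)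
  have "inv_into UNIV \<tau> (x + y) = inv_into UNIV \<tau> x + inv_into UNIV \<tau> y"
    "inv_into UNIV \<tau> (x * y) = inv_into UNIV \<tau> x * inv_into UNIV \<tau> y"
    "inv_into UNIV \<tau> (to_ac d) = to_ac d" for x y d
    using D(1) by (auto intro!: inv_into_f_eq simp: D c bij_is_inj)
  then show ?thesis using D(1) by (auto simp: ac_auts_def bij_imp_bij_inv)
qed

text \<open>A maximal graph supplied by Zorn's lemma is total, since a root of the transported
  minimal polynomial can always be adjoined. The resulting map is injective, and surjective because
  it permutes the finite root set of each polynomial over \<open>F\<close>.\<close>

theorem field_graph_extends:
  fixes T :: "('a::field alg_closure \<times> 'a alg_closure) set"
  assumes T: "field_graph T"
  shows "\<exists>\<tau>\<in>ac_auts. \<forall>a b. (a, b) \<in> T \<longrightarrow> \<tau> a = b"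
proof -
  define S where "S = {T'. field_graph T' \<and> T \<subseteq> T'}"
  have "\<exists>U\<in>S. \<forall>V\<in>S. U \<subseteq> V \<longrightarrow> V = U"
  proof (rule subset_Zorn_nonempty)
    show "S \<noteq> {}" using T by (auto simp: S_def)
    fix C assume C: "C \<noteq> {}" "subset.chain S C"
    have CS: "V \<in> C \<Longrightarrow> field_graph V \<and> T \<subseteq> V" for V using C(2) by (auto simp: subset.chain_def S_def)
    have ub: "\<exists>Z\<in>C. V \<subseteq> Z \<and> Y \<subseteq> Z" if "V \<in> C" "Y \<in> C" for V Y
    proof -
      have "V \<subseteq> Y \<or> Y \<subseteq> V" using C(2) that unfolding subset_chain_def by blast
      then show ?thesis using that by (elim disjE) (auto intro: bexI[of _ Y] bexI[of _ V])
    qed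
    have "field_graph (\<Union>C)"
      unfolding field_graph_def
    proof (intro conjI allI impI)
      fix c show "(to_ac c, to_ac c) \<in> \<Union>C" using C(1) CS field_graphD(1) by blast
    next
      fix a b c d assume "(a, b) \<in> \<Union>C" "(c, d) \<in> \<Union>C"
      then obtain Z where Z: "Z \<in> C" "(a, b) \<in> Z" "(c, d) \<in> Z" using ub by blast
      have "field_graph Z" using CS[OF Z(1)] by blast
      then show "(a + c, b + d) \<in> \<Union>C" "(a * c, b * d) \<in> \<Union>C"
        using Z field_graphD(2,3) by blast+
    next
      fix b assume "(0, b) \<in> \<Union>C"
      then show "b = 0" using CS field_graphD(4) by blast
    qed
    then show "\<Union>C \<in> S" using C(1) CS by (auto simp: S_def)
  qed
  then obtain U where U: "field_graph U" "T \<subseteq> U"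
    and max: "\<And>V. field_graph V \<Longrightarrow> T \<subseteq> V \<Longrightarrow> U \<subseteq> V \<Longrightarrow> V = U" by (auto simp: S_def)
  have total: "\<exists>b. (a, b) \<in> U" for a
  proof -
    obtain m m' where m: "graph_minimal U a m m'" using graph_minimal_ex[OF U(1)] by blast
    obtain b where "poly m' b = 0" using graph_minimal_root[OF U(1) m] by blast
    then obtain V where V: "field_graph V" "U \<subseteq> V" "(a, b) \<in> V" using field_graph_adjoin[OF U(1) m] by blast
    then have "V = U" using max U(2) by blast
    then show ?thesis using V by blast
  qed
  define \<tau> where "\<tau> a = (SOME b. (a, b) \<in> U)" for a
  have in_U: "(a, \<tau> a) \<in> U" for a unfolding \<tau>_def using someI_ex[OF total] .
  have eq: "\<tau> a = b" if "(a, b) \<in> U" for a b using field_graph_unique[OF U(1) in_U that] .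
  have hom: "\<tau> (x + y) = \<tau> x + \<tau> y" "\<tau> (x * y) = \<tau> x * \<tau> y" "\<tau> (to_ac c) = to_ac c" for x y c
    by (intro eq field_graphD(1-3)[OF U(1)] in_U)+
  have "inj \<tau>"
  proof (rule injI)
    fix x y assume "\<tau> x = \<tau> y"
    then have "(x - y, 0) \<in> U" using field_graph_diff[OF U(1) in_U in_U, of x y] by simp
    then show "x = y" using field_graph_inverse(1)[OF U(1), of "x - y" 0] by auto
  qed
  moreover have "\<exists>x. \<tau> x = y" for y
  proof -
    obtain p :: "'a poly" where p: "p \<noteq> 0" "poly (emb p) y = 0" using alg_closure_algebraic by metis
    define R where "R = {x. poly (emb p) x = 0}"
    have "finite R" unfolding R_def using p by (intro poly_roots_finite) simp
    moreover have "\<tau> ` R \<subseteq> R"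
    proof
      fix x assume "x \<in> \<tau> ` R"
      then obtain z where z: "poly (emb p) z = 0" "x = \<tau> z" by (auto simp: R_def)
      have "(poly (emb p) z, poly (emb p) (\<tau> z)) \<in> U" using field_graph_poly[OF U(1) in_U] .
      then show "x \<in> R" using z field_graphD(4)[OF U(1)] by (auto simp: R_def)
    qed
    ultimately have "\<tau> ` R = R" using \<open>inj \<tau>\<close> by (intro endo_inj_surj) (auto simp: inj_on_def)
    moreover have "y \<in> R" using p by (simp add: R_def)
    ultimately have "y \<in> \<tau> ` R" by simp
    then show ?thesis by blast
  qed
  then have "surj \<tau>" unfolding surj_def by metis
  ultimately have "\<tau> \<in> ac_auts" using hom by (simp add: ac_auts_def bij_def)
  then show ?thesis using eq U(2) by (intro bexI[of _ \<tau>]) auto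
qed


section \<open>Separable elements\<close>

text \<open>The ring generated over \<open>F\<close>; by \<open>inverse_as_poly\<close> it is a
  field.\<close>

inductive_set adjoin :: "'a::field alg_closure set \<Rightarrow> 'a alg_closure set" for B where
  adjoin_base: "to_ac c \<in> adjoin B"
| adjoin_gen: "x \<in> B \<Longrightarrow> x \<in> adjoin B"
| adjoin_add: "x \<in> adjoin B \<Longrightarrow> y \<in> adjoin B \<Longrightarrow> x + y \<in> adjoin B"
| adjoin_mult: "x \<in> adjoin B \<Longrightarrow> y \<in> adjoin B \<Longrightarrow> x * y \<in> adjoin B"

lemma adjoin_mono: "B \<subseteq> C \<Longrightarrow> x \<in> adjoin B \<Longrightarrow> x \<in> adjoin C"
  by (rotate_tac, induction rule: adjoin.induct) (auto intro: adjoin.intros)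

lemma adjoin_empty: "(adjoin {} :: 'a::field alg_closure set) = range to_ac"
proof
  show "(adjoin {} :: 'a alg_closure set) \<subseteq> range to_ac"
  proof
    fix x :: "'a alg_closure" assume "x \<in> adjoin {}"
    then show "x \<in> range to_ac"
      by induction (auto simp flip: to_ac_add to_ac_mult)
  qed
qed (auto intro: adjoin.intros)

text \<open>The identity of a subfield is a partial homomorphism; its extensions are the
  automorphisms over that subfield.\<close>

lemma field_graph_Id_adjoin: "field_graph (Id_on (adjoin B))"
  unfolding field_graph_def by (auto intro: adjoin.intros)

lemma poly_graph_Id_iff: "poly_graph (Id_on H) q r \<longleftrightarrow> q = r \<and> (\<forall>i. coeff q i \<in> H)"
  unfolding poly_graph_def by (auto simp: poly_eq_iff Id_on_iff)

lemma adjoin_insert_poly: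
  assumes "s \<in> adjoin (insert y B)"
  shows "\<exists>q. poly q y = s \<and> poly_graph (Id_on (adjoin B)) q q"
  using assms
proof induction
  note T = field_graph_Id_adjoin[of B]
  case (adjoin_base c)
  show ?case using poly_graph_emb[OF T, of "[:c:]"] by (intro exI[of _ "emb [:c:]"]) simp
next
  note T = field_graph_Id_adjoin[of B]
  case (adjoin_gen x)
  show ?case
  proof (cases "x = y")
    case True
    show ?thesis using poly_graph_emb[OF T, of "[:0, 1:]"] True by (intro exI[of _ "emb [:0, 1:]"]) simp
  next
    case False
    then have "(x, x) \<in> Id_on (adjoin B)" using adjoin_gen by (auto intro: adjoin.intros)
    then show ?thesis using poly_graph_pCons[OF poly_graph_0[OF T]] by (intro exI[of _ "[:x:]"]) simp
  qed
next
  note T = field_graph_Id_adjoin[of B]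
  case (adjoin_add x z)
  then show ?case using poly_graph_add[OF T] poly_add by metis
next
  note T = field_graph_Id_adjoin[of B]
  case (adjoin_mult x z)
  then show ?case using poly_graph_mult[OF T] poly_mult by metis
qed

lemma ac_auts_adjoin:
  assumes "\<tau> \<in> ac_auts" "\<And>x. x \<in> B \<Longrightarrow> \<tau> x \<in> adjoin C" "x \<in> adjoin B"
  shows "\<tau> x \<in> adjoin C"
  using assms(3) by induction (auto simp: ac_autsD[OF assms(1)] intro: adjoin.intros assms(2))

section \<open>Galois descent for separable elements\<close>

lemma card_roots_rsquarefree:
  fixes p :: "'b::alg_closed_field poly"
  assumes "rsquarefree p" shows "card {x. poly p x = 0} = degree p"
  using assms
proof (induction "degree p" arbitrary: p)
  case 0
  then obtain c where "p = [:c:]" by (metis degree_eq_zeroE)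
  then show ?case using 0 by (auto simp: rsquarefree_def)
next
  case (Suc n)
  then obtain a where a: "poly p a = 0" using alg_closed_imp_poly_has_root[of p] by auto
  then obtain r where r: "p = [:- a, 1:] * r" by (auto simp: poly_eq_0_iff_dvd elim!: dvdE)
  have p0: "p \<noteq> 0" "r \<noteq> 0" using Suc.prems r by (auto simp: rsquarefree_def)
  have deg: "degree p = Suc (degree r)" unfolding r using p0 by (subst degree_mult_eq) auto
  have ord: "order x p = order x [:- a, 1:] + order x r" for x
    using p0 unfolding r by (intro order_mult) auto
  have "order a [:- a, 1:] = 1" using order_power_n_n[of a 1] by simp
  moreover have "order a p = 1" using rsquarefree_root_order[OF Suc.prems a p0(1)] .
  ultimately have "order a r = 0" using ord[of a] by simp
  then have ra: "poly r a \<noteq> 0" using p0 by (simp add: order_root)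
  have "rsquarefree r" unfolding rsquarefree_def
  proof (intro conjI allI)
    fix x
    have "order x p = 0 \<or> order x p = 1" using Suc.prems unfolding rsquarefree_def by blast
    then show "order x r = 0 \<or> order x r = 1" using ord[of x] by auto
  qed (rule p0)
  then have "card {x. poly r x = 0} = degree r" using Suc deg by simp
  moreover have "{x. poly p x = 0} = insert a {x. poly r x = 0}" unfolding r by auto
  moreover have "finite {x. poly r x = 0}" using p0 by (intro poly_roots_finite)
  ultimately show ?case using ra deg by simp
qed

lemma rsquarefree_dvd:
  assumes "rsquarefree p" "q dvd p" shows "rsquarefree q"
proof -
  have p: "p \<noteq> 0" using assms by (simp add: rsquarefree_def)
  have "order a q \<le> order a p" for a using dvd_imp_order_le[OF p assms(2)] .
  moreover have "order a p \<le> 1" for a using assms(1) unfolding rsquarefree_def by (metis le_refl zero_le)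
  ultimately have "order a q \<le> 1" for a using order_trans by blast
  then have "order a q = 0 \<or> order a q = 1" for a by (metis One_nat_def le_SucE le_zero_eq)
  then show ?thesis using p assms(2) unfolding rsquarefree_def by auto
qed

text \<open>Any squarefree annihilator is allowed instead of an irreducible one, which makes closure
  properties easier; \<open>sep_closure_iff\<close> compares the two.\<close>

definition separable_elt :: "'a::field alg_closure \<Rightarrow> bool" where
  "separable_elt y \<longleftrightarrow> (\<exists>p :: 'a poly. rsquarefree (emb p) \<and> poly (emb p) y = 0)"

text \<open>Write \<open>s = q(y)\<close> with \<open>degree q < degree m\<close>. For each of the
  \<open>degree m\<close> distinct roots \<open>z\<close> of \<open>m\<close> an automorphism over
  \<open>B\<close> moves \<open>y\<close> to \<open>z\<close>, and invariance gives
  \<open>q(z) = s\<close>. So \<open>q - s\<close> has too many roots, and \<open>s\<close> is the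
  constant coefficient of \<open>q\<close>.\<close>

lemma fixed_in_simple_extension:
  assumes y: "separable_elt y" and s: "s \<in> adjoin (insert y B)"
    and fixed: "\<And>\<tau>. \<tau> \<in> ac_auts \<Longrightarrow> (\<And>x. x \<in> B \<Longrightarrow> \<tau> x = x) \<Longrightarrow> \<tau> s = s"
  shows "s \<in> adjoin B"
proof -
  define T where "T = Id_on (adjoin B)"
  have T: "field_graph T" unfolding T_def by (rule field_graph_Id_adjoin)
  obtain m m' where m0: "graph_minimal T y m m'" using graph_minimal_ex[OF T] by blast
  then have mm: "m' = m" by (simp add: graph_minimal_def T_def poly_graph_Id_iff)
  note m = m0[unfolded mm]
  obtain p where p: "rsquarefree (emb p)" "poly (emb p) y = 0" using y by (auto simp: separable_elt_def)
  have "m dvd emb p" using graph_minimal_divides[OF T m poly_graph_emb[OF T] p(2)] by blast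
  then have card: "card {x. poly m x = 0} = degree m"
    using card_roots_rsquarefree rsquarefree_dvd[OF p(1)] by blast
  have mp: "poly_graph T m m" "m \<noteq> 0" "poly m y = 0" using m by (auto simp: graph_minimal_def)
  have dm: "degree m > 0"
  proof (rule ccontr)
    assume "\<not> degree m > 0"
    then obtain c where "m = [:c:]" by (auto elim: degree_eq_zeroE)
    then show False using mp by simp
  qed
  obtain q0 where "poly q0 y = s \<and> poly_graph T q0 q0" using adjoin_insert_poly[OF s] unfolding T_def by blast
  then obtain q where q: "poly q y = s" "poly_graph T q q"
    and min: "\<And>r. poly r y = s \<Longrightarrow> poly_graph T r r \<Longrightarrow> degree q \<le> degree r"
    using ex_has_least_nat[of "\<lambda>q. poly q y = s \<and> poly_graph T q q" q0 degree] by blast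
  have dq: "degree q < degree m"
  proof (rule ccontr)
    assume "\<not> degree q < degree m"
    then have le: "degree m \<le> degree q" by simp
    obtain k k' where k: "poly_graph T k k'" "poly_graph T (q - k * m) (q - k' * m)"
      "coeff (q - k * m) (degree q) = 0" "degree (q - k * m) \<le> degree q"
      using poly_graph_reduce[OF T mp(1,2) q(2) le] .
    have "k' = k" using k(1) by (simp add: T_def poly_graph_Id_iff)
    then have "degree q \<le> degree (q - k * m)" using k(2) q(1) mp(3) by (intro min) auto
    then show False using degree_less_of_coeff_0[OF k(4,3)] dm le by auto
  qed
  have root: "poly q z = s" if "poly m z = 0" for z
  proof -
    obtain T' where T': "field_graph T'" "T \<subseteq> T'" "(y, z) \<in> T'"
      using field_graph_adjoin[OF T m \<open>poly m z = 0\<close>] by blast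
    obtain \<tau> where t: "\<tau> \<in> ac_auts" "\<And>a b. (a, b) \<in> T' \<Longrightarrow> \<tau> a = b"
      using field_graph_extends[OF T'(1)] by blast
    have fx: "\<tau> x = x" if "x \<in> adjoin B" for x using t(2) T'(2) that by (auto simp: T_def)
    have "map_poly \<tau> q = q"
      using q(2) fx by (intro poly_eqI) (simp add: coeff_map_poly ac_auts_simps[OF t(1)] T_def poly_graph_Id_iff)
    then have "\<tau> s = poly q z" using ac_auts_poly[OF t(1), of q y] q(1) t(2)[OF T'(3)] by simp
    moreover have "\<tau> s = s" by (rule fixed[OF t(1)]) (rule fx[OF adjoin_gen])
    ultimately show ?thesis by simp
  qed
  have "q - [:s:] = 0"
  proof (rule ccontr)
    assume ne: "q - [:s:] \<noteq> 0"
    have "degree m \<le> card {z. poly (q - [:s:]) z = 0}"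
      unfolding card[symmetric] using root ne by (intro card_mono poly_roots_finite) auto
    also have "\<dots> \<le> degree (q - [:s:])" using card_poly_roots_bound[OF ne] .
    also have "\<dots> \<le> max (degree q) (degree [:s:])" by (rule degree_diff_le_max)
    finally show False using dq dm by simp
  qed
  then have "q = [:s:]" by simp
  then have "s = coeff q 0" by simp
  then show ?thesis using q(2) by (simp add: T_def poly_graph_Id_iff)
qed

lemma fixed_in_extension:
  assumes "finite S" "\<And>y. y \<in> S \<Longrightarrow> separable_elt y" "s \<in> adjoin (B \<union> S)"
    "\<And>\<tau>. \<tau> \<in> ac_auts \<Longrightarrow> (\<And>x. x \<in> B \<Longrightarrow> \<tau> x = x) \<Longrightarrow> \<tau> s = s"
  shows "s \<in> adjoin B"
  using assms
proof (induction S arbitrary: B)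
  case empty then show ?case by simp
next
  case (insert y S)
  have "s \<in> adjoin (insert y B)"
  proof (rule insert.IH)
    show "s \<in> adjoin (insert y B \<union> S)" using insert.prems(2) by simp
    show "\<tau> s = s" if "\<tau> \<in> ac_auts" "\<And>x. x \<in> insert y B \<Longrightarrow> \<tau> x = x" for \<tau>
      by (rule insert.prems(3)[OF that(1)]) (use that(2) in blast)
  qed (use insert.prems(1) in blast)
  then show ?case
    by (rule fixed_in_simple_extension[rotated]) (use insert.prems in auto)
qed

lemma separable_elt_fixed:
  assumes "separable_elt s" "\<And>\<tau>. \<tau> \<in> ac_auts \<Longrightarrow> \<tau> s = s" shows "s \<in> range to_ac"
  using fixed_in_extension[of "{s}" s "{}"] assms by (auto simp: adjoin_empty intro: adjoin.intros)

lemma adjoin_uminus: "x \<in> adjoin B \<Longrightarrow> - x \<in> adjoin B"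
  using adjoin_mult[OF adjoin_base[of "-1"], of x B] by simp

lemma poly_graph_Id_prod:
  assumes T: "field_graph T" and "\<And>i. i \<in> I \<Longrightarrow> poly_graph T (u i) (u i)"
  shows "poly_graph T (\<Prod>i\<in>I. u i) (\<Prod>i\<in>I. u i)"
  using assms(2) by (induction I rule: infinite_finite_induct)
    (use poly_graph_emb[OF T, of 1] in \<open>auto intro: poly_graph_mult[OF T]\<close>)

lemma rsquarefree_prod_linear:
  fixes I :: "'b::idom set"
  assumes "finite I" shows "rsquarefree (\<Prod>x\<in>I. [:- x, 1:])"
proof -
  have "order a (\<Prod>x\<in>I. [:- x, 1:]) = (if a \<in> I then 1 else 0)" for a
    using assms
  proof (induction I)
    case (insert x I)
    have "order a (\<Prod>x\<in>insert x I. [:- x, 1:]) = order a ([:- x, 1:] * (\<Prod>x\<in>I. [:- x, 1:]))"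
      using insert.hyps by simp
    also have "[:- x, 1:] * (\<Prod>x\<in>I. [:- x, 1:]) \<noteq> 0"
      unfolding mult_eq_0_iff using insert.hyps by (simp add: prod_zero_iff)
    then have "order a ([:- x, 1:] * (\<Prod>x\<in>I. [:- x, 1:])) = order a [:- x, 1:] + order a (\<Prod>x\<in>I. [:- x, 1:])"
      by (rule order_mult)
    also have "order a [:- x, 1:] = (if a = x then 1 else 0)"
      using order_power_n_n[of a 1] by (auto intro: order_0I)
    finally show ?case using insert by auto
  qed simp
  moreover have "(\<Prod>x\<in>I. [:- x, 1:]) \<noteq> 0" using assms by (simp add: prod_zero_iff)
  ultimately show ?thesis by (auto simp: rsquarefree_def)
qed

lemma map_poly_ac_auts_prod:
  assumes t: "\<tau> \<in> ac_auts"
  shows "map_poly \<tau> (\<Prod>i\<in>I. u i) = (\<Prod>i\<in>I. map_poly \<tau> (u i))"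
proof -
  have "map_poly \<tau> (p * q) = map_poly \<tau> p * map_poly \<tau> q" for p q
    by (rule poly_eqI) (simp add: coeff_map_poly coeff_mult ac_auts_simps[OF t] ac_autsD[OF t])
  then show ?thesis
    by (induction I rule: infinite_finite_induct) (auto simp: ac_auts_simps[OF t])
qed

lemma finite_orbit:
  fixes s :: "'a::field alg_closure"
  shows "finite {\<tau> s |\<tau>. \<tau> \<in> ac_auts}"
proof -
  obtain p :: "'a poly" where p: "p \<noteq> 0" "poly (emb p) s = 0" using alg_closure_algebraic by metis
  have "{\<tau> s |\<tau>. \<tau> \<in> ac_auts} \<subseteq> {x. poly (emb p) x = 0}"
    using p(2) ac_auts_poly_emb[of _ p s] by (auto simp: ac_auts_simps)
  moreover have "finite {x. poly (emb p) x = 0}" using p(1) by (intro poly_roots_finite) simp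
  ultimately show ?thesis by (rule finite_subset)
qed

text \<open>The orbit polynomial of \<open>s\<close> has simple roots and invariant coefficients.
  These lie in a field generated by separable elements, so descent puts them into \<open>F\<close>
  although the separability of \<open>s\<close> is still open.\<close>

lemma adjoin_separable:
  fixes S :: "'a::field alg_closure set"
  assumes S: "finite S" "\<And>y. y \<in> S \<Longrightarrow> separable_elt y"
    and stable: "\<And>\<tau> y. \<tau> \<in> ac_auts \<Longrightarrow> y \<in> S \<Longrightarrow> \<tau> y \<in> S" and s: "s \<in> adjoin S"
  shows "separable_elt s"
proof -
  define I where "I = {\<tau> s |\<tau>. \<tau> \<in> ac_auts}"
  have fin: "finite I" unfolding I_def by (rule finite_orbit)
  define h where "h = (\<Prod>x\<in>I. [:- x, 1:])"
  note T = field_graph_Id_adjoin[of S]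
  have I_adjoin: "x \<in> adjoin S" if "x \<in> I" for x
    using that ac_auts_adjoin[of _ S S s] s stable by (auto simp: I_def intro: adjoin.intros)
  have "(- x, - x) \<in> Id_on (adjoin S)" if "x \<in> I" for x using adjoin_uminus[OF I_adjoin[OF that]] by auto
  then have "poly_graph (Id_on (adjoin S)) [:- x, 1:] [:- x, 1:]" if "x \<in> I" for x
    using that by (intro poly_graph_pCons poly_graph_0[OF T] field_graph_0_1[OF T])
  then have "poly_graph (Id_on (adjoin S)) h h" unfolding h_def by (intro poly_graph_Id_prod[OF T])
  then have coeff: "coeff h i \<in> adjoin ({} \<union> S)" for i by (simp add: poly_graph_Id_iff)
  have "\<tau> (coeff h i) = coeff h i" if t: "\<tau> \<in> ac_auts" for \<tau> i
  proof -
    have "\<tau> ` I \<subseteq> I"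
    proof
      fix y assume "y \<in> \<tau> ` I"
      then obtain \<sigma> where "\<sigma> \<in> ac_auts" "y = (\<tau> \<circ> \<sigma>) s" by (auto simp: I_def)
      then show "y \<in> I" using ac_auts_comp[OF t, of \<sigma>] unfolding I_def by blast
    qed
    then have im: "\<tau> ` I = I" using fin by (intro endo_inj_surj) (auto simp: inj_on_def ac_auts_simps[OF t])
    have "map_poly \<tau> h = (\<Prod>x\<in>I. [:- \<tau> x, 1:])"
      unfolding h_def map_poly_ac_auts_prod[OF t] by (simp add: map_poly_pCons ac_auts_simps[OF t])
    also have "\<dots> = (\<Prod>x\<in>\<tau> ` I. [:- x, 1:])"
      by (subst prod.reindex) (auto simp: inj_on_def ac_auts_simps[OF t])
    finally have "map_poly \<tau> h = h" by (simp add: im h_def)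
    then have "coeff (map_poly \<tau> h) i = coeff h i" by simp
    then show ?thesis by (simp add: coeff_map_poly ac_auts_simps[OF t])
  qed
  then have "coeff h i \<in> range to_ac" for i
    using fixed_in_extension[OF S coeff] by (simp add: adjoin_empty)
  then have "emb (map_poly of_ac h) = h"
    by (intro poly_eqI) (simp add: coeff_map_poly to_ac_of_ac)
  moreover have "poly h s = 0" unfolding h_def poly_prod using fin ac_auts_id
    by (auto simp: prod_zero_iff I_def intro!: bexI[of _ s] exI[of _ id])
  moreover have "rsquarefree h" unfolding h_def by (rule rsquarefree_prod_linear[OF fin])
  ultimately show ?thesis unfolding separable_elt_def by metis
qed

lemma separable_elt_conj: "separable_elt y \<Longrightarrow> \<tau> \<in> ac_auts \<Longrightarrow> separable_elt (\<tau> y)"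
  unfolding separable_elt_def by (metis ac_auts_poly_emb ac_auts_simps(1))

text \<open>The generators are enlarged by their finitely many conjugates to make them
  stable.\<close>

lemma separable_elt_adjoin:
  assumes "finite S" "\<And>y. y \<in> S \<Longrightarrow> separable_elt y" "s \<in> adjoin S"
  shows "separable_elt s"
proof -
  define S' where "S' = (\<Union>y\<in>S. {\<tau> y |\<tau>. \<tau> \<in> ac_auts})"
  have "y \<in> S'" if "y \<in> S" for y
    unfolding S'_def using that ac_auts_id by (intro UN_I[OF that] CollectI exI[of _ id]) simp
  then have "S \<subseteq> S'" by blast
  show ?thesis
  proof (rule adjoin_separable)
    show "finite S'" unfolding S'_def using assms(1) finite_orbit by blast
    show "separable_elt y" if "y \<in> S'" for y using that assms(2) separable_elt_conj by (auto simp: S'_def)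
    show "\<tau> y \<in> S'" if t: "\<tau> \<in> ac_auts" and "y \<in> S'" for \<tau> y
    proof -
      obtain x \<sigma> where "x \<in> S" "\<sigma> \<in> ac_auts" "y = \<sigma> x" using \<open>y \<in> S'\<close> by (auto simp: S'_def)
      then show ?thesis using ac_auts_comp[OF t, of \<sigma>]
        unfolding S'_def by (intro UN_I[of x] CollectI exI[of _ "\<tau> \<circ> \<sigma>"]) auto
    qed
    show "s \<in> adjoin S'" using adjoin_mono[OF \<open>S \<subseteq> S'\<close> assms(3)] .
  qed
qed

lemma separable_elt_add: "separable_elt x \<Longrightarrow> separable_elt y \<Longrightarrow> separable_elt (x + y)"
  and separable_elt_mult: "separable_elt x \<Longrightarrow> separable_elt y \<Longrightarrow> separable_elt (x * y)"
  using separable_elt_adjoin[of "{x, y}"] by (auto intro: adjoin.intros)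

lemma separable_elt_to_ac: "separable_elt (to_ac c)"
  using separable_elt_adjoin[of "{}" "to_ac c"] by (auto intro: adjoin.intros)

text \<open>A nonzero polynomial of least degree vanishing at \<open>z\<close> divides the
  squarefree one, hence is squarefree itself, and minimality makes it irreducible.\<close>

lemma sep_closure_iff: "z \<in> sep_closure \<longleftrightarrow> separable_elt z"
proof
  assume "z \<in> sep_closure"
  then show "separable_elt z"
    unfolding sep_closure_def separable_elt_def separable_poly_def by blast
next
  assume "separable_elt z"
  then obtain p where p: "rsquarefree (emb p)" "poly (emb p) z = 0" unfolding separable_elt_def by blast
  have "p \<noteq> 0" using p(1) by (auto simp: rsquarefree_def)
  then obtain m where m: "m \<noteq> 0" "poly (emb m) z = 0"
    and min: "\<And>q. q \<noteq> 0 \<Longrightarrow> poly (emb q) z = 0 \<Longrightarrow> degree m \<le> degree q"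
    using ex_has_least_nat[of "\<lambda>q. q \<noteq> 0 \<and> poly (emb q) z = 0" p degree] p(2) by blast
  have "poly (emb (p mod m)) z = 0"
  proof -
    have "emb p = emb (p div m) * emb m + emb (p mod m)"
      by (metis div_mult_mod_eq emb_add emb_mult)
    then show ?thesis using p(2) m(2) by (metis add_0 mult_zero_right poly_add poly_mult)
  qed
  then have "p mod m = 0"
    using min[of "p mod m"] degree_mod_less[OF m(1), of p] by force
  then have "m dvd p" by (simp add: mod_eq_0_iff_dvd)
  then have "emb m dvd emb p" by (auto simp: emb_mult elim!: dvdE)
  then have sep: "separable_poly m" using rsquarefree_dvd[OF p(1)] by (simp add: separable_poly_def)
  have dm: "degree m > 0"
  proof (rule ccontr)
    assume "\<not> degree m > 0"
    then obtain c where "m = [:c:]" by (auto elim: degree_eq_zeroE)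
    then show False using m by simp
  qed
  have "irreducible m"
  proof (rule irreducibleI)
    show "m \<noteq> 0" "\<not> m dvd 1" using m dm by (auto simp: is_unit_iff_degree)
    fix a b assume ab: "m = a * b"
    then have nz: "a \<noteq> 0" "b \<noteq> 0" using m by auto
    have "poly (emb a) z = 0 \<or> poly (emb b) z = 0" using m(2) by (simp add: ab emb_mult)
    then have "degree m \<le> degree a \<or> degree m \<le> degree b" using min nz by blast
    then have "degree a = 0 \<or> degree b = 0" using nz by (auto simp: ab degree_mult_eq)
    then show "a dvd 1 \<or> b dvd 1" using nz by (auto simp: is_unit_iff_degree)
  qed
  then show "z \<in> sep_closure" using sep m(2) unfolding sep_closure_def by blast
qed

section \<open>From the absolute Galois group to automorphisms of the closure\<close>

lemma abs_Galois_extends: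
  assumes g: "g \<in> abs_Galois" shows "\<exists>\<tau>\<in>ac_auts. \<forall>z\<in>sep_closure. g z = \<tau> z"
proof -
  define T where "T = {(z, g z) |z. z \<in> sep_closure}"
  have hom: "\<And>y z. y \<in> sep_closure \<Longrightarrow> z \<in> sep_closure \<Longrightarrow> g (y + z) = g y + g z \<and> g (y * z) = g y * g z"
    and base: "\<And>c. g (to_ac c) = to_ac c" using g by (auto simp: abs_Galois_def)
  have "field_graph T"
    unfolding field_graph_def
  proof (intro conjI allI impI)
    fix c show "(to_ac c, to_ac c) \<in> T"
      using base[of c] separable_elt_to_ac[of c] by (auto simp: T_def sep_closure_iff)
  next
    fix a b c d assume "(a, b) \<in> T" "(c, d) \<in> T"
    then have *: "a \<in> sep_closure" "b = g a" "c \<in> sep_closure" "d = g c" by (auto simp: T_def)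
    show "(a + c, b + d) \<in> T" "(a * c, b * d) \<in> T"
      using hom[OF *(1,3)] * by (auto simp: T_def sep_closure_iff separable_elt_add separable_elt_mult)
  next
    fix b assume "(0, b) \<in> T" then show "b = 0" using base[of 0] by (auto simp: T_def)
  qed
  then obtain \<tau> where t: "\<tau> \<in> ac_auts" "\<And>a b. (a, b) \<in> T \<Longrightarrow> \<tau> a = b" using field_graph_extends by blast
  have "g z = \<tau> z" if "z \<in> sep_closure" for z using t(2)[of z "g z"] that by (auto simp: T_def)
  then show ?thesis using t(1) by blast
qed

lemma ac_auts_restrict:
  fixes \<tau> :: "'a::field alg_closure \<Rightarrow> 'a alg_closure"
  assumes t: "\<tau> \<in> ac_auts" shows "restrict \<tau> sep_closure \<in> abs_Galois"
proof -
  have im: "\<sigma> z \<in> sep_closure" if "\<sigma> \<in> ac_auts" "z \<in> sep_closure" for \<sigma> and z :: "'a alg_closure"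
    using that by (simp add: sep_closure_iff separable_elt_conj)
  have "bij_betw \<tau> sep_closure sep_closure"
  proof (rule bij_betwI[where g = "inv_into UNIV \<tau>"])
    show "\<tau> \<in> sep_closure \<rightarrow> sep_closure" using im[OF t] by blast
    show "inv_into UNIV \<tau> \<in> sep_closure \<rightarrow> sep_closure" using im[OF ac_auts_inv[OF t]] by blast
  qed (use ac_autsD(1)[OF t] in \<open>auto simp: bij_is_inj bij_is_surj surj_f_inv_f\<close>)
  then have "bij_betw (restrict \<tau> sep_closure) sep_closure sep_closure"
    by (subst bij_betw_restrict_eq)
  then show ?thesis
    unfolding abs_Galois_def
    by (auto simp: sep_closure_iff separable_elt_add separable_elt_mult separable_elt_to_ac ac_autsD[OF t])
qed


section \<open>The arboreal representation\<close>

lemma emb_pcompose: "emb (pcompose p q) = pcompose (emb p) (emb q)"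
  by (induction p) (auto simp: pcompose_pCons emb_add emb_mult)

lemma poly_iter_0 [simp]: "poly_iter f 0 = [:0, 1:]"
  and poly_iter_Suc: "poly_iter f (Suc n) = pcompose f (poly_iter f n)"
  by (simp_all add: poly_iter_def)

lemma poly_iter_Suc': "poly_iter f (Suc n) = pcompose (poly_iter f n) f"
proof (induction n)
  case 0 then show ?case by (simp add: poly_iter_Suc pcompose_pCons pcompose_idR)
next
  case (Suc n)
  have "poly_iter f (Suc (Suc n)) = pcompose f (pcompose (poly_iter f n) f)"
    by (subst poly_iter_Suc) (simp add: Suc)
  also have "\<dots> = pcompose (poly_iter f (Suc n)) f" by (simp add: poly_iter_Suc pcompose_assoc)
  finally show ?case .
qed

lemma prod_words_Suc:
  "(\<Prod>w\<in>words (Suc n). g w) = (\<Prod>w\<in>words n. g (Lx # w) * g (Ly # w))"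
  unfolding words_Suc by (subst prod.union_disjoint) (auto simp: prod.reindex prod.distrib)

lemma prod_branch_Suc:
  "n \<ge> 1 \<Longrightarrow> (\<Prod>w\<in>branch (Suc n) s. g w) = (\<Prod>w\<in>branch n s. g (Lx # w) * g (Ly # w))"
  by (subst branch_Suc, simp, subst prod.union_disjoint) (auto simp: prod.reindex prod.distrib)

lemma ex_sqrt: "\<exists>r. r\<^sup>2 = (c :: 'b::alg_closed_field)"
proof -
  have "degree [:- c, 0, 1:] > 0" by simp
  then obtain r where "poly [:- c, 0, 1:] r = 0" using alg_closed_imp_poly_has_root by blast
  then show ?thesis by (auto simp: power2_eq_square)
qed

lemma Omega_I:
  assumes root: "\<sigma> [] = []" and step: "\<And>s w. \<exists>t. \<sigma> (s # w) = t # \<sigma> w" and inj: "inj \<sigma>"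
  shows "\<sigma> \<in> Omega"
proof -
  have "\<sigma> w = act (portrait \<sigma>) w" for w
  proof (induction w)
    case (Cons s w)
    obtain t u where t: "\<sigma> (Lx # w) = t # \<sigma> w" and u: "\<sigma> (Ly # w) = u # \<sigma> w" using step by meson
    have "\<sigma> (Lx # w) \<noteq> \<sigma> (Ly # w)" using inj by (simp add: inj_eq)
    then have "t \<noteq> u" using t u by auto
    then show ?case using t u Cons by (cases s; cases t; cases u) (auto simp: portrait_def)
  qed (simp add: root)
  then have "\<sigma> = act (portrait \<sigma>)" by (rule ext)
  then show ?thesis using act_in_Omega[of "portrait \<sigma>"] by simp
qed

text \<open>The roots of a nonconstant factor are stable under automorphisms, so by transitivity
  they are all the roots of \<open>p\<close>; counting them leaves degree \<open>0\<close> for the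
  cofactor.\<close>

lemma irreducible_if_transitive:
  fixes p :: "'a::field poly"
  assumes sep: "rsquarefree (emb p)" and ex: "\<exists>z. poly (emb p) z = 0"
    and trans: "\<And>z z'. poly (emb p) z = 0 \<Longrightarrow> poly (emb p) z' = 0 \<Longrightarrow> \<exists>\<tau>\<in>ac_auts. \<tau> z = z'"
  shows "irreducible p"
proof (rule irreducibleI)
  have "emb p \<noteq> 0" using sep by (simp add: rsquarefree_def)
  then show p0: "p \<noteq> 0" by simp
  have "degree p \<noteq> 0"
  proof
    assume "degree p = 0"
    then obtain c where "p = [:c:]" by (auto elim: degree_eq_zeroE)
    then show False using ex p0 by auto
  qed
  then show "\<not> p dvd 1" using p0 by (simp add: is_unit_iff_degree)
  fix a b assume ab: "p = a * b"
  then have nz: "a \<noteq> 0" "b \<noteq> 0" using p0 by auto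
  show "a dvd 1 \<or> b dvd 1"
  proof (rule ccontr)
    assume "\<not> (a dvd 1 \<or> b dvd 1)"
    then have deg: "degree a > 0" "degree b > 0" using nz by (auto simp: is_unit_iff_degree)
    then obtain z where z: "poly (emb a) z = 0" using alg_closed_imp_poly_has_root[of "emb a"] by auto
    have "poly (emb a) z' = 0" if z': "poly (emb p) z' = 0" for z'
    proof -
      have "poly (emb p) z = 0" using z by (simp add: ab emb_mult)
      then obtain \<tau> where "\<tau> \<in> ac_auts" "\<tau> z = z'" using trans[OF _ z'] by blast
      then show ?thesis using ac_auts_poly_emb[of \<tau> a z] z by (simp add: ac_auts_simps)
    qed
    then have "card {z. poly (emb p) z = 0} \<le> card {z. poly (emb a) z = 0}"
      using nz by (intro card_mono poly_roots_finite) auto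
    also have "\<dots> \<le> degree a" using card_poly_roots_bound[of "emb a"] nz by simp
    finally have "degree p \<le> degree a" using card_roots_rsquarefree[OF sep] by simp
    then show False using deg nz by (simp add: ab degree_mult_eq)
  qed
qed

definition sgnb :: "bit \<Rightarrow> 'b::comm_ring_1" where
  "sgnb b = (if b = 0 then 1 else - 1)"

lemma sgnb_add: "sgnb (b + c) = sgnb b * sgnb c"
  by (cases b; cases c) (auto simp: sgnb_def)

lemma sgnb_0 [simp]: "sgnb 0 = 1" by (simp add: sgnb_def)

lemma sgnb_1 [simp]: "sgnb 1 = - 1" by (simp add: sgnb_def)

lemma sgnb_sum: "sgnb (\<Sum>i\<in>I. u i) = (\<Prod>i\<in>I. sgnb (u i))"
  by (induction I rule: infinite_finite_induct) (simp_all add: sgnb_add)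

section \<open>The tree of iterated preimages and its labelling\<close>

locale arboreal =
  fixes \<gamma> \<delta> :: "'a::field" and f :: "'a poly" and \<iota> :: "nat \<times> 'a alg_closure \<Rightarrow> word"
  assumes char: "CHAR('a) \<noteq> 2"
    and f_def: "f = [:- \<gamma>, 1:]\<^sup>2 - [:\<delta>:]"
    and separable: "\<And>n. separable_poly (poly_iter f n)"
    and iso: "tree_iso f \<iota>"
begin

lemma two_neq_0: "(2 :: 'a alg_closure) \<noteq> 0"
proof
  assume "(2 :: 'a alg_closure) = 0"
  then have "of_nat 2 = (0 :: 'a alg_closure)" by simp
  then have "CHAR('a alg_closure) dvd 2" by (simp only: of_nat_eq_0_iff_char_dvd)
  then have "CHAR('a) dvd 2" by simp
  then have "CHAR('a) = 1 \<or> CHAR('a) = 2" using prime_nat_iff two_is_prime_nat by blast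
  then show False using char CHAR_not_1 by auto
qed

lemma double_neq_0: "(x :: 'a alg_closure) \<noteq> 0 \<Longrightarrow> x \<noteq> - x"
proof
  assume "x \<noteq> 0" "x = - x"
  then have "2 * x = 0" by (simp only: eq_neg_iff_add_eq_0 mult_2)
  then show False using two_neq_0 \<open>x \<noteq> 0\<close> by simp
qed

lemma sgnb_eq_1_iff: "(sgnb b :: 'a alg_closure) = 1 \<longleftrightarrow> b = 0"
  using double_neq_0[of 1] by (cases b) auto

definition F :: "'a alg_closure \<Rightarrow> 'a alg_closure" where
  "F z = (z - to_ac \<gamma>)\<^sup>2 - to_ac \<delta>"

lemma poly_emb_f: "poly (emb f) z = F z"
  by (simp add: f_def F_def emb_diff emb_mult power2_eq_square algebra_simps)

lemma poly_emb_iter: "poly (emb (poly_iter f n)) z = (F ^^ n) z"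
  by (induction n) (simp_all add: poly_iter_Suc emb_pcompose poly_pcompose poly_emb_f)

lemma F_to_ac: "(F ^^ n) (to_ac x) = to_ac (poly (poly_iter f n) x)"
proof -
  have "poly (emb p) (to_ac x) = to_ac (poly p x)" for p by (induction p) auto
  then show ?thesis using poly_emb_iter[of n "to_ac x"] by simp
qed

lemma ac_auts_F: "\<tau> \<in> ac_auts \<Longrightarrow> \<tau> (F z) = F (\<tau> z)"
  by (simp add: F_def ac_auts_simps ac_autsD)

lemma ac_auts_F_iter: "\<tau> \<in> ac_auts \<Longrightarrow> \<tau> ((F ^^ n) z) = (F ^^ n) (\<tau> z)"
  by (induction n) (simp_all add: ac_auts_F)

lemma iter_separable_elt: "(F ^^ n) z = 0 \<Longrightarrow> separable_elt z"
  using separable[of n] poly_emb_iter[of n z] unfolding separable_elt_def separable_poly_def by auto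

lemma verts_iff: "(n, z) \<in> tree_verts f \<longleftrightarrow> (F ^^ n) z = 0"
  using iter_separable_elt by (auto simp: tree_verts_def poly_emb_iter sep_closure_iff)

text \<open>Otherwise \<open>\<gamma>\<close> would be a double preimage of \<open>z\<close>, and
  the next iterate would contain the square of a linear factor. This is where separability of all
  iterates is used to get two distinct children.\<close>

lemma ramified_neq_0:
  assumes z: "(F ^^ n) z = 0" shows "to_ac \<delta> + z \<noteq> 0"
proof
  assume dz: "to_ac \<delta> + z = 0"
  have "poly (emb (poly_iter f n)) z = 0" using z by (simp add: poly_emb_iter)
  then obtain r where r: "emb (poly_iter f n) = [:- z, 1:] * r"
    by (auto simp: poly_eq_0_iff_dvd elim!: dvdE)
  have "z = - to_ac \<delta>" using dz by (simp add: eq_neg_iff_add_eq_0 add.commute)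
  then have "emb f - [:z:] = [:- to_ac \<gamma>, 1:] ^ 2"
    by (simp add: f_def emb_diff emb_mult power2_eq_square)
  moreover have "emb (poly_iter f (Suc n)) = (emb f - [:z:]) * pcompose r (emb f)"
    unfolding poly_iter_Suc' emb_pcompose r pcompose_mult by (simp add: pcompose_pCons)
  ultimately have "[:- to_ac \<gamma>, 1:] ^ 2 dvd emb (poly_iter f (Suc n))" by simp
  then have "emb (poly_iter f (Suc n)) = 0 \<or> 2 \<le> order (to_ac \<gamma>) (emb (poly_iter f (Suc n)))"
    by (simp only: order_divides)
  moreover have "emb (poly_iter f (Suc n)) \<noteq> 0"
    "order (to_ac \<gamma>) (emb (poly_iter f (Suc n))) = 0 \<or> order (to_ac \<gamma>) (emb (poly_iter f (Suc n))) = 1"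
    using separable[of "Suc n"] unfolding separable_poly_def rsquarefree_def by blast+
  ultimately show False by auto
qed

definition vert :: "word \<Rightarrow> nat \<times> 'a alg_closure" where
  "vert w = inv_into (tree_verts f) \<iota> w"

lemma vert: "vert w \<in> tree_verts f" "\<iota> (vert w) = w" "v \<in> tree_verts f \<Longrightarrow> vert (\<iota> v) = v"
  using iso unfolding tree_iso_def vert_def
  by (auto simp: bij_betw_def inv_into_into f_inv_into_f)

lemma tree_adj_vert: "tree_adj f (vert v) (vert w) \<longleftrightarrow> word_adj v w"
  using iso vert(1,2) unfolding tree_iso_def by metis

lemma F_eq_iff:
  assumes "r\<^sup>2 = to_ac \<delta> + b" shows "F z = b \<longleftrightarrow> z = to_ac \<gamma> + r \<or> z = to_ac \<gamma> - r"
proof -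
  have "F z = b \<longleftrightarrow> (z - to_ac \<gamma>)\<^sup>2 = r\<^sup>2" using assms by (auto simp: F_def algebra_simps)
  also have "\<dots> \<longleftrightarrow> z - to_ac \<gamma> = r \<or> z - to_ac \<gamma> = - r" by (rule power2_eq_iff)
  finally show ?thesis by (auto simp: algebra_simps)
qed

text \<open>\<open>tree_iso\<close> does not mention levels. A vertex beyond level zero has a parent
  and two children, so the empty word, of valency two, can only correspond to the root
  \<open>(0, 0)\<close>.\<close>

lemma card_tree_nbrs:
  assumes "(Suc n, b) \<in> tree_verts f"
  shows "card {v \<in> tree_verts f. tree_adj f (Suc n, b) v} = 3"
proof -
  have b: "(F ^^ Suc n) b = 0" using assms by (simp only: verts_iff)
  obtain r where r: "r\<^sup>2 = to_ac \<delta> + b" using ex_sqrt by blast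
  have r0: "r \<noteq> 0" using ramified_neq_0[OF b] r by auto
  have ne: "to_ac \<gamma> + r \<noteq> to_ac \<gamma> - r" using double_neq_0[OF r0] by (simp add: eq_diff_eq)
  have ch: "(F ^^ Suc (Suc n)) z = 0" if "F z = b" for z
    using b that unfolding funpow_Suc_right[of "Suc n"] comp_apply by simp
  have pa: "(F ^^ n) (F b) = 0" using b unfolding funpow_Suc_right comp_apply .
  have adj: "(k, z) \<in> tree_verts f \<and> tree_adj f (Suc n, b) (k, z) \<longleftrightarrow> k = n \<and> z = F b \<or> k = Suc (Suc n) \<and> F z = b" for k z
    unfolding verts_iff using pa ch[of z] by (auto simp: tree_adj_def tree_child_def poly_emb_f simp del: funpow.simps)
  have "{v \<in> tree_verts f. tree_adj f (Suc n, b) v}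
      = {(Suc (Suc n), to_ac \<gamma> + r), (Suc (Suc n), to_ac \<gamma> - r), (n, F b)}"
  proof (rule Set.set_eqI)
    fix v :: "nat \<times> 'a alg_closure"
    obtain k z where "v = (k, z)" by (cases v)
    then show "v \<in> {v \<in> tree_verts f. tree_adj f (Suc n, b) v} \<longleftrightarrow>
      v \<in> {(Suc (Suc n), to_ac \<gamma> + r), (Suc (Suc n), to_ac \<gamma> - r), (n, F b)}"
      using adj[of k z] F_eq_iff[OF r, of z] by auto
  qed
  then show ?thesis using ne by simp
qed

lemma vert_root: "vert [] = (0, 0)"
proof -
  have "{v \<in> tree_verts f. tree_adj f (vert []) v} = vert ` {w. word_adj [] w}"
  proof (intro Set.set_eqI iffI)
    fix v assume v: "v \<in> {v \<in> tree_verts f. tree_adj f (vert []) v}"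
    then have "vert (\<iota> v) = v" using vert(3) by simp
    then show "v \<in> vert ` {w. word_adj [] w}" using v tree_adj_vert[of "[]" "\<iota> v"] by force
  qed (use vert(1) tree_adj_vert in auto)
  moreover have "inj vert" using vert(2) by (metis injI)
  ultimately have card: "card {v \<in> tree_verts f. tree_adj f (vert []) v} = 2"
    using card_word_nbrs[of "[]"] by (simp add: card_image inj_on_subset)
  obtain n b where nb: "vert [] = (n, b)" by (cases "vert []")
  show ?thesis
  proof (cases n)
    case 0
    then show ?thesis using vert(1)[of "[]"] nb by (simp add: verts_iff)
  next
    case (Suc m)
    then show ?thesis using card card_tree_nbrs[of m b] vert(1)[of "[]"] nb by simp
  qed
qed

text \<open>Adjacency is symmetric, so a neighbour of a vertex might be its parent; the parent is
  already labelled by the shorter word, hence the new neighbour is a child.\<close>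

lemma vert_Cons: "fst (vert w) = length w \<and> tree_child f (vert (s # w)) (vert w)"
proof (induction w arbitrary: s)
  case Nil
  have "tree_adj f (vert [s]) (vert [])" by (simp add: tree_adj_vert word_adj_def)
  then show ?case by (auto simp: vert_root tree_adj_def tree_child_def)
next
  case (Cons r w)
  have l: "fst (vert (r # w)) = Suc (length w)" and ch: "tree_child f (vert (r # w)) (vert w)"
    using Cons[of r] by (auto simp: tree_child_def)
  have "tree_adj f (vert (s # r # w)) (vert (r # w))" by (simp add: tree_adj_vert word_adj_def)
  moreover have "\<not> tree_child f (vert (r # w)) (vert (s # r # w))"
  proof
    assume "tree_child f (vert (r # w)) (vert (s # r # w))"
    then have "vert (s # r # w) = vert w" using ch by (auto simp: tree_child_def prod_eq_iff)
    then have "s # r # w = w" using vert(2) by metis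
    then show False by (metis Suc_n_not_le_n le_SucI length_Cons order_refl)
  qed
  ultimately show ?case using l by (simp add: tree_adj_def)
qed

definition th :: "word \<Rightarrow> 'a alg_closure" where "th w = snd (vert w)"

lemma vert_eq: "vert w = (length w, th w)"
  using vert_Cons[of w Lx] by (simp add: th_def prod_eq_iff)

lemma th_Nil [simp]: "th [] = 0"
  by (simp add: th_def vert_root)

lemma F_th: "F (th (s # w)) = th w"
  using vert_Cons[of w s] by (simp add: tree_child_def th_def poly_emb_f)

lemma F_iter_th: "(F ^^ length w) (th w) = 0"
  using vert(1)[of w] unfolding vert_eq verts_iff .

lemma th_inj: "length v = length w \<Longrightarrow> th v = th w \<Longrightarrow> v = w"
  using vert(2)[of v] vert(2)[of w] unfolding vert_eq by metis

lemma ex_th: "(F ^^ n) z = 0 \<Longrightarrow> \<exists>w. length w = n \<and> th w = z"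
  using vert(3)[of "(n, z)"] vert_eq[of "\<iota> (n, z)"] by (auto simp: verts_iff)

lemma F_iter_th_append: "(F ^^ length v) (th (v @ w)) = th w"
proof (induction v)
  case (Cons s v)
  have "(F ^^ length (s # v)) (th ((s # v) @ w)) = (F ^^ length v) (F (th (s # v @ w)))"
    by (simp add: funpow_swap1)
  then show ?case using Cons by (simp add: F_th)
qed simp

lemma separable_th: "separable_elt (th w)"
  using iter_separable_elt[OF F_iter_th] .

text \<open>The square root of \<open>\<delta> + th w\<close> whose sign is chosen by the labelling:
  \<open>Lx\<close> receives the plus sign.\<close>

definition rt :: "word \<Rightarrow> 'a alg_closure" where "rt w = th (Lx # w) - to_ac \<gamma>"

lemma rt_square: "(rt w)\<^sup>2 = to_ac \<delta> + th w"
  using F_th[of Lx w] by (simp add: F_def rt_def algebra_simps)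

lemma rt_neq_0: "rt w \<noteq> 0"
  using rt_square[of w] ramified_neq_0[OF F_iter_th[of w]] by auto

lemma th_Lx: "th (Lx # w) = to_ac \<gamma> + rt w"
  by (simp add: rt_def)

lemma th_Ly: "th (Ly # w) = to_ac \<gamma> - rt w"
proof -
  have "th (Ly # w) = to_ac \<gamma> + rt w \<or> th (Ly # w) = to_ac \<gamma> - rt w"
    using F_eq_iff[OF rt_square] F_th by blast
  moreover have "th (Ly # w) \<noteq> th (Lx # w)" using th_inj[of "Ly # w" "Lx # w"] by auto
  ultimately show ?thesis by (auto simp: th_Lx)
qed

lemma th_flipb: "th (flipb b Lx # w) = to_ac \<gamma> + sgnb b * rt w"
  by (cases b) (auto simp: th_Lx th_Ly)

lemma separable_rt: "separable_elt (rt w)"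
  unfolding rt_def using separable_elt_add[OF separable_th separable_elt_to_ac[of "- \<gamma>"]] by simp

text \<open>The action on words for all of \<open>ac_auts\<close>; by \<open>im_rho_eq\<close> its
  image is that of the absolute Galois group, because labels are separable.\<close>

definition gal :: "('a alg_closure \<Rightarrow> 'a alg_closure) \<Rightarrow> word \<Rightarrow> word" where
  "gal \<tau> w = \<iota> (length w, \<tau> (th w))"

lemma gal:
  assumes "\<tau> \<in> ac_auts"
  shows "length (gal \<tau> w) = length w" "th (gal \<tau> w) = \<tau> (th w)"
proof -
  have "(F ^^ length w) (\<tau> (th w)) = 0"
    using ac_auts_F_iter[OF assms, of "length w" "th w"] by (simp add: F_iter_th ac_auts_simps[OF assms])
  then have "vert (gal \<tau> w) = (length w, \<tau> (th w))" unfolding gal_def by (intro vert(3)) (simp add: verts_iff)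
  then show "length (gal \<tau> w) = length w" "th (gal \<tau> w) = \<tau> (th w)" by (auto simp: vert_eq)
qed

lemma gal_unique: "\<tau> \<in> ac_auts \<Longrightarrow> length v = length w \<Longrightarrow> th v = \<tau> (th w) \<Longrightarrow> gal \<tau> w = v"
  by (rule th_inj) (simp_all add: gal)

lemma gal_Omega: assumes "\<tau> \<in> ac_auts" shows "gal \<tau> \<in> Omega"
proof (rule Omega_I)
  show "gal \<tau> [] = []" using gal(1)[OF assms, of "[]"] by simp
  show "\<exists>t. gal \<tau> (s # w) = t # gal \<tau> w" for s w
  proof -
    obtain t v where tv: "gal \<tau> (s # w) = t # v" using gal(1)[OF assms, of "s # w"] by (cases "gal \<tau> (s # w)") auto
    have "gal \<tau> w = v"
    proof (rule gal_unique[OF assms])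
      show "length v = length w" using gal(1)[OF assms, of "s # w"] tv by simp
      have "th v = F (th (gal \<tau> (s # w)))" by (simp add: tv F_th)
      also have "\<dots> = \<tau> (th w)" by (simp add: gal(2)[OF assms] F_th flip: ac_auts_F[OF assms])
      finally show "th v = \<tau> (th w)" .
    qed
    then show ?thesis using tv by simp
  qed
  show "inj (gal \<tau>)"
  proof (rule injI)
    fix v w assume vw: "gal \<tau> v = gal \<tau> w"
    show "v = w"
    proof (rule th_inj)
      show "length v = length w" using vw gal(1)[OF assms] by metis
      have "\<tau> (th v) = \<tau> (th w)" using vw gal(2)[OF assms] by metis
      then show "th v = th w" by (simp add: ac_auts_simps[OF assms])
    qed
  qed
qed

lemma im_rho_eq: "im_rho f \<iota> = gal ` ac_auts"
proof -
  have eq: "\<iota> \<circ> rho g \<circ> inv_into (tree_verts f) \<iota> = gal \<tau>" if "\<And>z. z \<in> sep_closure \<Longrightarrow> g z = \<tau> z" for g \<tau>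
    using that separable_th by (auto simp: fun_eq_iff gal_def rho_def vert_eq sep_closure_iff simp flip: vert_def)
  show ?thesis
  proof (intro Set.set_eqI iffI)
    fix \<sigma> assume "\<sigma> \<in> im_rho f \<iota>"
    then obtain g where g: "g \<in> abs_Galois" "\<sigma> = \<iota> \<circ> rho g \<circ> inv_into (tree_verts f) \<iota>" by (auto simp: im_rho_def)
    obtain \<tau> where "\<tau> \<in> ac_auts" "\<And>z. z \<in> sep_closure \<Longrightarrow> g z = \<tau> z" using abs_Galois_extends[OF g(1)] by blast
    then show "\<sigma> \<in> gal ` ac_auts" using eq[of g \<tau>] g(2) by blast
  next
    fix \<sigma> assume "\<sigma> \<in> gal ` ac_auts"
    then obtain \<tau> where t: "\<tau> \<in> ac_auts" "\<sigma> = gal \<tau>" by blast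
    have e: "\<iota> \<circ> rho (restrict \<tau> sep_closure) \<circ> inv_into (tree_verts f) \<iota> = gal \<tau>" by (rule eq) simp
    show "\<sigma> \<in> im_rho f \<iota>"
      unfolding im_rho_def t(2) e[symmetric] by (rule imageI[OF ac_auts_restrict[OF t(1)]])
  qed
qed

abbreviation G :: "(word \<Rightarrow> word) set" where "G \<equiv> gal ` ac_auts"

lemma gal_comp: "\<sigma> \<in> ac_auts \<Longrightarrow> \<tau> \<in> ac_auts \<Longrightarrow> gal (\<sigma> \<circ> \<tau>) = gal \<sigma> \<circ> gal \<tau>"
  by (rule ext, rule gal_unique) (simp_all add: ac_auts_comp gal)

lemma gal_id: "gal id = id"
  by (rule ext, rule gal_unique) (simp_all add: ac_auts_id)

lemma G_group: "tree_subgroup G"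
  unfolding tree_subgroup_def
proof (intro conjI ballI)
  show "G \<subseteq> Omega" using gal_Omega by blast
  show "id \<in> G" using gal_id ac_auts_id by (metis imageI)
  show "\<sigma> \<circ> \<tau> \<in> G" if st: "\<sigma> \<in> G" "\<tau> \<in> G" for \<sigma> \<tau>
  proof -
    obtain \<sigma>' \<tau>' where *: "\<sigma>' \<in> ac_auts" "\<tau>' \<in> ac_auts" "\<sigma> = gal \<sigma>'" "\<tau> = gal \<tau>'" using st by blast
    show ?thesis unfolding *(3,4) gal_comp[OF *(1,2), symmetric] by (rule imageI[OF ac_auts_comp[OF *(1,2)]])
  qed
  show "tree_inv \<sigma> \<in> G" if s: "\<sigma> \<in> G" for \<sigma>
  proof -
    obtain \<tau> where t: "\<tau> \<in> ac_auts" "\<sigma> = gal \<tau>" using s by blast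
    have i: "inv_into UNIV \<tau> \<circ> \<tau> = id" using ac_autsD(1)[OF t(1)] by (simp add: bij_is_inj)
    have "gal (inv_into UNIV \<tau>) \<circ> gal \<tau> = id"
      unfolding gal_comp[OF ac_auts_inv[OF t(1)] t(1), symmetric] i by (rule gal_id)
    then have "gal (inv_into UNIV \<tau>) (\<sigma> w) = w" for w using t(2) by (metis comp_apply id_apply)
    then have "gal (inv_into UNIV \<tau>) v = tree_inv \<sigma> v" for v
      using Omega_inv_cancel(2)[OF gal_Omega[OF t(1)]] t(2) by metis
    then have "tree_inv \<sigma> = gal (inv_into UNIV \<tau>)" by auto
    then show ?thesis using ac_auts_inv[OF t(1)] by blast
  qed
qed

text \<open>The partial homomorphism over \<open>F\<close> that an automorphism inducing
  \<open>\<sigma>\<close> is forced to extend.\<close>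

inductive_set limit_graph :: "(word \<Rightarrow> word) \<Rightarrow> ('a alg_closure \<times> 'a alg_closure) set" for \<sigma> where
  "(to_ac c, to_ac c) \<in> limit_graph \<sigma>"
| "(th w, th (\<sigma> w)) \<in> limit_graph \<sigma>"
| "(a, b) \<in> limit_graph \<sigma> \<Longrightarrow> (c, d) \<in> limit_graph \<sigma> \<Longrightarrow> (a + c, b + d) \<in> limit_graph \<sigma>"
| "(a, b) \<in> limit_graph \<sigma> \<Longrightarrow> (c, d) \<in> limit_graph \<sigma> \<Longrightarrow> (a * c, b * d) \<in> limit_graph \<sigma>"

text \<open>In place of a compactness argument: every pair of \<open>limit_graph \<sigma>\<close> is
  realised by all sufficiently good approximants. Hence the relation sends \<open>0\<close> only to
  \<open>0\<close>, and it extends to an automorphism of the closure.\<close>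

lemma G_closed:
  assumes s: "\<sigma> \<in> Omega" and approx: "\<And>n. \<exists>g\<in>G. agree n \<sigma> g"
  shows "\<sigma> \<in> G"
proof -
  have "\<exists>\<tau>. \<tau> \<in> ac_auts \<and> agree n \<sigma> (gal \<tau>)" for n using approx[of n] by blast
  then obtain t where t: "\<And>n. t n \<in> ac_auts" "\<And>n. agree n \<sigma> (gal (t n))" by metis
  have lim: "\<exists>n. \<forall>m\<ge>n. t m a = b" if "(a, b) \<in> limit_graph \<sigma>" for a b
    using that
  proof induction
    case (1 c)
    then show ?case using t(1) ac_autsD(4) by blast
  next
    case (2 w)
    have "t m (th w) = th (\<sigma> w)" if m: "m \<ge> length w" for m
    proof -
      have "agree (length w) \<sigma> (gal (t m))"
        using m t(2)[of m]
      proof (induction rule: inc_induct)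
        case (step k)
        then show ?case using agree_Suc_iff[OF s gal_Omega[OF t(1)]] by blast
      qed
      then have "\<sigma> w = gal (t m) w" by (simp add: agree_def)
      then show ?thesis using gal(2)[OF t(1)] by simp
    qed
    then show ?case by blast
  next
    case (3 a b c d)
    then obtain n n' where "\<forall>m\<ge>n. t m a = b" "\<forall>m\<ge>n'. t m c = d" by blast
    then show ?case using ac_autsD(2)[OF t(1)] by (intro exI[of _ "max n n'"]) auto
  next
    case (4 a b c d)
    then obtain n n' where "\<forall>m\<ge>n. t m a = b" "\<forall>m\<ge>n'. t m c = d" by blast
    then show ?case using ac_autsD(3)[OF t(1)] by (intro exI[of _ "max n n'"]) auto
  qed
  have "field_graph (limit_graph \<sigma>)"
    unfolding field_graph_def
  proof (intro conjI allI impI)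
    fix b assume "(0, b) \<in> limit_graph \<sigma>"
    then obtain n where "\<forall>m\<ge>n. t m 0 = b" using lim by blast
    then show "b = 0" using ac_auts_simps(1)[OF t(1)] by auto
  qed (auto intro: limit_graph.intros)
  then obtain \<tau> where tau: "\<tau> \<in> ac_auts" "\<And>a b. (a, b) \<in> limit_graph \<sigma> \<Longrightarrow> \<tau> a = b"
    using field_graph_extends by blast
  have "gal \<tau> w = \<sigma> w" for w
    using tau(2)[OF limit_graph.intros(2)[of w]] s by (intro gal_unique[OF tau(1)]) auto
  then have "\<sigma> = gal \<tau>" by auto
  then show ?thesis using tau(1) by blast
qed

lemma ac_auts_rt:
  assumes "\<tau> \<in> ac_auts" shows "\<tau> (rt w) = sgnb (portrait (gal \<tau>) w) * rt (gal \<tau> w)"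
proof -
  have "to_ac \<gamma> + sgnb (portrait (gal \<tau>) w) * rt (gal \<tau> w) = th (gal \<tau> (Lx # w))"
    by (simp add: Omega_Cons[OF gal_Omega[OF assms]] th_flipb)
  also have "\<dots> = to_ac \<gamma> + \<tau> (rt w)"
    by (simp add: gal(2)[OF assms] th_Lx ac_autsD[OF assms])
  finally show ?thesis by simp
qed

section \<open>Square roots of orbit elements as products over levels\<close>

definition rprod :: "word set \<Rightarrow> 'a alg_closure" where "rprod S = (\<Prod>w\<in>S. rt w)"

lemma rprod_neq_0: "rprod S \<noteq> 0"
  unfolding rprod_def using rt_neq_0 by (cases "finite S") (auto simp: prod_zero_iff)

lemma separable_elt_prod: "(\<And>i. i \<in> I \<Longrightarrow> separable_elt (u i)) \<Longrightarrow> separable_elt (\<Prod>i\<in>I. u i)"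
  by (induction I rule: infinite_finite_induct)
    (use separable_elt_to_ac[of 1] in \<open>auto intro: separable_elt_mult\<close>)

lemma separable_rprod: "separable_elt (rprod S)"
  unfolding rprod_def by (intro separable_elt_prod separable_rt)

lemma ac_auts_rprod:
  assumes "\<tau> \<in> ac_auts"
  shows "\<tau> (rprod S) = sgnb (psum S (gal \<tau>)) * rprod (gal \<tau> ` S)"
proof -
  have inj: "inj_on (gal \<tau>) S" using Omega_inj[OF gal_Omega[OF assms]] by (auto simp: inj_on_def)
  have "\<tau> (rprod S) = (\<Prod>w\<in>S. sgnb (portrait (gal \<tau>) w) * rt (gal \<tau> w))"
    unfolding rprod_def by (simp add: ac_auts_simps[OF assms] ac_auts_rt[OF assms])
  then show ?thesis by (simp add: prod.distrib rprod_def psum_def sgnb_sum prod.reindex[OF inj])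
qed

abbreviation c :: "nat \<Rightarrow> 'a" where "c \<equiv> adj_orbit f \<gamma>"

lemma c_0: "c 0 = \<delta>"
  by (simp add: adj_orbit_def f_def)

lemma c_pos: "n \<ge> 1 \<Longrightarrow> to_ac (c n) = (F ^^ n) (- to_ac \<delta>)"
proof -
  assume "n \<ge> 1"
  then have "to_ac (c n) = (F ^^ Suc n) (to_ac \<gamma>)" by (simp only: F_to_ac) (simp add: adj_orbit_def)
  also have "\<dots> = (F ^^ n) (- to_ac \<delta>)" unfolding funpow_Suc_right comp_apply by (simp add: F_def)
  finally show ?thesis .
qed

lemma fibre_prod: "(t - th (Lx # w)) * (t - th (Ly # w)) = F t - th w"
proof -
  have "(t - th (Lx # w)) * (t - th (Ly # w)) = (t - to_ac \<gamma>)\<^sup>2 - (rt w)\<^sup>2"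
    by (simp add: th_Lx th_Ly power2_eq_square algebra_simps)
  then show ?thesis by (simp add: rt_square F_def algebra_simps)
qed

lemma fibre_prod': "(to_ac \<delta> + th (Lx # w)) * (to_ac \<delta> + th (Ly # w)) = F (- to_ac \<delta>) - th w"
  using fibre_prod[of "- to_ac \<delta>" w] by (simp add: algebra_simps)

lemma words_prod: "(\<Prod>w\<in>words n. t - th w) = (F ^^ n) t"
  by (induction n arbitrary: t) (simp_all add: words_0 prod_words_Suc fibre_prod funpow_swap1)

lemma branch_prod: "(\<Prod>w\<in>branch (Suc n) s. t - th w) = (F ^^ n) t - th [s]"
  by (induction n arbitrary: t) (simp_all add: branch_1 prod_branch_Suc fibre_prod funpow_swap1)

text \<open>The product of \<open>\<delta> + \<beta>\<close> over a level \<open>n \<ge> 1\<close>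
  has an even number of factors, so the signs cancel and it equals the \<open>n\<close>-th iterate
  at \<open>- \<delta> = f(\<gamma>)\<close>. On level \<open>0\<close> the single factor is
  \<open>\<delta>\<close>, which explains the sign in \<open>c_0\<close>.\<close>

lemma rprod_words_square: "(rprod (words n))\<^sup>2 = to_ac (c n)"
proof (cases n)
  case 0
  then show ?thesis by (simp add: rprod_def words_0 rt_square c_0)
next
  case (Suc m)
  have "(rprod (words n))\<^sup>2 = (\<Prod>w\<in>words n. to_ac \<delta> + th w)"
    by (simp add: rprod_def rt_square prod_power_distrib)
  also have "\<dots> = (F ^^ m) (F (- to_ac \<delta>))" by (simp add: Suc prod_words_Suc fibre_prod' words_prod)
  also have "\<dots> = to_ac (c n)" using Suc by (simp add: c_pos funpow_swap1)
  finally show ?thesis .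
qed

text \<open>Half of level \<open>i\<close> has \<open>2^(i - 1)\<close> vertices. For
  \<open>i = 1\<close> this number is odd and the sign survives, whence the separate first case; the
  index drops by one because the half starts at level one.\<close>

definition bval :: "nat \<Rightarrow> letter \<Rightarrow> 'a alg_closure" where
  "bval i s = (if i = 1 then to_ac (c 0) + th [s] else to_ac (c (i - 1)) - th [s])"

lemma rprod_branch_square:
  assumes "n \<ge> 1" shows "(rprod (branch n s))\<^sup>2 = bval n s"
proof -
  have *: "(rprod (branch n s))\<^sup>2 = (\<Prod>w\<in>branch n s. to_ac \<delta> + th w)"
    by (simp add: rprod_def rt_square prod_power_distrib)
  show ?thesis
  proof (cases "n = 1")
    case True then show ?thesis using * by (simp add: branch_1 bval_def c_0)
  next
    case False
    then obtain m where m: "n = Suc (Suc m)" using assms by (cases n; cases "n - 1") auto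
    have "(\<Prod>w\<in>branch n s. to_ac \<delta> + th w) = (F ^^ m) (F (- to_ac \<delta>)) - th [s]"
      unfolding m by (simp add: prod_branch_Suc fibre_prod' branch_prod)
    also have "\<dots> = to_ac (c (Suc m)) - th [s]" by (simp add: c_pos funpow_swap1)
    finally show ?thesis using * m by (simp add: bval_def)
  qed
qed

lemma c_neq_0: "c n \<noteq> 0"
  using rprod_words_square[of n] rprod_neq_0[of "words n"] by auto

text \<open>A square root is unique up to sign, and an invariant one lies in \<open>F\<close> by
  descent, for which \<open>x\<close> has to be separable.\<close>

lemma unit_square_iff:
  assumes "separable_elt x" "x \<noteq> 0" "x\<^sup>2 = to_ac y"
  shows "unit_square y \<longleftrightarrow> (\<forall>\<tau>\<in>ac_auts. \<tau> x = x)"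
proof
  assume "unit_square y"
  then obtain r where "y = r\<^sup>2" by (auto simp: unit_square_def)
  then have "x\<^sup>2 = (to_ac r)\<^sup>2" using assms(3) by simp
  then have "x = to_ac r \<or> x = to_ac (- r)" by (simp add: power2_eq_iff)
  then show "\<forall>\<tau>\<in>ac_auts. \<tau> x = x" using ac_autsD(4) by metis
next
  assume "\<forall>\<tau>\<in>ac_auts. \<tau> x = x"
  then obtain r where r: "x = to_ac r" using separable_elt_fixed[OF assms(1)] by blast
  then have "to_ac (r\<^sup>2) = to_ac y" using assms(3) by simp
  then have "y = r\<^sup>2" by (simp only: to_ac_eq_iff)
  moreover have "r \<noteq> 0" using r assms(2) by auto
  ultimately show "unit_square y" by (auto simp: unit_square_def)
qed

lemma unit_square_character:
  assumes "separable_elt x" "x \<noteq> 0" "x\<^sup>2 = to_ac y"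
    and "\<And>\<tau>. \<tau> \<in> ac_auts \<Longrightarrow> \<tau> x = sgnb (\<chi> (gal \<tau>)) * x"
  shows "unit_square y \<longleftrightarrow> (\<forall>\<sigma>\<in>G. \<chi> \<sigma> = 0)"
proof -
  have "\<tau> x = x \<longleftrightarrow> \<chi> (gal \<tau>) = 0" if "\<tau> \<in> ac_auts" for \<tau>
    using assms(4)[OF that] assms(2) sgnb_eq_1_iff by simp
  then show ?thesis unfolding unit_square_iff[OF assms(1-3)] by auto
qed

definition cprod :: "nat set \<Rightarrow> 'a alg_closure" where "cprod A = (\<Prod>i\<in>A. rprod (words i))"

lemma cprod_neq_0: "cprod A \<noteq> 0"
  unfolding cprod_def using rprod_neq_0 by (cases "finite A") (auto simp: prod_zero_iff)

lemma separable_cprod: "separable_elt (cprod A)"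
  unfolding cprod_def by (intro separable_elt_prod separable_rprod)

lemma cprod_square: "(cprod A)\<^sup>2 = to_ac (\<Prod>i\<in>A. c i)"
  by (simp add: cprod_def prod_power_distrib rprod_words_square to_ac_prod)

lemma ac_auts_cprod: "\<tau> \<in> ac_auts \<Longrightarrow> \<tau> (cprod A) = sgnb (chi A (gal \<tau>)) * cprod A"
  by (simp add: cprod_def ac_auts_simps ac_auts_rprod Omega_image_words gal_Omega prod.distrib chi_def sgnb_sum)

lemma unit_square_chi: "unit_square (\<Prod>i\<in>A. c i) \<longleftrightarrow> (\<forall>\<sigma>\<in>G. chi A \<sigma> = 0)"
  by (rule unit_square_character[OF separable_cprod cprod_neq_0 cprod_square ac_auts_cprod])

end

section \<open>Square classes\<close>

lemma sq_equiv_refl: "x \<noteq> 0 \<Longrightarrow> sq_equiv x x"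
  by (auto simp: sq_equiv_def intro!: exI[of _ 1])

lemma sq_class_eq_iff: "x \<noteq> 0 \<Longrightarrow> y \<noteq> 0 \<Longrightarrow> sq_class x = sq_class y \<longleftrightarrow> sq_equiv x y"
  using Quotient3_rel[OF Quotient3_sqclass, of x y] sq_equiv_refl[of x] sq_equiv_refl[of y] by auto

lemma sq_class_mult: "x \<noteq> 0 \<Longrightarrow> y \<noteq> 0 \<Longrightarrow> sq_class (x * y) = sq_class x + sq_class y"
  using plus_sqclass.abs_eq[of x y] sq_equiv_refl by metis

lemma sq_class_1: "sq_class 1 = 0"
  by (simp add: zero_sqclass_def)

lemma sq_class_eq_0_iff: "x \<noteq> 0 \<Longrightarrow> sq_class x = 0 \<longleftrightarrow> unit_square x"
  unfolding sq_class_1[symmetric] by (subst sq_class_eq_iff) (auto simp: sq_equiv_def unit_square_def)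

lemma sq_class_prod: "(\<And>i. i \<in> A \<Longrightarrow> v i \<noteq> 0) \<Longrightarrow> sq_class (\<Prod>i\<in>A. v i) = (\<Sum>i\<in>A. sq_class (v i))"
  by (induction A rule: infinite_finite_induct) (auto simp: sq_class_1 sq_class_mult prod_zero_iff)

lemma sqclass_eq_iff_add: "(x :: 'a::field sqclass) = y \<longleftrightarrow> x + y = 0"
  by (metis add_right_cancel sqclass_double)

text \<open>Over the field of two elements linear combinations are sums over finite subsets; adding
  a term already present removes it.\<close>

lemma sq_span_image_iff:
  "x \<in> sq.span (h ` J) \<longleftrightarrow> (\<exists>A. finite A \<and> A \<subseteq> J \<and> x = (\<Sum>i\<in>A. h i))"
proof
  assume "x \<in> sq.span (h ` J)"
  then show "\<exists>A. finite A \<and> A \<subseteq> J \<and> x = (\<Sum>i\<in>A. h i)"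
  proof (induction rule: sq.span_induct_alt)
    case base
    show ?case by (intro exI[of _ "{}"]) simp
  next
    case (step b z y)
    then obtain i A where i: "i \<in> J" "z = h i" and A: "finite A" "A \<subseteq> J" "y = (\<Sum>i\<in>A. h i)" by blast
    show ?case
    proof (cases "b = 0")
      case True then show ?thesis using A by (auto simp: sq_scale_def)
    next
      case False
      show ?thesis
      proof (cases "i \<in> A")
        case True
        have "h i + y = (\<Sum>i\<in>A - {i}. h i)"
          using A True by (simp add: sum.remove[of A i] sqclass_double flip: add.assoc)
        then show ?thesis using False i A by (intro exI[of _ "A - {i}"]) (auto simp: sq_scale_def)
      next
        case nA: False
        then show ?thesis using False i A by (intro exI[of _ "insert i A"]) (auto simp: sq_scale_def)
      qed
    qed
  qed
next
  assume "\<exists>A. finite A \<and> A \<subseteq> J \<and> x = (\<Sum>i\<in>A. h i)"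
  then show "x \<in> sq.span (h ` J)" by (auto intro!: sq.span_sum intro: sq.span_base)
qed

text \<open>Injectivity is the case of a two-element product, and a dependence of one class on
  others is a square product over the corresponding indices.\<close>

lemma sq_independent_family_iff:
  "sq_independent_family v \<longleftrightarrow>
     (\<forall>i. v i \<noteq> 0) \<and> (\<forall>A. finite A \<longrightarrow> A \<noteq> {} \<longrightarrow> \<not> unit_square (\<Prod>i\<in>A. v i))"
proof (cases "\<forall>i. v i \<noteq> 0")
  case True
  define h where "h i = sq_class (v i)" for i
  have us: "unit_square (\<Prod>i\<in>A. v i) \<longleftrightarrow> (\<Sum>i\<in>A. h i) = 0" if "finite A" for A
    using True that sq_class_eq_0_iff[of "\<Prod>i\<in>A. v i"] sq_class_prod[of A v]
    by (simp add: h_def prod_zero_iff)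
  have "inj h \<and> sq.independent (range h) \<longleftrightarrow> (\<forall>A. finite A \<longrightarrow> A \<noteq> {} \<longrightarrow> (\<Sum>i\<in>A. h i) \<noteq> 0)"
  proof (intro iffI conjI allI impI notI)
    fix A assume ind: "inj h \<and> sq.independent (range h)" and A: "finite A" "A \<noteq> {}" "(\<Sum>i\<in>A. h i) = 0"
    obtain i where i: "i \<in> A" using A by blast
    have "h i + (\<Sum>i\<in>A - {i}. h i) = 0" using A i by (simp add: sum.remove[of A i])
    then have "h i = (\<Sum>i\<in>A - {i}. h i)" by (rule iffD2[OF sqclass_eq_iff_add])
    also have "\<dots> \<in> sq.span (range h - {h i})"
      using ind by (intro sq.span_sum sq.span_base) (auto simp: inj_eq)
    finally show False using ind unfolding sq.dependent_def by blast
  next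
    assume no: "\<forall>A. finite A \<longrightarrow> A \<noteq> {} \<longrightarrow> (\<Sum>i\<in>A. h i) \<noteq> 0"
    show "inj h"
    proof (rule injI, rule ccontr)
      fix i j assume "h i = h j" "i \<noteq> j"
      then have "(\<Sum>i\<in>{i, j}. h i) = 0" by (simp add: sqclass_double)
      then show False using no[rule_format, of "{i, j}"] by simp
    qed
    assume "sq.dependent (range h)"
    then obtain i where "h i \<in> sq.span (range h - {h i})" unfolding sq.dependent_def by blast
    moreover have "range h - {h i} \<subseteq> h ` (UNIV - {i})" by blast
    ultimately have "h i \<in> sq.span (h ` (UNIV - {i}))" using sq.span_mono by blast
    then obtain A where A: "finite A" "A \<subseteq> UNIV - {i}" "h i = (\<Sum>i\<in>A. h i)" by (auto simp: sq_span_image_iff)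
    have "i \<notin> A" using A(2) by blast
    then have "(\<Sum>i\<in>insert i A. h i) = h i + (\<Sum>i\<in>A. h i)" using A(1) by simp
    also have "\<dots> = 0" using A(3) by (rule iffD1[OF sqclass_eq_iff_add])
    finally have "(\<Sum>i\<in>insert i A. h i) = 0" .
    then show False using no[rule_format, of "insert i A"] A(1) by simp
  qed
  then show ?thesis using True us unfolding sq_independent_family_def h_def by auto
qed (auto simp: sq_independent_family_def)

lemma lookup_bit: "Poly_Mapping.lookup a i = (if i \<in> Poly_Mapping.keys a then (1 :: bit) else 0)"
  by (auto simp: Poly_Mapping.in_keys_iff)

lemma keys_bit_inject: "Poly_Mapping.keys a = Poly_Mapping.keys (b :: nat \<Rightarrow>\<^sub>0 bit) \<Longrightarrow> a = b"
  by (rule poly_mapping_eqI) (simp add: lookup_bit)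

lemma ex_keys_bit: "finite A \<Longrightarrow> \<exists>a :: nat \<Rightarrow>\<^sub>0 bit. Poly_Mapping.keys a = A"
proof -
  assume "finite A"
  then have "Poly_Mapping.lookup (Abs_poly_mapping (\<lambda>i. if i \<in> A then 1 else (0 :: bit))) = (\<lambda>i. if i \<in> A then 1 else 0)"
    by (intro lookup_Abs_poly_mapping) simp
  then have "Poly_Mapping.keys (Abs_poly_mapping (\<lambda>i. if i \<in> A then 1 else (0 :: bit))) = A"
    by (auto simp: Poly_Mapping.in_keys_iff split: if_splits)
  then show ?thesis by blast
qed

lemma M_sub_eq: "M_sub a = rel_group (Poly_Mapping.keys a)"
proof -
  have "(\<Sum>i\<in>Poly_Mapping.keys a. Poly_Mapping.lookup a i * phi i \<sigma>) = chi (Poly_Mapping.keys a) \<sigma>"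
    if "\<sigma> \<in> Omega" for \<sigma>
    unfolding chi_def by (intro sum.cong) (auto simp: lookup_bit phi_eq_psum[OF that])
  then show ?thesis by (auto simp: M_sub_def rel_group_def)
qed

section \<open>The square class conditions as conditions on characters\<close>

context arboreal
begin

lemma unique_square_relation_iff:
  fixes a :: "nat \<Rightarrow>\<^sub>0 bit"
  defines "A \<equiv> Poly_Mapping.keys a"
  shows "unique_square_relation c a \<longleftrightarrow>
    G \<subseteq> rel_group A \<and> (\<forall>B. finite B \<longrightarrow> B \<noteq> {} \<longrightarrow> B \<noteq> A \<longrightarrow> (\<exists>g\<in>G. chi B g = 1))"
proof -
  have sub: "unit_square (orbit_prod c a) \<longleftrightarrow> G \<subseteq> rel_group A"
    unfolding orbit_prod_def unit_square_chi A_def using tree_subgroupD(1)[OF G_group] by (auto simp: rel_group_def)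
  have "(\<forall>a'. a' \<noteq> 0 \<and> a' \<noteq> a \<longrightarrow> \<not> unit_square (orbit_prod c a'))
    \<longleftrightarrow> (\<forall>B. finite B \<longrightarrow> B \<noteq> {} \<longrightarrow> B \<noteq> A \<longrightarrow> (\<exists>g\<in>G. chi B g = 1))"
  proof (intro iffI allI impI)
    fix B assume *: "\<forall>a'. a' \<noteq> 0 \<and> a' \<noteq> a \<longrightarrow> \<not> unit_square (orbit_prod c a')"
      and B: "finite B" "B \<noteq> {}" "B \<noteq> A"
    obtain b :: "nat \<Rightarrow>\<^sub>0 bit" where b: "Poly_Mapping.keys b = B" using ex_keys_bit[OF B(1)] by blast
    then have "b \<noteq> 0" "b \<noteq> a" using B by (auto simp: A_def)
    then have "\<not> unit_square (orbit_prod c b)" using * by blast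
    then show "\<exists>g\<in>G. chi B g = 1" unfolding orbit_prod_def unit_square_chi b by auto
  next
    fix a' assume *: "\<forall>B. finite B \<longrightarrow> B \<noteq> {} \<longrightarrow> B \<noteq> A \<longrightarrow> (\<exists>g\<in>G. chi B g = 1)" and a': "a' \<noteq> 0 \<and> a' \<noteq> a"
    have "Poly_Mapping.keys a' \<noteq> {}" "Poly_Mapping.keys a' \<noteq> A"
      using a' keys_bit_inject[of a' a] by (auto simp: A_def)
    then obtain g where "g \<in> G" "chi (Poly_Mapping.keys a') g = 1"
      using *[rule_format, OF finite_keys] by blast
    then show "\<not> unit_square (orbit_prod c a')" unfolding orbit_prod_def unit_square_chi by auto
  qed
  then show ?thesis unfolding unique_square_relation_def sub by simp
qed

definition qprod :: "nat set \<Rightarrow> letter \<Rightarrow> 'a alg_closure" where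
  "qprod A s = (\<Prod>i\<in>A. rprod (branch i s))"

lemma qprod_neq_0: "qprod A s \<noteq> 0"
  unfolding qprod_def using rprod_neq_0 by (cases "finite A") (auto simp: prod_zero_iff)

lemma separable_qprod: "separable_elt (qprod A s)"
  unfolding qprod_def by (intro separable_elt_prod separable_rprod)

lemma ac_auts_qprod:
  assumes "\<tau> \<in> ac_auts"
  shows "\<tau> (qprod A s) = sgnb (\<Sum>i\<in>A. psum (branch i s) (gal \<tau>)) * qprod A (flipb (portrait (gal \<tau>) []) s)"
  by (simp add: qprod_def ac_auts_simps[OF assms] ac_auts_rprod[OF assms]
      Omega_image_branch[OF gal_Omega[OF assms]] prod.distrib sgnb_sum)

text \<open>Every level of \<open>A\<close> is the union of its two halves. In particular
  \<open>d\<close> can only be \<open>\<plusminus> cprod A\<close>.\<close>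

lemma qprod_mult:
  assumes "0 \<notin> A" shows "qprod A Lx * qprod A Ly = cprod A"
  unfolding qprod_def cprod_def prod.distrib[symmetric]
proof (rule prod.cong)
  fix i assume "i \<in> A"
  then have "i \<ge> 1" using assms by (cases i) auto
  then show "rprod (branch i Lx) * rprod (branch i Ly) = rprod (words i)"
    unfolding rprod_def by (subst words_eq_branches[of i Lx], simp, subst prod.union_disjoint)
      (auto simp: branch_def finite_branch[unfolded branch_def])
qed simp

lemma qprod_square:
  assumes "0 \<notin> Poly_Mapping.keys a"
  shows "(qprod (Poly_Mapping.keys a) s)\<^sup>2 = P_factor f \<gamma> \<iota> a s"
proof -
  have "(qprod (Poly_Mapping.keys a) s)\<^sup>2 = (\<Prod>i\<in>Poly_Mapping.keys a. bval i s)"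
    unfolding qprod_def prod_power_distrib
  proof (rule prod.cong)
    fix i assume "i \<in> Poly_Mapping.keys a"
    then have "i \<ge> 1" using assms by (cases i) auto
    then show "(rprod (branch i s))\<^sup>2 = bval i s" by (rule rprod_branch_square)
  qed simp
  moreover have "Poly_Mapping.keys a - {0} = Poly_Mapping.keys a" using assms by blast
  moreover have l: "level_one_root f \<iota> s = th [s]" by (simp add: level_one_root_def th_def vert_def)
  ultimately show ?thesis unfolding P_factor_def l bval_def by simp
qed

text \<open>
  The square roots of the two candidates for \<open>c~\<^sub>a\<close>, one for each sign of \<open>d\<close>; Galois acts on
  them through \<open>psi\<close> and \<open>psi + phi\<^sub>0\<close>.
\<close>

definition ysum :: "nat set \<Rightarrow> bit \<Rightarrow> 'a alg_closure" where
  "ysum A e = qprod A Lx + sgnb e * qprod A Ly"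

lemma separable_sgnb: "separable_elt (sgnb e :: 'a alg_closure)"
  using separable_elt_to_ac[of 1] separable_elt_to_ac[of "-1"] by (cases e) auto

lemma separable_ysum: "separable_elt (ysum A e)"
  unfolding ysum_def by (intro separable_elt_add separable_elt_mult separable_sgnb separable_qprod)

text \<open>On \<open>rel_group A\<close> both halves contribute the same sign \<open>psi A\<close>.
  A flip of the root exchanges the two summands: this fixes the sum for \<open>e = 0\<close> and
  negates it for \<open>e = 1\<close>, hence the additional \<open>chi {0}\<close>.\<close>

lemma ac_auts_ysum:
  assumes t: "\<tau> \<in> ac_auts" and sub: "gal \<tau> \<in> rel_group A" and A: "0 \<notin> A"
  shows "\<tau> (ysum A e) = sgnb (psi A (gal \<tau>) + e * chi {0} (gal \<tau>)) * ysum A e"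
proof -
  have p: "chi {0} (gal \<tau>) = portrait (gal \<tau>) []" by (simp add: chi_def psum_def words_0)
  have "(\<Sum>i\<in>A. psum (branch i Ly) (gal \<tau>)) + psi A (gal \<tau>) = chi A (gal \<tau>)"
    unfolding psi_def chi_def sum.distrib[symmetric]
  proof (rule sum.cong)
    fix i assume "i \<in> A"
    then have "i \<ge> 1" using A by (cases i) auto
    then show "psum (branch i Ly) (gal \<tau>) + psum (branch i Lx) (gal \<tau>) = psum (words i) (gal \<tau>)"
      using psum_words_branches[of i _ Ly] by simp
  qed simp
  then have y: "(\<Sum>i\<in>A. psum (branch i Ly) (gal \<tau>)) = psi A (gal \<tau>)"
    using sub by (simp add: rel_group_def bit_add_eq_0_iff)
  have s: "\<tau> (sgnb e) = sgnb e" by (cases e) (simp_all add: ac_auts_simps[OF t])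
  have "\<tau> (ysum A e) = sgnb (psi A (gal \<tau>)) * (qprod A (flipb (portrait (gal \<tau>) []) Lx)
      + sgnb e * qprod A (flipb (portrait (gal \<tau>) []) Ly))"
    unfolding ysum_def ac_autsD(2,3)[OF t] ac_auts_qprod[OF t] y s
    by (simp add: psi_def algebra_simps)
  then show ?thesis unfolding p
    by (cases "portrait (gal \<tau>) []"; cases e) (simp_all add: ysum_def sgnb_add algebra_simps)
qed

lemma ysum_square:
  assumes "0 \<notin> A"
  shows "(ysum A e)\<^sup>2 = (qprod A Lx)\<^sup>2 + (qprod A Ly)\<^sup>2 + 2 * (sgnb e * cprod A)"
  unfolding qprod_mult[OF assms, symmetric] ysum_def
  by (cases e) (simp_all add: power2_eq_square algebra_simps)

text \<open>Multiplying by orbit elements adds level parities to the character of \<open>t\<close>,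
  so membership in the span says that \<open>psi A\<close> agrees on \<open>G\<close> with some
  \<open>chi B\<close>. The right-hand side is free of \<open>e\<close>: the choice of
  \<open>d\<close> does not matter.\<close>

lemma ctilde_in_span_iff:
  assumes A: "0 \<notin> A" and sub: "G \<subseteq> rel_group A" and t: "t \<noteq> 0" "(ysum A e)\<^sup>2 = to_ac t"
  shows "sq_class t \<in> sq.span (range (\<lambda>n. sq_class (c n))) \<longleftrightarrow> (\<exists>B. finite B \<and> (\<forall>\<sigma>\<in>G. psi A \<sigma> = chi B \<sigma>))"
proof -
  have y0: "ysum A e \<noteq> 0" using t by auto
  have us: "unit_square (t * (\<Prod>i\<in>B. c i)) \<longleftrightarrow> (\<forall>\<sigma>\<in>G. psi A \<sigma> + e * chi {0} \<sigma> + chi B \<sigma> = 0)" for B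
  proof (rule unit_square_character)
    show "separable_elt (ysum A e * cprod B)" by (intro separable_elt_mult separable_ysum separable_cprod)
    show "ysum A e * cprod B \<noteq> 0" using y0 cprod_neq_0 by simp
    show "(ysum A e * cprod B)\<^sup>2 = to_ac (t * (\<Prod>i\<in>B. c i))"
      unfolding power_mult_distrib t(2) cprod_square by simp
    fix \<tau> :: "'a alg_closure \<Rightarrow> 'a alg_closure" assume tau: "\<tau> \<in> ac_auts"
    then have "gal \<tau> \<in> rel_group A" using sub by blast
    then show "\<tau> (ysum A e * cprod B) = sgnb (psi A (gal \<tau>) + e * chi {0} (gal \<tau>) + chi B (gal \<tau>)) * (ysum A e * cprod B)"
      unfolding ac_autsD(3)[OF tau] ac_auts_ysum[OF tau _ A] ac_auts_cprod[OF tau]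
      by (simp add: ac_auts_ysum[OF tau _ A] sgnb_add)
  qed
  have "sq_class t = (\<Sum>i\<in>B. sq_class (c i)) \<longleftrightarrow> unit_square (t * (\<Prod>i\<in>B. c i))" if "finite B" for B
  proof -
    have nz: "(\<Prod>i\<in>B. c i) \<noteq> 0" using that c_neq_0 by (simp add: prod_zero_iff)
    have "sq_class t = (\<Sum>i\<in>B. sq_class (c i)) \<longleftrightarrow> sq_class t + sq_class (\<Prod>i\<in>B. c i) = 0"
      using c_neq_0 by (subst sq_class_prod) (auto simp flip: sqclass_eq_iff_add)
    also have "\<dots> \<longleftrightarrow> sq_class (t * (\<Prod>i\<in>B. c i)) = 0" using nz t(1) by (simp add: sq_class_mult)
    also have "\<dots> \<longleftrightarrow> unit_square (t * (\<Prod>i\<in>B. c i))" using nz t(1) by (intro sq_class_eq_0_iff) simp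
    finally show ?thesis .
  qed
  then have "sq_class t \<in> sq.span (range (\<lambda>n. sq_class (c n))) \<longleftrightarrow>
      (\<exists>B. finite B \<and> (\<forall>\<sigma>\<in>G. psi A \<sigma> + e * chi {0} \<sigma> + chi B \<sigma> = 0))"
    unfolding sq_span_image_iff us[symmetric] by auto
  also have "\<dots> \<longleftrightarrow> (\<exists>B. finite B \<and> (\<forall>\<sigma>\<in>G. psi A \<sigma> = chi B \<sigma>))"
  proof -
    \<comment> \<open>The sign of \<open>d\<close> changes the character by the parity at the root,
      that is, by the class of \<open>c_0\<close>, which is absorbed into \<open>B\<close>.\<close>
    define E where "E = (if e = 1 then {0} else {} :: nat set)"
    have E: "e * chi {0} \<sigma> = chi E \<sigma>" for \<sigma> by (cases e) (auto simp: E_def chi_def)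
    have *: "psi A \<sigma> + e * chi {0} \<sigma> + chi B \<sigma> = 0 \<longleftrightarrow> psi A \<sigma> = chi (sym_diff B E) \<sigma>" if "finite B" for B \<sigma>
      using chi_sym_diff[OF that, of E \<sigma>] unfolding E by (auto simp: E_def bit_add_eq_iff add_ac split: if_splits)
    show ?thesis
    proof
      assume "\<exists>B. finite B \<and> (\<forall>\<sigma>\<in>G. psi A \<sigma> + e * chi {0} \<sigma> + chi B \<sigma> = 0)"
      then obtain B where B: "finite B" "\<forall>\<sigma>\<in>G. psi A \<sigma> + e * chi {0} \<sigma> + chi B \<sigma> = 0" by blast
      then show "\<exists>B. finite B \<and> (\<forall>\<sigma>\<in>G. psi A \<sigma> = chi B \<sigma>)"
        using *[OF B(1)] by (intro exI[of _ "sym_diff B E"]) (auto simp: E_def)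
    next
      assume "\<exists>B. finite B \<and> (\<forall>\<sigma>\<in>G. psi A \<sigma> = chi B \<sigma>)"
      then obtain B where B: "finite B" "\<forall>\<sigma>\<in>G. psi A \<sigma> = chi B \<sigma>" by blast
      have f: "finite (sym_diff B E)" using B(1) by (auto simp: E_def)
      have "sym_diff (sym_diff B E) E = B" by blast
      then show "\<exists>B. finite B \<and> (\<forall>\<sigma>\<in>G. psi A \<sigma> + e * chi {0} \<sigma> + chi B \<sigma> = 0)"
        using *[OF f] B f by (intro exI[of _ "sym_diff B E"]) auto
    qed
  qed
  finally show ?thesis .
qed

lemma is_ctilde_ysum:
  assumes a: "0 \<notin> Poly_Mapping.keys a" and t: "is_ctilde f \<gamma> \<iota> a t"
  shows "t \<noteq> 0 \<and> (\<exists>e. (ysum (Poly_Mapping.keys a) e)\<^sup>2 = to_ac t)"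
proof -
  let ?A = "Poly_Mapping.keys a"
  obtain d where d: "(to_ac d)\<^sup>2 = (qprod ?A Lx)\<^sup>2 * (qprod ?A Ly)\<^sup>2" "t \<noteq> 0"
    "to_ac t = 2 * to_ac d + (qprod ?A Lx)\<^sup>2 + (qprod ?A Ly)\<^sup>2"
    using t unfolding is_ctilde_def qprod_square[OF a, symmetric] by blast
  have "(to_ac d)\<^sup>2 = (cprod ?A)\<^sup>2" using d(1) by (simp add: power_mult_distrib flip: qprod_mult[OF a])
  then have "to_ac d = sgnb 0 * cprod ?A \<or> to_ac d = sgnb 1 * cprod ?A" by (simp add: power2_eq_iff)
  then obtain e where "to_ac d = sgnb e * cprod ?A" by blast
  then have "(ysum ?A e)\<^sup>2 = to_ac t" using d(3) by (simp add: ysum_square[OF a])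
  then show ?thesis using d(2) by blast
qed

text \<open>The definition asks for \<open>t \<noteq> 0\<close>. One of the two candidates
  qualifies, because their square roots add up to \<open>2 * qprod A Lx\<close>, which is nonzero as
  the characteristic is not \<open>2\<close>.\<close>

lemma ex_ctilde:
  assumes a: "0 \<notin> Poly_Mapping.keys a" and sub: "G \<subseteq> rel_group (Poly_Mapping.keys a)"
  shows "\<exists>t. is_ctilde f \<gamma> \<iota> a t"
proof -
  let ?A = "Poly_Mapping.keys a"
  have "\<exists>e. ysum ?A e \<noteq> 0"
  proof (rule ccontr)
    assume "\<not> (\<exists>e. ysum ?A e \<noteq> 0)"
    then have "ysum ?A 0 + ysum ?A 1 = 0" by simp
    then have "2 * qprod ?A Lx = 0" by (simp add: ysum_def)
    then show False using two_neq_0 qprod_neq_0[of ?A Lx] by simp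
  qed
  then obtain e where e: "ysum ?A e \<noteq> 0" by blast
  have sq1: "sgnb b * sgnb b = (1 :: 'a alg_closure)" for b by (cases b) auto
  have "\<tau> ((ysum ?A e)\<^sup>2) = (ysum ?A e)\<^sup>2" if t: "\<tau> \<in> ac_auts" for \<tau>
  proof -
    have "gal \<tau> \<in> rel_group ?A" using sub t by blast
    then have "\<tau> (ysum ?A e) = sgnb (psi ?A (gal \<tau>) + e * chi {0} (gal \<tau>)) * ysum ?A e"
      by (rule ac_auts_ysum[OF t _ a])
    then show ?thesis unfolding ac_auts_simps[OF t] power_mult_distrib by (simp add: power2_eq_square sq1)
  qed
  then obtain t where t: "(ysum ?A e)\<^sup>2 = to_ac t"
    using separable_elt_fixed[of "(ysum ?A e)\<^sup>2"] separable_elt_mult[OF separable_ysum separable_ysum]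
    by (auto simp: power2_eq_square)
  have "\<tau> (cprod ?A) = cprod ?A" if t: "\<tau> \<in> ac_auts" for \<tau>
    using ac_auts_cprod[OF t, of ?A] sub t by (auto simp: rel_group_def)
  then obtain d0 where d0: "cprod ?A = to_ac d0" using separable_elt_fixed[OF separable_cprod] by blast
  define d where "d = sgnb e * d0"
  have s: "to_ac (sgnb e) = sgnb e" by (cases e) auto
  have d: "to_ac d = sgnb e * cprod ?A" by (simp add: d_def s d0)
  have "d \<noteq> 0" using d cprod_neq_0[of ?A] by (cases e) auto
  moreover have "(to_ac d)\<^sup>2 = P_factor f \<gamma> \<iota> a Lx * P_factor f \<gamma> \<iota> a Ly"
    unfolding d qprod_square[OF a, symmetric] qprod_mult[OF a, symmetric]
    by (cases e) (simp_all add: power_mult_distrib)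
  moreover have "to_ac t = 2 * to_ac d + P_factor f \<gamma> \<iota> a Lx + P_factor f \<gamma> \<iota> a Ly"
    unfolding d qprod_square[OF a, symmetric] t[symmetric] ysum_square[OF a] by (simp add: algebra_simps)
  moreover have "t \<noteq> 0" using t e by auto
  ultimately show ?thesis unfolding is_ctilde_def by blast
qed

lemma cond_b_iff:
  fixes a :: "nat \<Rightarrow>\<^sub>0 bit"
  defines "A \<equiv> Poly_Mapping.keys a"
  shows "cond_b f \<gamma> \<iota> a \<longleftrightarrow> 0 \<notin> A \<and> unique_square_relation c a \<and> (\<forall>B. finite B \<longrightarrow> (\<exists>g\<in>G. psi A g \<noteq> chi B g))"
proof (cases "0 \<notin> A \<and> unique_square_relation c a")
  case True
  then have A: "0 \<notin> Poly_Mapping.keys a" and sub: "G \<subseteq> rel_group (Poly_Mapping.keys a)"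
    unfolding unique_square_relation_iff A_def by auto
  have span: "sq_class t \<in> sq.span (range (\<lambda>n. sq_class (c n))) \<longleftrightarrow> (\<exists>B. finite B \<and> (\<forall>\<sigma>\<in>G. psi A \<sigma> = chi B \<sigma>))"
    if "is_ctilde f \<gamma> \<iota> a t" for t
    using is_ctilde_ysum[OF A that] ctilde_in_span_iff[OF A sub] unfolding A_def by blast
  have "(\<exists>t. is_ctilde f \<gamma> \<iota> a t \<and> sq_class t \<notin> sq.span (range (\<lambda>n. sq_class (c n))))
      \<longleftrightarrow> \<not> (\<exists>B. finite B \<and> (\<forall>\<sigma>\<in>G. psi A \<sigma> = chi B \<sigma>))"
    using span ex_ctilde[OF A sub] by blast
  then show ?thesis using True unfolding cond_b_def by (auto simp: lookup_bit A_def)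
next
  case False
  then show ?thesis unfolding cond_b_def by (auto simp: lookup_bit A_def)
qed

text \<open>If \<open>G\<close> is the full group, explicit elements witness all independence
  conditions. Conversely the conditions give agreement on every level, and closedness turns this
  into equality.\<close>

theorem im_rho_iff:
  fixes a :: "nat \<Rightarrow>\<^sub>0 bit"
  assumes a: "a \<noteq> 0" "a \<noteq> Poly_Mapping.single 0 1"
  shows "im_rho f \<iota> = M_sub a \<longleftrightarrow> cond_a f \<gamma> a \<or> cond_b f \<gamma> \<iota> a"
proof -
  define A where "A = Poly_Mapping.keys a"
  have "A \<noteq> {0}" using a(2) keys_bit_inject[of a "Poly_Mapping.single 0 1"] by (auto simp: A_def)
  then interpret R: relation_set A using a(1) by unfold_locales (auto simp: A_def)
  have ca: "cond_a f \<gamma> a \<longleftrightarrow> 0 \<in> A \<and> unique_square_relation c a"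
    unfolding cond_a_def by (auto simp: lookup_bit A_def)
  note cb = cond_b_iff[of a, folded A_def]
  note us = unique_square_relation_iff[of a, folded A_def]
  show ?thesis unfolding im_rho_eq M_sub_eq A_def[symmetric]
  proof
    assume G: "G = rel_group A"
    have "unique_square_relation c a" unfolding us unfolding G using R.rel_group_independent by blast
    moreover have "\<forall>B. finite B \<longrightarrow> (\<exists>g\<in>G. psi A g \<noteq> chi B g)" if "0 \<notin> A"
      unfolding G using R.rel_group_psi_independent[OF that] by blast
    ultimately show "cond_a f \<gamma> a \<or> cond_b f \<gamma> \<iota> a" unfolding ca cb by blast
  next
    assume cond: "cond_a f \<gamma> a \<or> cond_b f \<gamma> \<iota> a"
    then have u: "G \<subseteq> rel_group A" "\<And>B. finite B \<Longrightarrow> B \<noteq> {} \<Longrightarrow> B \<noteq> A \<Longrightarrow> \<exists>g\<in>G. chi B g = 1"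
      unfolding ca cb us by blast+
    have p: "\<exists>g\<in>G. psi A g \<noteq> chi B g" if "0 \<notin> A" "finite B" for B using cond that unfolding ca cb by blast
    show "G = rel_group A"
      using R.M_group u(1) R.rel_group_approx[OF G_group u p] G_closed by (rule same_level_closed)
  qed
qed

text \<open>The image is transitive on each level, so each iterate has a single Galois orbit of
  simple roots.\<close>

theorem stable_if_im_rho:
  assumes a: "a \<noteq> 0" "a \<noteq> Poly_Mapping.single 0 1" and im: "im_rho f \<iota> = M_sub a"
  shows "stable_poly f"
proof -
  define A where "A = Poly_Mapping.keys a"
  have "A \<noteq> {0}" using a(2) keys_bit_inject[of a "Poly_Mapping.single 0 1"] by (auto simp: A_def)
  then interpret R: relation_set A using a(1) by unfold_locales (auto simp: A_def)
  have G: "G = rel_group A" using im unfolding im_rho_eq M_sub_eq A_def .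
  have "irreducible (poly_iter f n)" for n
  proof (rule irreducible_if_transitive)
    show "rsquarefree (emb (poly_iter f n))" using separable[of n] by (simp add: separable_poly_def)
    show "\<exists>z. poly (emb (poly_iter f n)) z = 0"
      using F_iter_th[of "replicate n Lx"] by (auto simp: poly_emb_iter)
    fix z z' assume "poly (emb (poly_iter f n)) z = 0" "poly (emb (poly_iter f n)) z' = 0"
    then obtain w w' where w: "length w = n" "th w = z" "length w' = n" "th w' = z'"
      using ex_th unfolding poly_emb_iter by metis
    then obtain h where h: "h \<in> G" "h w = w'" using R.M_transitive[of w w'] unfolding G by auto
    then obtain \<tau> where t: "\<tau> \<in> ac_auts" "gal \<tau> w = w'" by auto
    then have "\<tau> z = z'" using gal(2)[OF t(1), of w] w by simp
    then show "\<exists>\<tau>\<in>ac_auts. \<tau> z = z'" using t(1) by blast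
  qed
  then show ?thesis unfolding stable_poly_def stable_wrt_def by (simp flip: poly_iter_Suc)
qed

section \<open>The case in which \<open>f\<close> splits into linear factors\<close>

lemma delta_square_iff: "(\<exists>u. u\<^sup>2 = \<delta>) \<longleftrightarrow> G \<subseteq> split_group"
proof -
  have "unit_square \<delta> \<longleftrightarrow> (\<forall>\<sigma>\<in>G. chi {0} \<sigma> = 0)" using unit_square_chi[of "{0}"] by (simp add: c_0)
  moreover have "unit_square \<delta> \<longleftrightarrow> (\<exists>u. u\<^sup>2 = \<delta>)" using c_neq_0[of 0] by (auto simp: unit_square_def c_0)
  ultimately show ?thesis using tree_subgroupD(1)[OF G_group] by (auto simp: rel_group_def)
qed

definition plus_letter :: "'a \<Rightarrow> letter" where
  "plus_letter u = (if to_ac u = rt [] then Lx else Ly)"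

lemma th_plus_letter:
  assumes "u\<^sup>2 = \<delta>"
  shows "th [plus_letter u] = to_ac (\<gamma> + u)" "th [flip (plus_letter u)] = to_ac (\<gamma> - u)"
proof -
  have "(to_ac u)\<^sup>2 = (rt [])\<^sup>2" using assms by (simp add: rt_square flip: to_ac_power)
  then have "to_ac u = rt [] \<or> to_ac u = - rt []" by (simp add: power2_eq_iff)
  then show "th [plus_letter u] = to_ac (\<gamma> + u)" "th [flip (plus_letter u)] = to_ac (\<gamma> - u)"
    by (auto simp: plus_letter_def th_Lx th_Ly)
qed

text \<open>Member \<open>(n, b)\<close> of the family belongs to a half of level
  \<open>n + 1\<close>. For \<open>n = 0\<close> the root of \<open>f\<close> enters with a plus
  sign, for \<open>n \<ge> 1\<close> with a minus sign; so the half attached to the sign of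
  \<open>u\<close> is reversed after the first step.\<close>

definition split_index :: "'a \<Rightarrow> nat \<times> bool \<Rightarrow> nat \<times> letter" where
  "split_index u = (\<lambda>(n, b). (Suc n, if (n = 0) = b then plus_letter u else flip (plus_letter u)))"

lemma split_family_eq:
  assumes "u\<^sup>2 = \<delta>" "split_index u p = (i, s)"
  shows "i \<ge> 1" "to_ac (split_family f \<gamma> u p) = (rprod (branch i s))\<^sup>2"
proof -
  obtain n b where p: "p = (n, b)" by (cases p)
  then have i: "i = Suc n" "s = (if (n = 0) = b then plus_letter u else flip (plus_letter u))"
    using assms(2) by (auto simp: split_index_def)
  then show "i \<ge> 1" by simp
  then have "(rprod (branch i s))\<^sup>2 = bval i s" by (rule rprod_branch_square)
  then show "to_ac (split_family f \<gamma> u p) = (rprod (branch i s))\<^sup>2"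
    using th_plus_letter[OF assms(1)] by (auto simp: p i bval_def split_family_def)
qed

lemma split_index_bij: "bij_betw (split_index u) UNIV ({1..} \<times> UNIV)"
proof (rule bij_betw_imageI)
  show "inj (split_index u)" by (rule injI) (auto simp: split_index_def split: if_splits)
  show "range (split_index u) = {1..} \<times> UNIV"
  proof (intro Set.set_eqI iffI)
    fix q :: "nat \<times> letter" assume "q \<in> {1..} \<times> UNIV"
    then obtain n s where q: "q = (Suc n, s)" by (cases q; cases "fst q") auto
    have "split_index u (n, (s = plus_letter u) = (n = 0)) = q"
      using letter_neq_iff[of s "plus_letter u"] by (auto simp: split_index_def q)
    then show "q \<in> range (split_index u)" by blast
  qed (auto simp: split_index_def)
qed

text \<open>No element of \<open>G\<close> exchanges the halves, so products of their square roots
  are multiplied by signs. The condition obtained does not contain \<open>u\<close>.\<close>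

lemma split_independent_iff:
  assumes u: "u\<^sup>2 = \<delta>"
  shows "sq_independent_family (split_family f \<gamma> u) \<longleftrightarrow>
    (\<forall>B. finite B \<longrightarrow> B \<noteq> {} \<longrightarrow> B \<subseteq> {1..} \<times> UNIV \<longrightarrow> (\<exists>g\<in>G. branch_chi B g = 1))"
proof -
  have sub: "G \<subseteq> split_group" using u delta_square_iff by blast
  let ?v = "split_family f \<gamma> u" and ?r = "\<lambda>(i, s). rprod (branch i s)"
  have v: "to_ac (?v p) = (?r (split_index u p))\<^sup>2" for p
    using split_family_eq(2)[OF u] by (cases "split_index u p") auto
  have "?v p \<noteq> 0" for p
    using v[of p] rprod_neq_0 by (cases "split_index u p") auto
  moreover have "unit_square (\<Prod>p\<in>C. ?v p) \<longleftrightarrow> (\<forall>\<sigma>\<in>G. branch_chi (split_index u ` C) \<sigma> = 0)" if "finite C" for C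
  proof (rule unit_square_character)
    let ?B = "split_index u ` C"
    have inj: "inj_on (split_index u) C" using split_index_bij[of u] by (auto simp: bij_betw_def inj_on_def)
    show "separable_elt (\<Prod>q\<in>?B. ?r q)" by (intro separable_elt_prod) (auto intro: separable_rprod)
    show "(\<Prod>q\<in>?B. ?r q) \<noteq> 0" using that rprod_neq_0 by (simp add: prod_zero_iff case_prod_beta)
    show "(\<Prod>q\<in>?B. ?r q)\<^sup>2 = to_ac (\<Prod>p\<in>C. ?v p)"
      by (simp add: to_ac_prod v prod_power_distrib prod.reindex[OF inj])
    fix \<tau> :: "'a alg_closure \<Rightarrow> 'a alg_closure" assume t: "\<tau> \<in> ac_auts"
    have "portrait (gal \<tau>) [] = 0" using sub t by (auto simp: split_group_iff)
    then have "\<tau> (rprod (branch i s)) = sgnb (psum (branch i s) (gal \<tau>)) * rprod (branch i s)" for i s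
      using ac_auts_rprod[OF t, of "branch i s"] Omega_image_branch[OF gal_Omega[OF t], of i s] by simp
    then show "\<tau> (\<Prod>q\<in>?B. ?r q) = sgnb (branch_chi ?B (gal \<tau>)) * (\<Prod>q\<in>?B. ?r q)"
      unfolding ac_auts_simps[OF t] branch_chi_def sgnb_sum prod.distrib[symmetric]
      by (intro prod.cong) auto
  qed
  ultimately have "sq_independent_family ?v \<longleftrightarrow>
      (\<forall>C. finite C \<longrightarrow> C \<noteq> {} \<longrightarrow> (\<exists>g\<in>G. branch_chi (split_index u ` C) g = 1))"
    unfolding sq_independent_family_iff by auto
  also have "\<dots> \<longleftrightarrow> (\<forall>B. finite B \<longrightarrow> B \<noteq> {} \<longrightarrow> B \<subseteq> {1..} \<times> UNIV \<longrightarrow> (\<exists>g\<in>G. branch_chi B g = 1))"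
  proof (intro iffI allI impI)
    fix B :: "(nat \<times> letter) set"
    assume *: "\<forall>C. finite C \<longrightarrow> C \<noteq> {} \<longrightarrow> (\<exists>g\<in>G. branch_chi (split_index u ` C) g = 1)"
      and B: "finite B" "B \<noteq> {}" "B \<subseteq> {1..} \<times> UNIV"
    obtain C where C: "finite C" "B = split_index u ` C"
      using finite_subset_image[OF B(1), of "split_index u" UNIV] B(3) split_index_bij[of u] unfolding bij_betw_def by auto
    then show "\<exists>g\<in>G. branch_chi B g = 1" using * B(2) by blast
  next
    fix C :: "(nat \<times> bool) set"
    assume *: "\<forall>B. finite B \<longrightarrow> B \<noteq> {} \<longrightarrow> B \<subseteq> {1..} \<times> UNIV \<longrightarrow> (\<exists>g\<in>G. branch_chi B g = 1)"
      and C: "finite C" "C \<noteq> {}"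
    have "split_index u ` C \<subseteq> {1..} \<times> UNIV" using split_index_bij[of u] unfolding bij_betw_def by blast
    then show "\<exists>g\<in>G. branch_chi (split_index u ` C) g = 1"
      using *[rule_format, of "split_index u ` C"] C by simp
  qed
  finally show ?thesis .
qed

text \<open>Sufficiency uses a single square root of \<open>\<delta>\<close>; by
  \<open>split_independent_iff\<close> the family of one root is independent exactly when that of
  the other is.\<close>

theorem im_rho_split_iff:
  "im_rho f \<iota> = M_sub (Poly_Mapping.single 0 1) \<longleftrightarrow>
     (\<exists>u. u\<^sup>2 = \<delta>) \<and> (\<forall>u. u\<^sup>2 = \<delta> \<longrightarrow> sq_independent_family (split_family f \<gamma> u))"
proof -
  have M: "M_sub (Poly_Mapping.single 0 1) = split_group" by (simp add: M_sub_eq)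
  show ?thesis unfolding im_rho_eq M
  proof
    assume G: "G = split_group"
    have "\<exists>u. u\<^sup>2 = \<delta>" unfolding delta_square_iff G by simp
    moreover have "sq_independent_family (split_family f \<gamma> u)" if "u\<^sup>2 = \<delta>" for u
      unfolding split_independent_iff[OF that] G using split_group_independent by blast
    ultimately show "(\<exists>u. u\<^sup>2 = \<delta>) \<and> (\<forall>u. u\<^sup>2 = \<delta> \<longrightarrow> sq_independent_family (split_family f \<gamma> u))" by blast
  next
    assume *: "(\<exists>u. u\<^sup>2 = \<delta>) \<and> (\<forall>u. u\<^sup>2 = \<delta> \<longrightarrow> sq_independent_family (split_family f \<gamma> u))"
    then obtain u where u: "u\<^sup>2 = \<delta>" "sq_independent_family (split_family f \<gamma> u)" by blast
    have sub: "G \<subseteq> split_group" using * delta_square_iff by blast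
    have ind: "\<And>B. finite B \<Longrightarrow> B \<noteq> {} \<Longrightarrow> B \<subseteq> {1..} \<times> UNIV \<Longrightarrow> \<exists>g\<in>G. branch_chi B g = 1"
      using u(2) unfolding split_independent_iff[OF u(1)] by blast
    show "G = split_group"
      using split_group_group sub split_group_approx[OF G_group sub ind] G_closed by (rule same_level_closed)
  qed
qed

text \<open>The roots of \<open>g v\<close> composed with an iterate are the labels of half a level,
  and \<open>split_group\<close> is transitive on each half.\<close>

theorem split_stable:
  assumes G: "G = split_group"
  shows "\<exists>g1 g2. f = g1 * g2 \<and> degree g1 = 1 \<and> degree g2 = 1 \<and> stable_wrt f g1 \<and> stable_wrt f g2"
proof -
  obtain u where u: "u\<^sup>2 = \<delta>" using delta_square_iff G by blast
  define g where "g v = [:- (\<gamma> + v), 1:]" for v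
  have fg: "f = g v * g (- v)" if "v\<^sup>2 = \<delta>" for v
    using that by (auto simp: f_def g_def power2_eq_square algebra_simps)
  have "stable_wrt f (g v)" if v: "v\<^sup>2 = \<delta>" for v
    unfolding stable_wrt_def
  proof (intro allI impI)
    fix n :: nat
    let ?p = "pcompose (g v) (poly_iter f n)" and ?s = "plus_letter v"
    have "poly (emb (g v)) x = x - to_ac (\<gamma> + v)" for x by (simp add: g_def)
    then have ev: "poly (emb ?p) z = 0 \<longleftrightarrow> (F ^^ n) z = th [?s]" for z
      unfolding emb_pcompose poly_pcompose poly_emb_iter th_plus_letter(1)[OF v] by simp
    \<comment> \<open>One further application of \<open>F\<close> reaches \<open>0\<close>, so
      \<open>z\<close> is a label on level \<open>n + 1\<close>; after \<open>n\<close> applications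
      only the letter next to the root is left, and it must be \<open>?s\<close>.\<close>
    have root: "\<exists>w. length w = Suc n \<and> last w = ?s \<and> th w = z" if z: "poly (emb ?p) z = 0" for z
    proof -
      have "(F ^^ Suc n) z = F (th [?s])" using z by (simp add: ev)
      then have "(F ^^ Suc n) z = 0" by (simp only: F_th th_Nil)
      then obtain w where w: "length w = Suc n" "th w = z" using ex_th by blast
      then have "w \<noteq> []" by auto
      then obtain x r where wr: "w = x @ [r]" by (cases w rule: rev_cases) auto
      have "th [r] = th [?s]" using F_iter_th_append[of x "[r]"] z w wr by (simp add: ev)
      then have "[r] = [?s]" by (intro th_inj) simp_all
      then show ?thesis using w wr by (intro exI[of _ w]) simp
    qed
    show "irreducible ?p"
    proof (rule irreducible_if_transitive)
      have "emb (poly_iter f (Suc n)) = emb ?p * emb (pcompose (g (- v)) (poly_iter f n))"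
        unfolding poly_iter_Suc by (subst fg[OF v]) (simp only: pcompose_mult emb_mult)
      then show "rsquarefree (emb ?p)"
        using separable[of "Suc n"] unfolding separable_poly_def by (intro rsquarefree_dvd[of _ "emb ?p"]) auto
      have "(F ^^ n) (th (replicate n Lx @ [?s])) = th [?s]" using F_iter_th_append[of "replicate n Lx" "[?s]"] by simp
      then show "\<exists>z. poly (emb ?p) z = 0" using ev by blast
      fix z z' assume "poly (emb ?p) z = 0" "poly (emb ?p) z' = 0"
      then obtain w w' where w: "length w = Suc n" "last w = ?s" "th w = z" "length w' = Suc n" "last w' = ?s" "th w' = z'"
        using root by metis
      then have "w \<noteq> []" by auto
      then obtain h where h: "h \<in> G" "h w = w'" using split_transitive[of w w'] w unfolding G by auto
      then obtain \<tau> where t: "\<tau> \<in> ac_auts" "gal \<tau> w = w'" by auto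
      then have "\<tau> z = z'" using gal(2)[OF t(1), of w] w by simp
      then show "\<exists>\<tau>\<in>ac_auts. \<tau> z = z'" using t(1) by blast
    qed
  qed
  then have "stable_wrt f (g u)" "stable_wrt f (g (- u))" using u by auto
  moreover have "degree (g v) = 1" for v by (simp add: g_def)
  ultimately show ?thesis using fg[OF u] by blast
qed

end

theorem theoremA:
  fixes \<gamma> \<delta> :: "'a::field" and f :: "'a poly"
    and \<iota> :: "nat \<times> 'a alg_closure \<Rightarrow> word" and a :: "nat \<Rightarrow>\<^sub>0 bit"
  assumes "CHAR('a) \<noteq> 2"
    and "f = [:- \<gamma>, 1:]\<^sup>2 - [:\<delta>:]"
    and "\<And>n. separable_poly (poly_iter f n)"
    and "tree_iso f \<iota>"
    and "a \<noteq> 0"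
  shows "(a \<noteq> Poly_Mapping.single 0 1 \<longrightarrow>
            (im_rho f \<iota> = M_sub a \<longleftrightarrow> cond_a f \<gamma> a \<or> cond_b f \<gamma> \<iota> a) \<and>
            (cond_a f \<gamma> a \<or> cond_b f \<gamma> \<iota> a \<longrightarrow> stable_poly f)) \<and>
         (a = Poly_Mapping.single 0 1 \<longrightarrow>
            (im_rho f \<iota> = M_sub a \<longleftrightarrow>
               (\<exists>u. u\<^sup>2 = \<delta>) \<and> (\<forall>u. u\<^sup>2 = \<delta> \<longrightarrow> sq_independent_family (split_family f \<gamma> u))) \<and>
            (im_rho f \<iota> = M_sub a \<or>
               (\<exists>u. u\<^sup>2 = \<delta>) \<and> (\<forall>u. u\<^sup>2 = \<delta> \<longrightarrow> sq_independent_family (split_family f \<gamma> u)) \<longrightarrow>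
             (\<exists>g1 g2. f = g1 * g2 \<and> degree g1 = 1 \<and> degree g2 = 1 \<and>
                stable_wrt f g1 \<and> stable_wrt f g2)))"
proof -
  interpret arboreal \<gamma> \<delta> f \<iota> using assms(1-4) by unfold_locales
  have split: "G = split_group" if "im_rho f \<iota> = M_sub (Poly_Mapping.single 0 1)"
    using that by (simp add: im_rho_eq M_sub_eq)
  show ?thesis
    using im_rho_iff[OF assms(5)] stable_if_im_rho[OF assms(5)] im_rho_split_iff split_stable[OF split] by blast
qed

end
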